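(* Let $G$ be a connected graph, and let $X_G$ be the 2-dimensional CW complex whose 1-skeleton is $G$ and which has exactly one 2-cell glued along every simple 3-cycle and every simple 4-cycle of $G$. Then there is an isomorphism of $\mathbb{Z}/2$-vector spaces $$\mathcal{H}_1(G) \cong H_1(X_G),$$ where $\mathcal{H}_1(G)$ is the first discrete homology group of $G$ with $\mathbb{Z}/2$-coefficients, and $H_1(X_G)$ is the first singular homology group of the topological space $X_G$ with $\mathbb{Z}/2$-coefficients.
   Context: All homology is taken with coefficients in $\mathbb{Z}/2$, and all vector spaces are over $\mathbb{Z}/2$. **Graphs.** A graph $G$ is a set $G_V$ of vertices with a reflexive and symmetric relation $\sim\ \subseteq G_V\times G_V$ (adjacency). So graphs are simple and undirected, with every vertex regarded as adjacent to itself. A graph map $f\colon G\to H$ is a function $f\colon G_V\to H_V$ preserving adjacency (since adjacency is reflexive, edges may be collapsed to vertices). The box product $G\,\square\, H$ has vertex set $G_V\times H_V$, with $(u,v)\sim(u',v')$ if and only if either $u=u'$ and $v\sim v'$, or $u\sim u'$ and $v=v'$. Let $I_1$ be the graph with vertices $0,1$ and an edge between them. The discrete $n$-hypercube is $I_1^{\square n}$, with vertices $(x_1,\dots,x_n)\in\{0,1\}^n$ ($I_1^{\square 0}$ is a single vertex). **Discrete homology.** A singular $n$-cube in $G$ is a graph map $A\colon I_1^{\square n}\to G$. For $n\ge 1$ and $1\le i\le n$, its faces are the singular $(n-1)$-cubes $$\delta_i^+A(x_1,\dots,x_{n-1})=A(x_1,\dots,x_{i-1},1,x_i,\dots,x_{n-1}),\qquad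 \delta_i^-A(x_1,\dots,x_{n-1})=A(x_1,\dots,x_{i-1},0,x_i,\dots,x_{n-1}).$$ $A$ is degenerate if $\delta_i^+A=\delta_i^-A$ for some $i$, and non-degenerate otherwise (all $0$-cubes are non-degenerate). $C_n(G)$ is the free $\mathbb{Z}/2$-vector space on the non-degenerate singular $n$-cubes in $G$, and the differential $\partial_n\colon C_n(G)\to C_{n-1}(G)$ is given on cubes by $$\partial_n(A)=\sum_{i=1}^n(-1)^i(\delta_i^-A-\delta_i^+A),$$ where degenerate faces are interpreted as $0$ (and $\partial_0=0$). This is a chain complex, and $\mathcal{H}_n(G)=\ker(\partial_n)/\operatorname{im}(\partial_{n+1})$. **Simple cycles.** For $n\ge3$, an $n$-cycle in $G$ is a sequence of distinct vertices $(v_0,\dots,v_{n-1})$ with $v_i\sim v_{i+1}$ for $0\le i\le n-2$ and $v_{n-1}\sim v_0$. It is simple if no proper subsequence of it of length at least $3$ is itself a cycle in this sense. Thus every 3-cycle is simple, and a 4-cycle is simple exactly when neither diagonal $v_0v_2$, $v_1v_3$ is an edge of $G$. **The complex $X_G$.** The 1-skeleton of $X_G$ is $G$ regarded as a 1-dimensional CW complex: one 0-cell for each vertex and one 1-cell for each unordered pair $\{u,v\}$ with $u\neq v$ and $u\sim v$ (the loops coming from reflexivity contribute no 1-cells). For each simple 3-cycle and each simple 4-cycle (cycles being identified up to cyclic rotation and reversal), a single 2-cell is attached along the closed edge path $v_0,v_1,\dots,v_{n-1},v_0$. There are no other cells. *)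

theory Defs
  imports
    "HOL-Analysis.Analysis"
    "HOL-Homology.Homology"
    "HOL-Library.Z2"
    "HOL-Library.Sublist"
begin

section \<open>Vector spaces over the two-element field\<close>

text \<open>The free vector space over the field \<^typ>\<open>bit\<close> on a set \<open>S\<close> consists of the elements of
  \<open>'x \<Rightarrow>\<^sub>0 bit\<close> whose support \<open>Poly_Mapping.keys\<close> lies in \<open>S\<close>. Quotients are recorded with the
  \<open>module\<close> record of HOL-Algebra, of which the fields \<open>mult\<close> and \<open>one\<close> carry no meaning here.\<close>

definition scale :: "bit \<Rightarrow> ('x \<Rightarrow>\<^sub>0 bit) \<Rightarrow> ('x \<Rightarrow>\<^sub>0 bit)" where
  "scale a c = Poly_Mapping.map ((*) a) c"

definition linear_extension :: "('x \<Rightarrow> ('y \<Rightarrow>\<^sub>0 bit)) \<Rightarrow> ('x \<Rightarrow>\<^sub>0 bit) \<Rightarrow> ('y \<Rightarrow>\<^sub>0 bit)" where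
  "linear_extension b c = (\<Sum>x\<in>Poly_Mapping.keys c. scale (Poly_Mapping.lookup c x) (b x))"

definition quotient_space ::
    "('x \<Rightarrow>\<^sub>0 bit) set \<Rightarrow> ('x \<Rightarrow>\<^sub>0 bit) set \<Rightarrow> (bit, ('x \<Rightarrow>\<^sub>0 bit) set) module" where
  "quotient_space Z B =
    \<lparr> carrier = {{z + b | b. b \<in> B} | z. z \<in> Z},
      mult = undefined, one = undefined,
      zero = B,
      add = (\<lambda>X Y. {x + y | x y. x \<in> X \<and> y \<in> Y}),
      smult = (\<lambda>a X. {scale a x + b | x b. x \<in> X \<and> b \<in> B}) \<rparr>"

definition linear_isos :: "(bit, 'v) module \<Rightarrow> (bit, 'w) module \<Rightarrow> ('v \<Rightarrow> 'w) set" where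
  "linear_isos M N =
    {h. bij_betw h (carrier M) (carrier N) \<and>
        (\<forall>x\<in>carrier M. \<forall>y\<in>carrier M. h (x \<oplus>\<^bsub>M\<^esub> y) = h x \<oplus>\<^bsub>N\<^esub> h y) \<and>
        (\<forall>a. \<forall>x\<in>carrier M. h (a \<odot>\<^bsub>M\<^esub> x) = a \<odot>\<^bsub>N\<^esub> h x)}"

section \<open>Reflexive graphs\<close>

record 'a rgraph =
  verts :: "'a set"
  adj :: "('a \<times> 'a) set"

definition graph :: "'a rgraph \<Rightarrow> bool" where
  "graph G \<longleftrightarrow> adj G \<subseteq> verts G \<times> verts G \<and> refl_on (verts G) (adj G) \<and> sym (adj G)"

definition connected_graph :: "'a rgraph \<Rightarrow> bool" where
  "connected_graph G \<longleftrightarrow> (\<forall>u\<in>verts G. \<forall>v\<in>verts G. (u, v) \<in> (adj G)\<^sup>*)"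

text \<open>Graph maps are extensional (equal to \<open>undefined\<close> off \<open>verts G\<close>), so that two of them are
  equal exactly if they agree on the vertices of \<open>G\<close>.\<close>

definition graph_maps :: "'a rgraph \<Rightarrow> 'b rgraph \<Rightarrow> ('a \<Rightarrow> 'b) set" where
  "graph_maps G H =
    {f \<in> verts G \<rightarrow>\<^sub>E verts H. \<forall>u v. (u, v) \<in> adj G \<longrightarrow> (f u, f v) \<in> adj H}"

definition box_product :: "'a rgraph \<Rightarrow> 'b rgraph \<Rightarrow> ('a \<times> 'b) rgraph" where
  "box_product G H =
    \<lparr> verts = verts G \<times> verts H,
      adj = {((u, v), (u', v')).
              (u = u' \<and> u \<in> verts G \<and> (v, v') \<in> adj H) \<or>
              ((u, u') \<in> adj G \<and> v = v' \<and> v \<in> verts H)} \<rparr>"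

text \<open>The vertices 0 and 1 of the interval graph are \<^term>\<open>False\<close> and \<^term>\<open>True\<close>.\<close>

definition interval_graph :: "bool rgraph" where
  "interval_graph = \<lparr> verts = UNIV, adj = UNIV \<rparr>"

text \<open>The iterated box product of the interval graph, its vertices \<open>(x1, (x2, ...))\<close> being
  written as lists \<open>[x1, ..., xn]\<close>.\<close>

primrec hypercube :: "nat \<Rightarrow> bool list rgraph" where
  "hypercube 0 = \<lparr> verts = {[]}, adj = {([], [])} \<rparr>"
| "hypercube (Suc n) =
    (let P = box_product interval_graph (hypercube n); f = (\<lambda>(x, xs). x # xs)
     in \<lparr> verts = f ` verts P, adj = map_prod f f ` adj P \<rparr>)"

section \<open>Discrete homology\<close>

definition cubes :: "nat \<Rightarrow> 'a rgraph \<Rightarrow> (bool list \<Rightarrow> 'a) set" where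
  "cubes n G = graph_maps (hypercube n) G"

text \<open>\<open>cube_face n i e A\<close> is the \<open>i\<close>-th face, \<open>1 \<le> i \<le> n\<close>, of the \<open>n\<close>-cube \<open>A\<close>; the positive
  face for \<open>e = True\<close>, the negative one for \<open>e = False\<close>.\<close>

definition cube_face :: "nat \<Rightarrow> nat \<Rightarrow> bool \<Rightarrow> (bool list \<Rightarrow> 'a) \<Rightarrow> bool list \<Rightarrow> 'a" where
  "cube_face n i e A =
    restrict (\<lambda>x. A (take (i - 1) x @ [e] @ drop (i - 1) x)) (verts (hypercube (n - 1)))"

definition degenerate :: "nat \<Rightarrow> (bool list \<Rightarrow> 'a) \<Rightarrow> bool" where
  "degenerate n A \<longleftrightarrow> (\<exists>i\<in>{1..n}. cube_face n i True A = cube_face n i False A)"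

definition cube_chains :: "nat \<Rightarrow> 'a rgraph \<Rightarrow> ((bool list \<Rightarrow> 'a) \<Rightarrow>\<^sub>0 bit) set" where
  "cube_chains n G = {c. Poly_Mapping.keys c \<subseteq> {A \<in> cubes n G. \<not> degenerate n A}}"

definition cube_chain_of :: "nat \<Rightarrow> (bool list \<Rightarrow> 'a) \<Rightarrow> ((bool list \<Rightarrow> 'a) \<Rightarrow>\<^sub>0 bit)" where
  "cube_chain_of n A = (if degenerate n A then 0 else Poly_Mapping.single A 1)"

definition cube_boundary ::
    "nat \<Rightarrow> ((bool list \<Rightarrow> 'a) \<Rightarrow>\<^sub>0 bit) \<Rightarrow> ((bool list \<Rightarrow> 'a) \<Rightarrow>\<^sub>0 bit)" where
  "cube_boundary n = linear_extension (\<lambda>A. \<Sum>i = 1..n. scale ((-1) ^ i)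
     (cube_chain_of (n - 1) (cube_face n i False A) - cube_chain_of (n - 1) (cube_face n i True A)))"

definition discrete_homology ::
    "nat \<Rightarrow> 'a rgraph \<Rightarrow> (bit, ((bool list \<Rightarrow> 'a) \<Rightarrow>\<^sub>0 bit) set) module" where
  "discrete_homology n G =
    quotient_space {c \<in> cube_chains n G. cube_boundary n c = 0}
                   (cube_boundary (n + 1) ` cube_chains (n + 1) G)"

section \<open>Singular homology with coefficients in the two-element field\<close>

text \<open>As \<^const>\<open>singular_chain\<close> and \<^const>\<open>chain_boundary\<close>, which have integer coefficients.\<close>

definition singular_chains2 ::
    "nat \<Rightarrow> 'p topology \<Rightarrow> (((nat \<Rightarrow> real) \<Rightarrow> 'p) \<Rightarrow>\<^sub>0 bit) set" where
  "singular_chains2 p X = {c. Poly_Mapping.keys c \<subseteq> singular_simplex_set p X}"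

definition singular_boundary2 ::
    "nat \<Rightarrow> (((nat \<Rightarrow> real) \<Rightarrow> 'p) \<Rightarrow>\<^sub>0 bit) \<Rightarrow> (((nat \<Rightarrow> real) \<Rightarrow> 'p) \<Rightarrow>\<^sub>0 bit)" where
  "singular_boundary2 p c =
    (if p = 0 then 0
     else linear_extension
       (\<lambda>f. \<Sum>k\<le>p. scale ((-1) ^ k) (Poly_Mapping.single (singular_face p k f) 1)) c)"

definition singular_homology2 ::
    "nat \<Rightarrow> 'p topology \<Rightarrow> (bit, (((nat \<Rightarrow> real) \<Rightarrow> 'p) \<Rightarrow>\<^sub>0 bit) set) module" where
  "singular_homology2 p X =
    quotient_space {c \<in> singular_chains2 p X. singular_boundary2 p c = 0}
                   (singular_boundary2 (p + 1) ` singular_chains2 (p + 1) X)"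

section \<open>Attaching cells\<close>

text \<open>The space obtained from \<open>X\<close> by attaching one copy of the cell \<open>D\<close> (with boundary
  \<open>S \<subseteq> topspace D\<close>) for each \<open>i \<in> I\<close>, along \<open>\<phi> i\<close> from \<open>S\<close> to \<open>X\<close>. Its points are those of \<open>X\<close>
  and those of the open cells; \<open>characteristic_map\<close> restricts to the attaching map on \<open>S\<close>. The
  topology is the quotient topology from the disjoint union of \<open>X\<close> and the copies of \<open>D\<close>.\<close>

definition characteristic_map :: "'d set \<Rightarrow> ('i \<Rightarrow> 'd \<Rightarrow> 'p) \<Rightarrow> 'i \<Rightarrow> 'd \<Rightarrow> 'p + 'i \<times> 'd" where
  "characteristic_map S \<phi> i y = (if y \<in> S then Inl (\<phi> i y) else Inr (i, y))"

definition attach_cells ::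
    "'p topology \<Rightarrow> 'd topology \<Rightarrow> 'd set \<Rightarrow> 'i set \<Rightarrow> ('i \<Rightarrow> 'd \<Rightarrow> 'p) \<Rightarrow> ('p + 'i \<times> 'd) topology" where
  "attach_cells X D S I \<phi> = topology (\<lambda>U.
     U \<subseteq> Inl ` topspace X \<union> Inr ` (I \<times> (topspace D - S)) \<and>
     openin X {x \<in> topspace X. Inl x \<in> U} \<and>
     (\<forall>i\<in>I. openin D {y \<in> topspace D. characteristic_map S \<phi> i y \<in> U}))"

lemma openin_attach_cells:
  "openin (attach_cells X D S I \<phi>) U \<longleftrightarrow>
     U \<subseteq> Inl ` topspace X \<union> Inr ` (I \<times> (topspace D - S)) \<and>
     openin X {x \<in> topspace X. Inl x \<in> U} \<and>
     (\<forall>i\<in>I. openin D {y \<in> topspace D. characteristic_map S \<phi> i y \<in> U})"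
proof -
  define q where "q \<equiv> characteristic_map S \<phi>"
  have Int: "{x \<in> T. f x \<in> U \<inter> V} = {x \<in> T. f x \<in> U} \<inter> {x \<in> T. f x \<in> V}"
    for T f U V by auto
  have Un: "{x \<in> T. f x \<in> \<Union>K} = (\<Union>U\<in>K. {x \<in> T. f x \<in> U})" for T f K by auto
  have "istopology (\<lambda>U.
     U \<subseteq> Inl ` topspace X \<union> Inr ` (I \<times> (topspace D - S)) \<and>
     openin X {x \<in> topspace X. Inl x \<in> U} \<and>
     (\<forall>i\<in>I. openin D {y \<in> topspace D. q i y \<in> U}))"
    unfolding istopology_def
  proof (intro conjI allI impI, goal_cases)
    case (2 U V) then show ?case unfolding Int by blast
  next
    case (3 U V) then show ?case unfolding Int by blast
  next
    case (5 K) then show ?case unfolding Un by blast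
  next
    case (6 K) then show ?case unfolding Un by blast
  qed blast+
  then show ?thesis
    unfolding attach_cells_def q_def by (simp add: topology_inverse')
qed

section \<open>The complex of a graph\<close>

definition edges :: "'a rgraph \<Rightarrow> 'a set set" where
  "edges G = {{u, v} | u v. u \<noteq> v \<and> (u, v) \<in> adj G}"

text \<open>An arbitrary orientation of each edge.\<close>

definition edge_ends :: "'a set \<Rightarrow> 'a \<times> 'a" where
  "edge_ends e = (SOME (u, v). e = {u, v})"

definition edge_attach :: "'a set \<Rightarrow> real \<Rightarrow> 'a" where
  "edge_attach e t = (if t = 0 then fst (edge_ends e) else snd (edge_ends e))"

definition one_skeleton :: "'a rgraph \<Rightarrow> ('a + 'a set \<times> real) topology" where
  "one_skeleton G =
    attach_cells (discrete_topology (verts G)) (top_of_set {0..1}) {0, 1} (edges G) edge_attach"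

text \<open>The edge from \<open>u\<close> to \<open>v\<close> (with \<open>u \<noteq> v\<close>) as a path in the one-skeleton.\<close>

definition edge_path :: "'a \<Rightarrow> 'a \<Rightarrow> real \<Rightarrow> 'a + 'a set \<times> real" where
  "edge_path u v t = characteristic_map {0, 1} edge_attach {u, v}
     (if edge_ends {u, v} = (u, v) then t else 1 - t)"

definition graph_cycle :: "'a rgraph \<Rightarrow> 'a list \<Rightarrow> bool" where
  "graph_cycle G vs \<longleftrightarrow>
     length vs \<ge> 3 \<and> distinct vs \<and> set vs \<subseteq> verts G \<and>
     (\<forall>i. i + 1 < length vs \<longrightarrow> (vs ! i, vs ! (i + 1)) \<in> adj G) \<and> (last vs, hd vs) \<in> adj G"

definition simple_cycle :: "'a rgraph \<Rightarrow> 'a list \<Rightarrow> bool" where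
  "simple_cycle G vs \<longleftrightarrow>
     graph_cycle G vs \<and> (\<forall>ws. strict_subseq ws vs \<and> length ws \<ge> 3 \<longrightarrow> \<not> graph_cycle G ws)"

text \<open>The class of a cycle up to rotation and reversal.\<close>

definition cycle_class :: "'a list \<Rightarrow> 'a list set" where
  "cycle_class vs = {rotate k vs | k. True} \<union> {rotate k (rev vs) | k. True}"

definition two_cells :: "'a rgraph \<Rightarrow> 'a list set set" where
  "two_cells G = {cycle_class vs | vs. simple_cycle G vs \<and> length vs \<in> {3, 4}}"

text \<open>The closed edge path along \<open>vs\<close> of length \<open>n\<close>, parametrised by the unit circle: the arc
  from \<open>cis (2 * pi * k / n)\<close> to \<open>cis (2 * pi * (k + 1) / n)\<close> runs along the edge from the
  \<open>k\<close>-th to the \<open>(k + 1)\<close>-st vertex, indices modulo \<open>n\<close>.\<close>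

definition cycle_loop :: "'a list \<Rightarrow> complex \<Rightarrow> 'a + 'a set \<times> real" where
  "cycle_loop vs z =
    (let n = length vs; s = real n * Arg2pi z / (2 * pi); k = nat \<lfloor>s\<rfloor>
     in edge_path (vs ! k) (vs ! ((k + 1) mod n)) (frac s))"

definition two_cell_attach :: "'a list set \<Rightarrow> complex \<Rightarrow> 'a + 'a set \<times> real" where
  "two_cell_attach C = cycle_loop (SOME vs. vs \<in> C)"

definition X_complex ::
    "'a rgraph \<Rightarrow> (('a + 'a set \<times> real) + 'a list set \<times> complex) topology" where
  "X_complex G =
    attach_cells (one_skeleton G) (top_of_set (cball 0 1)) (sphere 0 1) (two_cells G) two_cell_attach"

end

theory Submission
  imports Defs
begin

text \<open>
A graph edge \<open>uv\<close> is sent to the sum of the two halves of the edge path, running from \<open>u\<close> and from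
\<open>v\<close> to the midpoint. Triangles and squares bound in the complex, so this map \<open>Phi\<close> descends to
homology. For the inverse, cover the complex by the open 2-cells and by a contractible sector around
each vertex \<open>w\<close>: the open edges at \<open>w\<close>, and in each 2-cell with corner \<open>w\<close> the points of positive
radius whose angle to \<open>w\<close> is less than one side of the polygon. All points of a member of the cover
lie in cells that share a vertex. A singular 1-simplex from \<open>x\<close> to \<open>y\<close> inside such a member, with
shared vertex \<open>w\<close>, is sent to a graph path from a vertex of the cell of \<open>x\<close> via \<open>w\<close> to a vertex of
the cell of \<open>y\<close>. Vertices of a common cell have a common neighbour, and any closed walk of length 4
bounds in discrete homology; hence modulo boundaries the choices do not matter, and boundaries of
small 2-simplices are sent to boundaries. Barycentric subdivision makes chains small. A small cycle
is homologous to the image of its graph path because each member of the cover is null-homotopic in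
the complex.
Since cycles modulo two do not lift to integral cycles, subdivision is transferred from integral
chains by lifting and reducing, the error terms being divisible by two.
\<close>

section \<open>Linear algebra over the two-element field\<close>

text \<open>A discrete 2-cube is a closed walk of length four in which repetitions and standing
  still are allowed. Up to backtracking it traces nothing, a triangle or a 4-cycle, and a 4-cycle
  with a chord splits into two triangles; this is why the simple 3- and 4-cycles are the right ones
  to fill. The comparison works with singular simplices directly, in the manner of acyclic carriers:
  on both sides, whatever is supported near one vertex or in one closed cell bounds. The shape of
  the sectors comes from this. Half-angle one side means that on the boundary circle of a 2-cell the
  sector of a corner meets just the corner and the open sides at it. So it matches the open star in
  the graph, it is open in the complex, and it can be contracted compatibly with the edges. The
  obstacle is the continuity of that contraction: the graph may be infinite and the complex carries
  a quotient topology, so continuity of a homotopy has to be derived from its continuity on the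
  cells.\<close>

lemma bit_chain_add_self [simp]: "(c :: 'x \<Rightarrow>\<^sub>0 bit) + c = 0"
  by (rule poly_mapping_eqI) (simp add: lookup_add)

lemma bit_chain_add_self_left [simp]: "(c :: 'x \<Rightarrow>\<^sub>0 bit) + (c + d) = d"
  by (simp flip: add.assoc)

lemma bit_chain_minus [simp]: "- (c :: 'x \<Rightarrow>\<^sub>0 bit) = c"
  by (rule minus_unique) simp

lemma bit_chain_diff [simp]: "(c :: 'x \<Rightarrow>\<^sub>0 bit) - d = c + d"
  using diff_conv_add_uminus[of c d] by simp

lemma bit_chain_add_eq_0 [simp]: "(c :: 'x \<Rightarrow>\<^sub>0 bit) + d = 0 \<longleftrightarrow> c = d"
  using add_eq_0_iff[of c d] by auto

lemma scale_bit: "scale a c = (if a = 1 then c else 0)"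
  by (rule poly_mapping_eqI) (auto simp: scale_def map.rep_eq when_def bit_not_one_iff)

lemma scale_one [simp]: "scale 1 c = c"
  by (simp add: scale_bit)

lemma linear_extension_alt: "linear_extension b c = sum b (Poly_Mapping.keys c)"
  unfolding linear_extension_def
  by (rule sum.cong) (auto simp: scale_bit in_keys_iff bit_not_zero_iff)

lemma linear_extension_superset:
  assumes "finite S" "Poly_Mapping.keys c \<subseteq> S"
  shows "linear_extension b c = (\<Sum>x\<in>S. scale (Poly_Mapping.lookup c x) (b x))"
  unfolding linear_extension_def
  by (rule sum.mono_neutral_left) (use assms in \<open>auto simp: scale_bit in_keys_iff\<close>)

lemma linear_extension_add [simp]:
  "linear_extension b (c + d) = linear_extension b c + linear_extension b d"
proof -
  let ?S = "Poly_Mapping.keys c \<union> Poly_Mapping.keys d"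
  have "scale (Poly_Mapping.lookup (c + d) x) (b x)
      = scale (Poly_Mapping.lookup c x) (b x) + scale (Poly_Mapping.lookup d x) (b x)" for x
    by (cases "Poly_Mapping.lookup c x"; cases "Poly_Mapping.lookup d x")
       (simp_all add: scale_bit lookup_add)
  moreover have "Poly_Mapping.keys (c + d) \<subseteq> ?S"
    by (rule keys_add)
  ultimately show ?thesis
    by (simp add: linear_extension_superset[of ?S] sum.distrib)
qed

lemma linear_extension_0 [simp]: "linear_extension b 0 = 0"
  by (simp add: linear_extension_alt)

lemma linear_extension_single [simp]: "linear_extension b (Poly_Mapping.single x 1) = b x"
  by (simp add: linear_extension_alt)

lemma bit_chain_expansion: "(\<Sum>x\<in>Poly_Mapping.keys c. Poly_Mapping.single x (1::bit)) = c"
proof (rule poly_mapping_eqI)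
  fix x
  show "Poly_Mapping.lookup (\<Sum>x\<in>Poly_Mapping.keys c. Poly_Mapping.single x 1) x
      = Poly_Mapping.lookup c x"
    by (cases "Poly_Mapping.lookup c x")
       (auto simp: lookup_sum lookup_single when_def in_keys_iff)
qed

lemma bit_chain_induct [consumes 1, case_names zero single add]:
  fixes c :: "'x \<Rightarrow>\<^sub>0 bit"
  assumes "Poly_Mapping.keys c \<subseteq> S" and "P 0"
    and "\<And>x. x \<in> S \<Longrightarrow> P (Poly_Mapping.single x 1)"
    and "\<And>a b. P a \<Longrightarrow> P b \<Longrightarrow> P (a + b)"
  shows "P c"
proof -
  have "P (\<Sum>x\<in>K. Poly_Mapping.single x 1)" if "finite K" "K \<subseteq> S" for K
    using that by (induction K) (use assms in auto)
  from this[of "Poly_Mapping.keys c"] assms(1) show ?thesis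
    by (simp add: bit_chain_expansion)
qed

text \<open>The only scalars are 0 and 1, so these are exactly the linear subspaces.\<close>

definition additive_set :: "('x \<Rightarrow>\<^sub>0 bit) set \<Rightarrow> bool" where
  "additive_set B \<longleftrightarrow> 0 \<in> B \<and> (\<forall>x\<in>B. \<forall>y\<in>B. x + y \<in> B)"

lemma additive_set_0: "additive_set B \<Longrightarrow> 0 \<in> B"
  by (simp add: additive_set_def)

lemma additive_set_add: "additive_set B \<Longrightarrow> x \<in> B \<Longrightarrow> y \<in> B \<Longrightarrow> x + y \<in> B"
  by (simp add: additive_set_def)

lemma additive_set_cancel: "additive_set B \<Longrightarrow> x \<in> B \<Longrightarrow> x + y \<in> B \<longleftrightarrow> y \<in> B"
  by (metis additive_set_add bit_chain_add_self_left)

lemma additive_set_chains: "additive_set {c. Poly_Mapping.keys c \<subseteq> S}"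
  by (auto simp: additive_set_def dest: subsetD[OF keys_add])

lemma additive_set_kernel:
  assumes "additive_set C" "\<And>x y. f (x + y) = f x + f y"
  shows "additive_set {c \<in> C. f c = (0 :: 'y \<Rightarrow>\<^sub>0 bit)}"
proof -
  have "f 0 = 0"
    using assms(2)[of 0 0] by simp
  with assms show ?thesis
    by (auto simp: additive_set_def)
qed

lemma additive_set_image:
  fixes f :: "('x \<Rightarrow>\<^sub>0 bit) \<Rightarrow> ('y \<Rightarrow>\<^sub>0 bit)"
  assumes "additive_set C" "\<And>x y. f (x + y) = f x + f y"
  shows "additive_set (f ` C)"
proof -
  have "f 0 = 0"
    using assms(2)[of 0 0] by simp
  then have "0 \<in> f ` C"
    using assms(1) by (metis additive_set_0 imageI)
  moreover have "f x + f y \<in> f ` C" if "x \<in> C" "y \<in> C" for x y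
    using assms that by (metis additive_set_add imageI)
  ultimately show ?thesis
    by (auto simp: additive_set_def)
qed

subsection \<open>Isomorphisms of quotient spaces\<close>

definition coset :: "('x \<Rightarrow>\<^sub>0 bit) set \<Rightarrow> ('x \<Rightarrow>\<^sub>0 bit) \<Rightarrow> ('x \<Rightarrow>\<^sub>0 bit) set" where
  "coset B z = {z + b | b. b \<in> B}"

text \<open>Signs do not matter, so \<open>z + x\<close> stands for the difference.\<close>

lemma mem_coset: "x \<in> coset B z \<longleftrightarrow> z + x \<in> B"
  unfolding coset_def by (auto intro!: exI[of _ "z + x"])

lemma coset_eq_iff:
  assumes "additive_set B"
  shows "coset B x = coset B y \<longleftrightarrow> x + y \<in> B"
proof
  assume "coset B x = coset B y"
  moreover have "y \<in> coset B y"
    using assms by (simp add: mem_coset additive_set_0)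
  ultimately show "x + y \<in> B"
    by (metis mem_coset)
next
  assume xy: "x + y \<in> B"
  have "x + z \<in> B \<longleftrightarrow> y + z \<in> B" for z
    using additive_set_cancel[OF assms xy, of "y + z"] additive_set_cancel[OF assms xy, of "x + z"]
    by (simp add: add_ac)
  then show "coset B x = coset B y"
    by (auto simp: mem_coset)
qed

lemma coset_add:
  assumes "additive_set B"
  shows "{x + y |x y. x \<in> coset B u \<and> y \<in> coset B v} = coset B (u + v)"
proof (intro subset_antisym subsetI)
  fix z assume "z \<in> {x + y |x y. x \<in> coset B u \<and> y \<in> coset B v}"
  then obtain x y where "u + x \<in> B" "v + y \<in> B" "z = x + y"
    by (auto simp: mem_coset)
  then show "z \<in> coset B (u + v)"
    using additive_set_add[OF assms, of "u + x" "v + y"] by (simp add: mem_coset add_ac)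
next
  fix z assume "z \<in> coset B (u + v)"
  then have "u \<in> coset B u" "z + u \<in> coset B v"
    using assms by (auto simp: mem_coset additive_set_0 add_ac)
  moreover have "z = u + (z + u)"
    by (simp add: add_ac)
  ultimately show "z \<in> {x + y |x y. x \<in> coset B u \<and> y \<in> coset B v}"
    by blast
qed

lemma coset_scale:
  assumes "additive_set B"
  shows "{scale a x + b |x b. x \<in> coset B z \<and> b \<in> B} = coset B (scale a z)"
proof (cases "a = 1")
  case True
  have "{x + y |x y. x \<in> coset B z \<and> y \<in> coset B 0} = coset B (z + 0)"
    by (rule coset_add[OF assms])
  then show ?thesis
    using True by (simp add: scale_bit mem_coset)
next
  case False
  have "z + z \<in> B"
    using assms by (simp add: additive_set_0)
  then have "\<exists>x. z + x \<in> B"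
    by blast
  then show ?thesis
    using False by (auto simp: scale_bit mem_coset)
qed

text \<open>The equivalence \<open>inj\<close> does two jobs: one direction makes the induced map on
  cosets well defined, the other makes it injective. In \<open>surj\<close> the sum is a difference,
  so every class of the target is hit. Linearity reduces to additivity.\<close>

lemma quotient_space_iso:
  assumes Z: "additive_set Z" and B: "additive_set B"
    and Z': "additive_set Z'" and B': "additive_set B'"
    and add: "\<And>x y. \<Phi> (x + y) = \<Phi> x + \<Phi> y"
    and ZZ': "\<And>z. z \<in> Z \<Longrightarrow> \<Phi> z \<in> Z'"
    and inj: "\<And>z. z \<in> Z \<Longrightarrow> \<Phi> z \<in> B' \<longleftrightarrow> z \<in> B"
    and surj: "\<And>c. c \<in> Z' \<Longrightarrow> \<exists>z\<in>Z. c + \<Phi> z \<in> B'"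
  shows "\<exists>h. h \<in> linear_isos (quotient_space Z B) (quotient_space Z' B')"
proof -
  have carrier: "carrier (quotient_space Z B) = coset B ` Z" for Z B :: "('x \<Rightarrow>\<^sub>0 bit) set"
    by (auto simp: quotient_space_def coset_def)
  have coset': "coset B' (\<Phi> x) = coset B' (\<Phi> y) \<longleftrightarrow> coset B x = coset B y"
    if "x \<in> Z" "y \<in> Z" for x y
    using inj[of "x + y"] that Z B B' by (simp add: coset_eq_iff add additive_set_add)
  define h where "h X = coset B' (\<Phi> (SOME z. z \<in> Z \<and> X = coset B z))" for X
  have h: "h (coset B z) = coset B' (\<Phi> z)" if "z \<in> Z" for z
  proof -
    have "(SOME w. w \<in> Z \<and> coset B z = coset B w) \<in> Z \<and>
          coset B z = coset B (SOME w. w \<in> Z \<and> coset B z = coset B w)"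
      by (rule someI[of _ z]) (simp add: that)
    then show ?thesis
      using coset' that unfolding h_def by metis
  qed
  have scaleZ: "scale a z \<in> Z" and \<Phi>_scale: "\<Phi> (scale a z) = scale a (\<Phi> z)"
    if "z \<in> Z" for a z
    using that Z add[of 0 0] by (auto simp: scale_bit additive_set_0)
  have "inj_on h (coset B ` Z)"
    by (auto simp: inj_on_def h coset')
  moreover have "h ` (coset B ` Z) = coset B' ` Z'"
  proof (intro subset_antisym subsetI)
    fix X assume "X \<in> h ` (coset B ` Z)"
    then show "X \<in> coset B' ` Z'"
      by (auto simp: h ZZ')
  next
    fix X assume "X \<in> coset B' ` Z'"
    then obtain c where "c \<in> Z'" "X = coset B' c"
      by blast
    with surj B' show "X \<in> h ` (coset B ` Z)"
      by (force simp: coset_eq_iff image_iff h)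
  qed
  ultimately have "bij_betw h (carrier (quotient_space Z B)) (carrier (quotient_space Z' B'))"
    unfolding bij_betw_def
    using carrier[of Z B] by (simp add: quotient_space_def coset_def[abs_def] Setcompr_eq_image)
  moreover have "h (X \<oplus>\<^bsub>quotient_space Z B\<^esub> Y) = h X \<oplus>\<^bsub>quotient_space Z' B'\<^esub> h Y"
    if "X \<in> coset B ` Z" "Y \<in> coset B ` Z" for X Y
  proof -
    from that obtain x y where "x \<in> Z" "y \<in> Z" "X = coset B x" "Y = coset B y"
      by blast
    then show ?thesis
      unfolding quotient_space_def
      by (simp add: coset_add[OF B] coset_add[OF B'] h additive_set_add[OF Z] add)
  qed
  moreover have "h (a \<odot>\<^bsub>quotient_space Z B\<^esub> X) = a \<odot>\<^bsub>quotient_space Z' B'\<^esub> h X"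
    if "X \<in> coset B ` Z" for a X
  proof -
    from that obtain x where "x \<in> Z" "X = coset B x"
      by blast
    then show ?thesis
      unfolding quotient_space_def
      by (simp add: coset_scale[OF B] coset_scale[OF B'] h scaleZ \<Phi>_scale)
  qed
  ultimately show ?thesis
    unfolding linear_isos_def carrier[of Z B, symmetric] by blast
qed

section \<open>Reduction of integral singular chains modulo two\<close>

definition red :: "('x \<Rightarrow>\<^sub>0 int) \<Rightarrow> ('x \<Rightarrow>\<^sub>0 bit)" where
  "red = Poly_Mapping.map of_int"

text \<open>The section of \<open>red\<close> with coefficients 0 and 1. It is not additive and does
  not commute with boundaries, but the discrepancies lie in the kernel of \<open>red\<close>; and it
  keeps supports, hence smallness.\<close>

definition lift :: "('x \<Rightarrow>\<^sub>0 bit) \<Rightarrow> ('x \<Rightarrow>\<^sub>0 int)" where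
  "lift = Poly_Mapping.map (\<lambda>b. of_bool (b = 1))"

lemma lookup_red: "Poly_Mapping.lookup (red c) x = of_int (Poly_Mapping.lookup c x)"
  by (simp add: red_def map.rep_eq when_def)

lemma lookup_lift: "Poly_Mapping.lookup (lift c) x = of_bool (Poly_Mapping.lookup c x = 1)"
  by (simp add: lift_def map.rep_eq when_def)

lemma red_0 [simp]: "red 0 = 0"
  by (rule poly_mapping_eqI) (simp add: lookup_red)

lemma red_add [simp]: "red (a + b) = red a + red b"
  by (rule poly_mapping_eqI) (simp add: lookup_red lookup_add)

lemma red_diff [simp]: "red (a - b) = red a + red b"
  by (rule poly_mapping_eqI) (simp add: lookup_red lookup_minus lookup_add)

lemma red_sum [simp]: "red (sum f I) = (\<Sum>i\<in>I. red (f i))"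
  by (induction I rule: infinite_finite_induct) auto

lemma red_frag_of [simp]: "red (frag_of x) = Poly_Mapping.single x 1"
  by (rule poly_mapping_eqI) (simp add: lookup_red lookup_single when_def)

lemma red_sign [simp]: "red (frag_cmul ((- 1) ^ k) c) = red c"
  by (rule poly_mapping_eqI) (simp add: lookup_red lookup_frag_cmul)

lemma red_lift [simp]: "red (lift c) = c"
proof (rule poly_mapping_eqI)
  fix x
  show "Poly_Mapping.lookup (red (lift c)) x = Poly_Mapping.lookup c x"
    by (cases "Poly_Mapping.lookup c x") (simp_all add: lookup_red lookup_lift)
qed

lemma keys_red: "Poly_Mapping.keys (red c) \<subseteq> Poly_Mapping.keys c"
  by (auto simp: in_keys_iff lookup_red)

lemma keys_lift: "Poly_Mapping.keys (lift c) = Poly_Mapping.keys c"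
  by (auto simp: in_keys_iff lookup_lift bit_not_zero_iff split: if_splits)

text \<open>Even coefficients can be halved. The form \<open>e + e\<close> is convenient because an
  additive operator maps it to a chain of the same form, which \<open>red\<close> kills.\<close>

lemma red_eq_0D:
  assumes "red c = 0"
  obtains e where "c = e + e"
proof
  have ev: "even (Poly_Mapping.lookup c x)" for x
    using assms by (metis even_of_int_iff lookup_red lookup_zero even_zero)
  have "Poly_Mapping.lookup c x = Poly_Mapping.lookup (Poly_Mapping.map (\<lambda>n. n div 2) c) x
      + Poly_Mapping.lookup (Poly_Mapping.map (\<lambda>n. n div 2) c) x" for x
    using ev[of x] by (auto simp: map.rep_eq when_def)
  then show "c = Poly_Mapping.map (\<lambda>n. n div 2) c + Poly_Mapping.map (\<lambda>n. n div 2) c"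
    by (intro poly_mapping_eqI) (simp add: lookup_add)
qed

section \<open>Singular boundaries modulo two and null-homotopic cycles\<close>

lemma singular_boundary2_add [simp]:
  "singular_boundary2 p (c + d) = singular_boundary2 p c + singular_boundary2 p d"
  by (simp add: singular_boundary2_def)

lemma singular_boundary2_0 [simp]: "singular_boundary2 p 0 = 0"
  by (simp add: singular_boundary2_def)

lemma red_chain_boundary: "red (chain_boundary p c) = singular_boundary2 p (red c)"
proof -
  have "Poly_Mapping.keys c \<subseteq> UNIV"
    by simp
  then show ?thesis
    by (induction c rule: frag_induction)
      (auto simp: chain_boundary_of chain_boundary_diff singular_boundary2_def sum.atMost_Suc)
qed

lemma singular_chains2_iff: "c \<in> singular_chains2 p X \<longleftrightarrow> singular_chain p X (lift c)"
  by (simp add: singular_chains2_def singular_chain_def keys_lift)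

lemma red_singular_chain: "singular_chain p X c \<Longrightarrow> red c \<in> singular_chains2 p X"
  using keys_red by (force simp: singular_chains2_def singular_chain_def)

lemma additive_singular_chains2: "additive_set (singular_chains2 p X)"
  unfolding singular_chains2_def by (rule additive_set_chains)

definition singular_boundaries2 :: "nat \<Rightarrow> 'p topology \<Rightarrow> (((nat \<Rightarrow> real) \<Rightarrow> 'p) \<Rightarrow>\<^sub>0 bit) set" where
  "singular_boundaries2 p X = singular_boundary2 (Suc p) ` singular_chains2 (Suc p) X"

lemma additive_singular_boundaries2: "additive_set (singular_boundaries2 p X)"
  unfolding singular_boundaries2_def
  by (rule additive_set_image[OF additive_singular_chains2]) simp

lemma red_singular_boundary:
  assumes "singular_relboundary p X {} c"
  shows "red c \<in> singular_boundaries2 p X"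
  using assms red_singular_chain unfolding singular_boundary singular_boundaries2_def
  by (metis imageI red_chain_boundary)

text \<open>Homotopy invariance of integral homology compares \<open>f\<close> with a constant map,
  whose image of \<open>c\<close> lives in a one-point space, where 1-cycles bound. Hence
  \<open>c\<close> has to be a cycle over the integers, and reduction comes last.\<close>

lemma null_homotopic_cycle_bounds:
  assumes hom: "homotopic_with (\<lambda>_. True) S X f (\<lambda>_. a)"
    and c: "singular_chain 1 S c" "chain_boundary 1 c = 0"
  shows "red (chain_map 1 f c) \<in> singular_boundaries2 1 X"
\<comment> \<open>Treated apart because a point of \<open>S\<close> is used to see that
  \<open>a\<close> lies in \<open>X\<close>.\<close>
proof (cases "topspace S = {}")
  case True
  then have "c = 0"
    using c singular_chain_empty by metis
  then show ?thesis
    using additive_set_0[OF additive_singular_boundaries2] by simp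
next
  case False
  have a: "a \<in> topspace X"
    using homotopic_with_imp_continuous_maps[OF hom] False
    by (auto simp: continuous_map_const)
  have cyc: "singular_relcycle 1 S {} c"
    using c by (simp add: singular_cycle)
  have "homotopic_with (\<lambda>h. h \<in> {} \<rightarrow> {}) S X f (\<lambda>_. a)"
    using hom by simp
  then have rel: "homologous_rel 1 X {} (chain_map 1 f c) (chain_map 1 (\<lambda>_. a) c)"
    using cyc by (rule homotopic_imp_homologous_rel_chain_maps)
  have top: "topspace (subtopology X {a}) = {a}"
    using a by auto
  have "continuous_map S (subtopology X {a}) (\<lambda>_. a)"
    using a by (simp add: continuous_map_in_subtopology)
  then have "singular_chain 1 (subtopology X {a}) (chain_map 1 (\<lambda>_. a) c)"
    using c singular_chain_chain_map by blast
  then have "singular_relboundary 1 (subtopology X {a}) {} (chain_map 1 (\<lambda>_. a) c)"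
    by (simp add: singular_boundary_singleton[OF top])
  then have "singular_relboundary 1 X {} (chain_map 1 (\<lambda>_. a) c)"
    using singular_boundary_mono[of "{a}" "topspace X" 1 X] a by simp
  with rel have "singular_relboundary 1 X {} (chain_map 1 f c)"
    unfolding homologous_rel_def
    by (metis diff_add_cancel singular_relboundary_add)
  then show ?thesis
    by (rule red_singular_boundary)
qed

subsection \<open>Paths as singular 1-simplices\<close>

abbreviation gen :: "((nat \<Rightarrow> real) \<Rightarrow> 'p) \<Rightarrow> ((nat \<Rightarrow> real) \<Rightarrow> 'p) \<Rightarrow>\<^sub>0 bit" where
  "gen f \<equiv> Poly_Mapping.single f 1"

definition basis :: "nat \<Rightarrow> nat \<Rightarrow> real" where
  "basis i = (\<lambda>j. if j = i then 1 else 0)"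

lemma basis_mem [simp]: "basis i \<in> standard_simplex p \<longleftrightarrow> i \<le> p"
  unfolding basis_def by (rule basis_in_standard_simplex)

definition point_simplex :: "'p \<Rightarrow> (nat \<Rightarrow> real) \<Rightarrow> 'p" where
  "point_simplex p = restrict (\<lambda>_. p) (standard_simplex 0)"

text \<open>The coordinate \<open>x 1\<close> identifies the standard 1-simplex with the unit
  interval, running from \<open>basis 0\<close> to \<open>basis 1\<close>.\<close>

definition path_simplex :: "(real \<Rightarrow> 'p) \<Rightarrow> (nat \<Rightarrow> real) \<Rightarrow> 'p" where
  "path_simplex g = restrict (\<lambda>x. g (x 1)) (standard_simplex 1)"

lemma path_simplex_ends [simp]:
  "path_simplex g (basis 0) = g 0" "path_simplex g (basis 1) = g 1"
    "path_simplex g (basis (Suc 0)) = g 1"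
  by (simp_all add: path_simplex_def) (simp_all add: basis_def)

lemma path_simplex_image:
  "path_simplex g ` standard_simplex 1 \<subseteq> g ` {0..1}"
  by (auto simp: path_simplex_def standard_simplex_def)

lemma singular_simplex_path_simplex:
  assumes "continuous_map (top_of_set {0..1}) X g"
  shows "singular_simplex 1 X (path_simplex g)"
proof -
  have "continuous_map (subtopology (powertop_real UNIV) (standard_simplex 1))
          (top_of_set {0..1}) (\<lambda>x. x 1)"
    by (auto simp: continuous_map_in_subtopology standard_simplex_def
        intro: continuous_map_product_projection continuous_map_from_subtopology)
  from continuous_map_compose[OF this assms] show ?thesis
    by (simp add: singular_simplex_def path_simplex_def o_def)
qed

lemma path_simplex_cong:
  "(\<And>t. 0 \<le> t \<Longrightarrow> t \<le> 1 \<Longrightarrow> g t = h t) \<Longrightarrow> path_simplex g = path_simplex h"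
  unfolding path_simplex_def by (rule restrict_ext) (simp add: standard_simplex_def)

lemma path_simplex_mem:
  "(\<And>t. 0 \<le> t \<Longrightarrow> t \<le> 1 \<Longrightarrow> g t \<in> U) \<Longrightarrow> path_simplex g \<in> standard_simplex 1 \<rightarrow> U"
  using path_simplex_image[of g] by fastforce

lemma singular_simplex_path_in:
  assumes "continuous_on {0..1} g" "\<And>t. 0 \<le> t \<Longrightarrow> t \<le> 1 \<Longrightarrow> g t \<in> T"
  shows "singular_simplex 1 (top_of_set T) (path_simplex g)"
  using assms by (intro singular_simplex_path_simplex) (auto simp: continuous_map_in_subtopology)

lemma simplex_map_id_simplex: "singular_simplex p S f \<Longrightarrow> simplex_map p id f = f"
  by (simp add: simplex_map_def singular_simplex_def extensional_restrict)

lemma singular_simplex_mem: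
  "singular_simplex p X f \<Longrightarrow> s \<in> standard_simplex p \<Longrightarrow> f s \<in> topspace X"
  by (auto simp: singular_simplex_def continuous_map_def)

lemma simplex_map_path_simplex:
  "simplex_map 1 \<kappa> (path_simplex g) = path_simplex (\<kappa> \<circ> g)"
  by (auto simp: simplex_map_def path_simplex_def)

lemma simplical_face_basis:
  "simplical_face k (basis i) = basis (if i < k then i else Suc i)"
  by (auto simp: simplical_face_def basis_def fun_eq_iff)

lemma singular_face_basis:
  "i < p \<Longrightarrow> singular_face p k f (basis i) = f (basis (if i < k then i else Suc i))"
  by (auto simp: singular_face_def simplical_face_basis)

lemma singular_face_1: "singular_face 1 k f = point_simplex (f (basis (if k = 0 then 1 else 0)))"
proof -
  have "standard_simplex 0 = {basis 0}"
    by (simp add: standard_simplex_0 basis_def)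
  then show ?thesis
    unfolding singular_face_def point_simplex_def
    by (intro extensionalityI[of _ "{basis 0}"]) (auto simp: simplical_face_basis)
qed

lemma chain_boundary_1:
  "chain_boundary 1 (frag_of f) = frag_of (point_simplex (f (basis 1))) - frag_of (point_simplex (f (basis 0)))"
  using singular_face_1[of 0 f] singular_face_1[of 1 f] by (simp add: chain_boundary_of)

lemma singular_boundary2_1:
  "singular_boundary2 1 (Poly_Mapping.single f 1)
     = Poly_Mapping.single (point_simplex (f (basis 0))) 1 + Poly_Mapping.single (point_simplex (f (basis 1))) 1"
  using red_chain_boundary[of 1 "frag_of f"] unfolding chain_boundary_1 by (simp add: add.commute)

lemma singular_boundary2_2:
  "singular_boundary2 (Suc 1) (Poly_Mapping.single f 1)
     = Poly_Mapping.single (singular_face 2 0 f) 1 + Poly_Mapping.single (singular_face 2 1 f) 1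
       + Poly_Mapping.single (singular_face 2 2 f) 1"
  by (simp add: singular_boundary2_def numeral_2_eq_2)

lemma null_homotopic_triangle:
  assumes hom: "homotopic_with (\<lambda>_. True) S X \<kappa> (\<lambda>_. a)"
    and "singular_simplex 1 S f" "singular_simplex 1 S g" "singular_simplex 1 S k"
    and ends: "f (basis 0) = k (basis 0)" "f (basis 1) = g (basis 0)" "g (basis 1) = k (basis 1)"
  shows "gen (simplex_map 1 \<kappa> f) + gen (simplex_map 1 \<kappa> g) + gen (simplex_map 1 \<kappa> k)
           \<in> singular_boundaries2 1 X"
proof -
  \<comment> \<open>With this sign the loop is a cycle over the integers; \<open>red\<close> removes
    the sign.\<close>
  define c where "c = frag_of f + frag_of g - frag_of k"
  have "singular_chain 1 S c"
    unfolding c_def using assms(2-4)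
    by (intro singular_chain_diff singular_chain_add) (simp_all add: singular_chain_of)
  moreover have "chain_boundary 1 c = 0"
    unfolding c_def chain_boundary_diff chain_boundary_add chain_boundary_1 ends by simp
  ultimately have "red (chain_map 1 \<kappa> c) \<in> singular_boundaries2 1 X"
    using null_homotopic_cycle_bounds[OF hom] by blast
  then show ?thesis
    unfolding c_def by (simp add: chain_map_diff chain_map_add)
qed

text \<open>Two broken paths with the same ends, \<open>f\<close> followed by \<open>g\<close> and
  \<open>k\<close> followed by \<open>h\<close>. This is the form in which two rays are compared
  with the two halves of an edge.\<close>

lemma null_homotopic_quadrangle:
  assumes hom: "homotopic_with (\<lambda>_. True) S X \<kappa> (\<lambda>_. a)"
    and "singular_simplex 1 S f" "singular_simplex 1 S g" "singular_simplex 1 S h" "singular_simplex 1 S k"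
    and ends: "f (basis 0) = k (basis 0)" "f (basis 1) = g (basis 0)"
      "g (basis 1) = h (basis 1)" "h (basis 0) = k (basis 1)"
  shows "gen (simplex_map 1 \<kappa> f) + gen (simplex_map 1 \<kappa> g)
       + (gen (simplex_map 1 \<kappa> h) + gen (simplex_map 1 \<kappa> k)) \<in> singular_boundaries2 1 X"
proof -
  define c where "c = frag_of f + frag_of g - (frag_of h + frag_of k)"
  have "singular_chain 1 S c"
    unfolding c_def using assms(2-5)
    by (intro singular_chain_diff singular_chain_add) (simp_all add: singular_chain_of)
  moreover have "chain_boundary 1 c = 0"
    unfolding c_def chain_boundary_diff chain_boundary_add chain_boundary_1 ends by simp
  ultimately have "red (chain_map 1 \<kappa> c) \<in> singular_boundaries2 1 X"
    using null_homotopic_cycle_bounds[OF hom] by blast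
  then show ?thesis
    unfolding c_def by (simp add: chain_map_diff chain_map_add)
qed

subsection \<open>Chains of small simplices\<close>

definition small_chains2 :: "'p set set \<Rightarrow> nat \<Rightarrow> 'p topology \<Rightarrow> (((nat \<Rightarrow> real) \<Rightarrow> 'p) \<Rightarrow>\<^sub>0 bit) set" where
  "small_chains2 \<C> p X =
     {c. Poly_Mapping.keys c \<subseteq> {f. singular_simplex p X f \<and> (\<exists>V\<in>\<C>. f \<in> standard_simplex p \<rightarrow> V)}}"

lemma small_chains2_subset: "small_chains2 \<C> p X \<subseteq> singular_chains2 p X"
  by (auto simp: small_chains2_def singular_chains2_def)

lemma additive_small_chains2: "additive_set (small_chains2 \<C> p X)"
  unfolding small_chains2_def by (rule additive_set_chains)

lemma singular_chain_iterated_subdivision: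
  "singular_chain p X c \<Longrightarrow> singular_chain p X ((singular_subdivision p ^^ n) c)"
  by (induction n) (simp_all add: singular_chain_singular_subdivision)

lemma chain_boundary_iterated_subdivision:
  assumes "singular_chain p X c"
  shows "chain_boundary p ((singular_subdivision p ^^ n) c)
       = (singular_subdivision (p - Suc 0) ^^ n) (chain_boundary p c)"
proof (induction n)
  case (Suc n)
  then show ?case
    using chain_boundary_singular_subdivision[OF singular_chain_iterated_subdivision[OF assms, of n]]
    by simp
qed simp

lemma iterated_subdivision_add:
  "(singular_subdivision p ^^ n) (a + b) = (singular_subdivision p ^^ n) a + (singular_subdivision p ^^ n) b"
  by (induction n) (simp_all add: singular_subdivision_add)

lemma exists_small_subdivision:
  assumes "\<And>U. U \<in> \<C> \<Longrightarrow> openin X U" "topspace X \<subseteq> \<Union>\<C>" "singular_chain p X c"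
  obtains n where "red ((singular_subdivision p ^^ n) c) \<in> small_chains2 \<C> p X"
proof -
  obtain n where n: "\<And>m f. \<lbrakk>n \<le> m; f \<in> Poly_Mapping.keys ((singular_subdivision p ^^ m) c)\<rbrakk>
      \<Longrightarrow> \<exists>V \<in> \<C>. f \<in> (standard_simplex p) \<rightarrow> V"
    using sufficient_iterated_singular_subdivision_exists[of \<C> X p c] assms by metis
  have "Poly_Mapping.keys (red ((singular_subdivision p ^^ n) c))
      \<subseteq> Poly_Mapping.keys ((singular_subdivision p ^^ n) c)"
    by (rule keys_red)
  also have "\<dots> \<subseteq> {f. singular_simplex p X f \<and> (\<exists>V\<in>\<C>. f \<in> standard_simplex p \<rightarrow> V)}"
    using singular_chain_iterated_subdivision[OF assms(3), of n] n[of n]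
    unfolding singular_chain_def by blast
  finally show thesis
    using that[of n] by (simp add: small_chains2_def)
qed

text \<open>The integral lift of \<open>c\<close> has a boundary of the form \<open>e + e\<close>.
  The boundary term in the chain homotopy from the identity to iterated subdivision is then a double
  as well. So modulo two the subdivided chain is a cycle and differs from \<open>c\<close> by a
  boundary.\<close>

lemma homologous_small_cycle:
  assumes \<C>: "\<And>U. U \<in> \<C> \<Longrightarrow> openin X U" "topspace X \<subseteq> \<Union>\<C>"
    and c: "c \<in> singular_chains2 1 X" "singular_boundary2 1 c = 0"
  obtains c' where "c' \<in> small_chains2 \<C> 1 X" "singular_boundary2 1 c' = 0"
    "c + c' \<in> singular_boundaries2 1 X"
proof -
  have T: "singular_chain 1 X (lift c)"
    using c by (simp add: singular_chains2_iff)
  then obtain n where n: "red ((singular_subdivision 1 ^^ n) (lift c)) \<in> small_chains2 \<C> 1 X"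
    using exists_small_subdivision \<C> by metis
  obtain h where h: "\<And>p c1 c2. h p (c1-c2) = h p c1 - h p c2"
      "\<And>p X c. singular_chain p X c \<Longrightarrow> singular_chain (Suc p) X (h p c)"
      "\<And>p X c. singular_chain p X c
                 \<Longrightarrow> chain_boundary (Suc p) (h p c) + h (p - Suc 0) (chain_boundary p c)
                   = (singular_subdivision p ^^ n) c - (c :: 'a chain)"
    using chain_homotopic_iterated_singular_subdivision[where 'a='a] by metis
  have h0: "h p 0 = 0" for p
    using h(1)[of p 0 0] by simp
  have hadd: "h p (a + b) = h p a + h p b" for p a b
    using h(1)[of p a "- b"] h(1)[of p 0 b] by (simp add: h0)
  have "red (chain_boundary 1 (lift c)) = 0"
    using c by (simp add: red_chain_boundary)
  then obtain e where e: "chain_boundary 1 (lift c) = e + e"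
    by (rule red_eq_0D)
  have "red (chain_boundary 1 ((singular_subdivision 1 ^^ n) (lift c))) = 0"
    unfolding chain_boundary_iterated_subdivision[OF T] e by (simp add: iterated_subdivision_add)
  then have cyc: "singular_boundary2 1 (red ((singular_subdivision 1 ^^ n) (lift c))) = 0"
    by (simp add: red_chain_boundary)
  have "red ((singular_subdivision 1 ^^ n) (lift c) - lift c)
      = red (chain_boundary (Suc 1) (h 1 (lift c)) + h (1 - Suc 0) (e + e))"
    using h(3)[OF T] unfolding e by (rule arg_cong[OF sym])
  then have "c + red ((singular_subdivision 1 ^^ n) (lift c)) = singular_boundary2 (Suc 1) (red (h 1 (lift c)))"
    by (simp add: hadd red_chain_boundary add.commute)
  moreover have "red (h 1 (lift c)) \<in> singular_chains2 (Suc 1) X"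
    using h(2)[OF T] by (rule red_singular_chain)
  ultimately have "c + red ((singular_subdivision 1 ^^ n) (lift c)) \<in> singular_boundaries2 1 X"
    by (simp add: singular_boundaries2_def)
  with n cyc that show thesis
    by blast
qed

text \<open>Subdividing a filling \<open>t\<close> makes it small but also subdivides its boundary
  \<open>c\<close>. The prism chain \<open>h 1 (lift c)\<close> fills the gap between
  \<open>c\<close> and its subdivision, and it is small because \<open>c\<close> is.\<close>

lemma small_boundary:
  assumes \<C>: "\<And>U. U \<in> \<C> \<Longrightarrow> openin X U" "topspace X \<subseteq> \<Union>\<C>"
    and c: "c \<in> small_chains2 \<C> 1 X" "c \<in> singular_boundaries2 1 X"
  obtains b where "b \<in> small_chains2 \<C> (Suc 1) X" "singular_boundary2 (Suc 1) b = c"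
proof -
  obtain t where t: "t \<in> singular_chains2 (Suc 1) X" "singular_boundary2 (Suc 1) t = c"
    using c unfolding singular_boundaries2_def by blast
  then have T: "singular_chain (Suc 1) X (lift t)"
    by (simp add: singular_chains2_iff)
  then obtain n where n: "red ((singular_subdivision (Suc 1) ^^ n) (lift t)) \<in> small_chains2 \<C> (Suc 1) X"
    using exists_small_subdivision \<C> by metis
  obtain h where h: "\<And>p c1 c2. h p (c1-c2) = h p c1 - h p c2"
      "\<And>p X c. singular_chain p X c \<Longrightarrow> singular_chain (Suc p) X (h p c)"
      "\<And>p X c. singular_chain p X c
                 \<Longrightarrow> chain_boundary (Suc p) (h p c) + h (p - Suc 0) (chain_boundary p c)
                   = (singular_subdivision p ^^ n) c - (c :: 'a chain)"
    using chain_homotopic_iterated_singular_subdivision[where 'a='a] by metis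
  have h0: "h p 0 = 0" for p
    using h(1)[of p 0 0] by simp
  have hadd: "h p (a + b) = h p a + h p b" for p a b
    using h(1)[of p a "- b"] h(1)[of p 0 b] by (simp add: h0)
  \<comment> \<open>\<open>lift c\<close> need not be an integral cycle, whereas \<open>?D\<close>
    is one, so its homotopy formula has no second term. The two differ by a double, which
    \<open>h\<close> preserves.\<close>
  let ?D = "chain_boundary (Suc 1) (lift t)"
  have D: "singular_chain 1 X ?D"
    using singular_chain_boundary_alt[OF T] .
  have DD: "chain_boundary 1 ?D = 0"
    using chain_boundary_boundary_alt[of 1 X "lift t"] T by simp
  have redD: "red ?D = c"
    using t(2) by (simp add: red_chain_boundary)
  then have "red (?D - lift c) = 0"
    by simp
  then obtain e where "?D - lift c = e + e"
    by (rule red_eq_0D)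
  then have e: "?D = lift c + (e + e)"
    by (metis diff_add_cancel add.commute)
  have "red (chain_boundary (Suc 1) ((singular_subdivision (Suc 1) ^^ n) (lift t)))
      = red ((singular_subdivision 1 ^^ n) ?D)"
    unfolding chain_boundary_iterated_subdivision[OF T] by simp
  also have "(singular_subdivision 1 ^^ n) ?D = ?D + chain_boundary (Suc 1) (h 1 ?D)"
    using h(3)[OF D] unfolding DD h0 by (simp add: algebra_simps)
  also have "red \<dots> = c + red (chain_boundary (Suc 1) (h 1 ?D))"
    using redD by simp
  also have "red (chain_boundary (Suc 1) (h 1 ?D)) = singular_boundary2 (Suc 1) (red (h 1 (lift c)))"
    unfolding e hadd by (simp add: red_chain_boundary)
  finally have eq: "singular_boundary2 (Suc 1) (red ((singular_subdivision (Suc 1) ^^ n) (lift t))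
        + red (h 1 (lift c))) = c"
    by (simp add: red_chain_boundary add_ac)
  let ?S = "\<lambda>p. {f. singular_simplex p X f \<and> (\<exists>V\<in>\<C>. f \<in> standard_simplex p \<rightarrow> V)}"
  \<comment> \<open>The operator \<open>h\<close> is the same for all spaces; applied to the
    subspace \<open>V\<close>, it turns a simplex in \<open>V\<close> into a chain in
    \<open>V\<close>.\<close>
  have "Poly_Mapping.keys (h 1 a) \<subseteq> ?S (Suc 1)" if "Poly_Mapping.keys a \<subseteq> ?S 1" for a
    using that
  proof (induction a rule: frag_induction)
    case (one f)
    then obtain V where V: "V \<in> \<C>" "singular_simplex 1 X f" "f \<in> standard_simplex 1 \<rightarrow> V"
      by auto
    then have "singular_chain 1 (subtopology X V) (frag_of f)"
      by (auto simp: singular_chain_of singular_simplex_subtopology)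
    then have "singular_chain (Suc 1) (subtopology X V) (h 1 (frag_of f))"
      by (rule h(2))
    then show ?case
      using V(1) unfolding singular_chain_def singular_simplex_subtopology image_subset_iff_funcset
      by (auto simp del: One_nat_def intro!: bexI[of _ V] dest!: subsetD)
  next
    case (diff a b)
    then show ?case
      using keys_diff[of "h 1 a" "h 1 b"] unfolding h(1) by blast
  qed (simp add: h0)
  moreover have "Poly_Mapping.keys (lift c) \<subseteq> ?S 1"
    using c(1) by (simp add: keys_lift small_chains2_def)
  ultimately have "Poly_Mapping.keys (h 1 (lift c)) \<subseteq> ?S (Suc 1)"
    by blast
  then have "red (h 1 (lift c)) \<in> small_chains2 \<C> (Suc 1) X"
    unfolding small_chains2_def using keys_red[of "h 1 (lift c)"] by blast
  with n eq show thesis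
    using that additive_set_add[OF additive_small_chains2] by blast
qed

section \<open>Discrete homology in degree one\<close>

locale reflexive_graph =
  fixes G :: "'a rgraph"
  assumes graph: "graph G"
begin

lemma adj_verts: "(u, v) \<in> adj G \<Longrightarrow> u \<in> verts G \<and> v \<in> verts G"
  using graph by (auto simp: graph_def)

lemma adj_refl: "u \<in> verts G \<Longrightarrow> (u, u) \<in> adj G"
  using graph by (auto simp: graph_def refl_on_def)

lemma adj_sym: "(u, v) \<in> adj G \<Longrightarrow> (v, u) \<in> adj G"
  using graph by (auto simp: graph_def dest: symD)

end

section \<open>Cubes of dimension at most two\<close>

definition cube0 :: "'a \<Rightarrow> bool list \<Rightarrow> 'a" where
  "cube0 u = restrict (\<lambda>_. u) {[]}"

definition cube1 :: "'a \<Rightarrow> 'a \<Rightarrow> bool list \<Rightarrow> 'a" where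
  "cube1 u v = restrict (\<lambda>x. if hd x then v else u) {[False], [True]}"

text \<open>The corners \<open>a\<close> and \<open>d\<close> are opposite, and so are
  \<open>b\<close> and \<open>c\<close>; as a closed walk the square reads \<open>a\<close>,
  \<open>b\<close>, \<open>d\<close>, \<open>c\<close>.\<close>

definition cube2 :: "'a \<Rightarrow> 'a \<Rightarrow> 'a \<Rightarrow> 'a \<Rightarrow> bool list \<Rightarrow> 'a" where
  "cube2 a b c d = restrict (\<lambda>x. if hd x then if hd (tl x) then d else c else if hd (tl x) then b else a)
     {[False, False], [False, True], [True, False], [True, True]}"

lemma verts_hypercube_1: "verts (hypercube 1) = {[False], [True]}"
  by (auto simp: box_product_def interval_graph_def Let_def image_iff)

lemma verts_hypercube_2:
  "verts (hypercube 2) = {[False, False], [False, True], [True, False], [True, True]}"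
  by (auto simp: box_product_def interval_graph_def Let_def image_iff numeral_2_eq_2)

lemma adj_hypercube_Suc:
  "(x, y) \<in> adj (hypercube (Suc n)) \<longleftrightarrow>
     (\<exists>i k xs ys. x = i # xs \<and> y = k # ys \<and>
        (i = k \<and> (xs, ys) \<in> adj (hypercube n) \<or> xs = ys \<and> xs \<in> verts (hypercube n)))"
proof -
  have *: "(x, y) \<in> adj (hypercube (Suc n)) \<longleftrightarrow>
    (\<exists>p q. (p, q) \<in> adj (box_product interval_graph (hypercube n)) \<and>
       x = fst p # snd p \<and> y = fst q # snd q)"
    by (fastforce simp: Let_def map_prod_def image_iff split_beta intro: rev_bexI)
  show ?thesis
    unfolding * box_product_def interval_graph_def by auto
qed

lemma adj_hypercube_1: "(x, y) \<in> adj (hypercube 1) \<longleftrightarrow> x \<in> {[False], [True]} \<and> y \<in> {[False], [True]}"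
  unfolding One_nat_def adj_hypercube_Suc by auto

lemma adj_hypercube_2:
  "(x, y) \<in> adj (hypercube 2) \<longleftrightarrow>
     (\<exists>i j k l. x = [i, j] \<and> y = [k, l] \<and> (i = k \<or> j = l))"
  unfolding Suc_1[symmetric] adj_hypercube_Suc adj_hypercube_1 verts_hypercube_1 by auto

lemma cube_face_1: "cube_face 1 1 e A = cube0 (A [e])"
  by (auto simp: cube_face_def cube0_def restrict_def)

lemma cube1_values [simp]: "cube1 u v [False] = u" "cube1 u v [True] = v"
  by (simp_all add: cube1_def)

lemma cube2_values [simp]:
  "cube2 a b c d [False, False] = a" "cube2 a b c d [False, True] = b"
  "cube2 a b c d [True, False] = c" "cube2 a b c d [True, True] = d"
  by (simp_all add: cube2_def)

lemma cube_face_2: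
  "cube_face 2 1 e A = cube1 (A [e, False]) (A [e, True])"
  "cube_face 2 2 e A = cube1 (A [False, e]) (A [True, e])"
proof -
  have n: "(2::nat) - 1 = 1" by simp
  show "cube_face 2 1 e A = cube1 (A [e, False]) (A [e, True])"
    "cube_face 2 2 e A = cube1 (A [False, e]) (A [True, e])"
    unfolding cube_face_def cube1_def n verts_hypercube_1 by (auto simp: restrict_def fun_eq_iff)
qed

lemma cube0_eq [simp]: "cube0 u = cube0 v \<longleftrightarrow> u = v"
  by (metis cube0_def restrict_apply' singletonI)

lemma degenerate_1: "degenerate 1 A \<longleftrightarrow> A [True] = A [False]"
  unfolding degenerate_def by (simp add: cube_face_1[unfolded One_nat_def])

definition vert_chain :: "'a \<Rightarrow> (bool list \<Rightarrow> 'a) \<Rightarrow>\<^sub>0 bit" where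
  "vert_chain u = Poly_Mapping.single (cube0 u) 1"

text \<open>A constant 1-cube is degenerate, so the chain of a loop vanishes. This lets walks stand
  still and absorbs many cases of coinciding vertices.\<close>

definition edge_chain :: "'a \<Rightarrow> 'a \<Rightarrow> (bool list \<Rightarrow> 'a) \<Rightarrow>\<^sub>0 bit" where
  "edge_chain u v = cube_chain_of 1 (cube1 u v)"

lemma edge_chain_alt: "edge_chain u v = (if u = v then 0 else Poly_Mapping.single (cube1 u v) 1)"
  unfolding edge_chain_def cube_chain_of_def degenerate_1 by auto

lemma edge_chain_same [simp]: "edge_chain u u = 0"
  by (simp add: edge_chain_alt)

lemma cube_boundary_add [simp]: "cube_boundary n (c + d) = cube_boundary n c + cube_boundary n d"
  by (simp add: cube_boundary_def)

lemma cube_boundary_0 [simp]: "cube_boundary n 0 = 0"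
  by (simp add: cube_boundary_def)

lemma cube_boundary_edge_chain: "cube_boundary 1 (edge_chain u v) = vert_chain u + vert_chain v"
  by (simp add: cube_boundary_def edge_chain_alt cube_face_1[unfolded One_nat_def] cube_chain_of_def
      degenerate_def vert_chain_def)

lemma cube_boundary_cube2:
  "cube_boundary 2 (Poly_Mapping.single A 1)
     = edge_chain (A [False, False]) (A [False, True]) + edge_chain (A [True, False]) (A [True, True])
     + (edge_chain (A [False, False]) (A [True, False]) + edge_chain (A [False, True]) (A [True, True]))"
proof -
  have n: "(2::nat) - 1 = 1" "{1..2::nat} = {1, 2}" by auto
  show ?thesis
    unfolding cube_boundary_def linear_extension_single n
    by (simp add: cube_face_2[unfolded One_nat_def] edge_chain_def)
qed

lemma degenerate_cube2:
  "degenerate 2 A \<longleftrightarrow>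
     A [False, False] = A [True, False] \<and> A [False, True] = A [True, True] \<or>
     A [False, False] = A [False, True] \<and> A [True, False] = A [True, True]"
proof -
  have n: "{1..2::nat} = {1, 2}" by auto
  have "cube1 u v = cube1 u' v' \<longleftrightarrow> u = u' \<and> v = v'" for u v u' v' :: 'a
    by (metis cube1_values)
  then show ?thesis
    unfolding degenerate_def n by (auto simp: cube_face_2[unfolded One_nat_def])
qed

section \<open>Edges and squares as generators of 1-chains and their boundaries\<close>

context reflexive_graph
begin

abbreviation "cycles1 \<equiv> {c \<in> cube_chains 1 G. cube_boundary 1 c = 0}"
abbreviation "boundaries1 \<equiv> cube_boundary (1 + 1) ` cube_chains (1 + 1) G"

lemma discrete_homology_1: "discrete_homology 1 G = quotient_space cycles1 boundaries1"
  by (simp add: discrete_homology_def)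

lemma additive_cube_chains: "additive_set (cube_chains n G)"
  unfolding cube_chains_def by (rule additive_set_chains)

lemma additive_cycles1: "additive_set cycles1"
  by (intro additive_set_kernel additive_cube_chains) simp

lemma additive_boundaries1: "additive_set boundaries1"
  by (intro additive_set_image additive_cube_chains) simp

lemmas boundaries1_add = additive_set_add[OF additive_boundaries1]

lemma cube1_mem: "cube1 u v \<in> cubes 1 G \<longleftrightarrow> (u, v) \<in> adj G"
proof
  assume "cube1 u v \<in> cubes 1 G"
  moreover have "([False], [True]) \<in> adj (hypercube 1)"
    unfolding adj_hypercube_1 by simp
  ultimately have "(cube1 u v [False], cube1 u v [True]) \<in> adj G"
    unfolding cubes_def graph_maps_def by blast
  then show "(u, v) \<in> adj G"
    by simp
next
  assume uv: "(u, v) \<in> adj G"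
  have "cube1 u v \<in> verts (hypercube 1) \<rightarrow>\<^sub>E verts G"
    unfolding verts_hypercube_1 using adj_verts[OF uv] by (auto simp: cube1_def)
  then show "cube1 u v \<in> cubes 1 G"
    unfolding cubes_def graph_maps_def adj_hypercube_1
    using uv adj_verts[OF uv] adj_refl adj_sym by auto
qed

lemma cubes1_cases:
  assumes "A \<in> cubes 1 G"
  obtains u v where "A = cube1 u v" "(u, v) \<in> adj G"
proof -
  have A: "A \<in> {[False], [True]} \<rightarrow>\<^sub>E verts G"
    using assms unfolding cubes_def graph_maps_def verts_hypercube_1 by blast
  have "A = cube1 (A [False]) (A [True])"
    by (rule extensionalityI[of _ "{[False], [True]}"]) (use A in \<open>auto simp: cube1_def PiE_iff\<close>)
  with assms cube1_mem that show thesis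
    by metis
qed

lemma edge_chain_mem: "(u, v) \<in> adj G \<Longrightarrow> edge_chain u v \<in> cube_chains 1 G"
  by (auto simp: cube_chains_def edge_chain_alt degenerate_1[unfolded One_nat_def] cube1_mem[unfolded One_nat_def])

lemma cube_chain_induct [consumes 1, case_names zero edge add]:
  assumes "c \<in> cube_chains 1 G" "P 0"
    and edge: "\<And>u v. (u, v) \<in> adj G \<Longrightarrow> u \<noteq> v \<Longrightarrow> P (edge_chain u v)"
    and "\<And>a b. P a \<Longrightarrow> P b \<Longrightarrow> P (a + b)"
  shows "P c"
proof -
  have "Poly_Mapping.keys c \<subseteq> {A \<in> cubes 1 G. \<not> degenerate 1 A}"
    using assms(1) by (simp add: cube_chains_def)
  then show ?thesis
  proof (induction c rule: bit_chain_induct)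
    case (single A)
    then obtain u v where uv: "A = cube1 u v" "(u, v) \<in> adj G"
      by (blast elim: cubes1_cases)
    with single have "u \<noteq> v"
      by (auto simp: degenerate_1[unfolded One_nat_def])
    with edge[OF uv(2)] show ?case
      by (simp add: edge_chain_alt uv(1))
  qed (use assms in auto)
qed

text \<open>The four sides form the boundary of \<open>cube2 a b c d\<close>. The vertices may
  coincide: if the cube is degenerate, one pair of opposite sides agrees and the other pair is
  constant, so the sum is 0.\<close>

lemma square_mem_boundaries1:
  assumes "(a, b) \<in> adj G" "(c, d) \<in> adj G" "(a, c) \<in> adj G" "(b, d) \<in> adj G"
  shows "edge_chain a b + edge_chain c d + (edge_chain a c + edge_chain b d) \<in> boundaries1"
proof (cases "degenerate 2 (cube2 a b c d)")
  case True
  then show ?thesis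
    using additive_set_0[OF additive_boundaries1] by (auto simp: degenerate_cube2)
next
  case False
  have "cube2 a b c d \<in> verts (hypercube 2) \<rightarrow>\<^sub>E verts G"
    unfolding verts_hypercube_2 using assms adj_verts by (auto simp: cube2_def)
  moreover have "(cube2 a b c d [i, j], cube2 a b c d [k, l]) \<in> adj G" if "i = k \<or> j = l" for i j k l
    using that assms adj_verts adj_refl adj_sym
    by (cases i; cases j; cases k; cases l) auto
  ultimately have "cube2 a b c d \<in> cubes 2 G"
    unfolding cubes_def graph_maps_def adj_hypercube_2 by blast
  with False have "Poly_Mapping.single (cube2 a b c d) 1 \<in> cube_chains (1 + 1) G"
    by (simp add: cube_chains_def one_add_one del: One_nat_def)
  from imageI[OF this, of "cube_boundary (1 + 1)"] show ?thesis
    unfolding one_add_one cube_boundary_cube2 by simp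
qed

lemma boundaries1_induct [consumes 1, case_names square zero add]:
  assumes "c \<in> boundaries1"
    and square: "\<And>a b c d. (a, b) \<in> adj G \<Longrightarrow> (c, d) \<in> adj G \<Longrightarrow> (a, c) \<in> adj G \<Longrightarrow> (b, d) \<in> adj G
      \<Longrightarrow> P (edge_chain a b + edge_chain c d + (edge_chain a c + edge_chain b d))"
    and "P 0" and add: "\<And>a b. P a \<Longrightarrow> P b \<Longrightarrow> P (a + b)"
  shows "P c"
proof -
  obtain b where b: "c = cube_boundary 2 b" "b \<in> cube_chains 2 G"
    using assms(1) unfolding one_add_one by blast
  have "Poly_Mapping.keys b \<subseteq> {A \<in> cubes 2 G. \<not> degenerate 2 A}"
    using b(2) by (simp add: cube_chains_def)
  then have "P (cube_boundary 2 b)"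
  proof (induction b rule: bit_chain_induct)
    case (single A)
    then have "\<forall>x y. (x, y) \<in> adj (hypercube 2) \<longrightarrow> (A x, A y) \<in> adj G"
      by (simp add: cubes_def graph_maps_def)
    then have A: "(A [i, j], A [k, l]) \<in> adj G" if "i = k \<or> j = l" for i j k l
      using that unfolding adj_hypercube_2 by blast
    show ?case
      unfolding cube_boundary_cube2 by (rule square) (rule A; simp)+
  qed (use assms in auto)
  with b show ?thesis
    by simp
qed

subsection \<open>Vertices with a common neighbour\<close>

definition linked :: "'a \<Rightarrow> 'a \<Rightarrow> bool" where
  "linked u v \<longleftrightarrow> (\<exists>m. (u, m) \<in> adj G \<and> (m, v) \<in> adj G)"

definition middle :: "'a \<Rightarrow> 'a \<Rightarrow> 'a" where
  "middle u v = (SOME m. (u, m) \<in> adj G \<and> (m, v) \<in> adj G)"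

definition link :: "'a \<Rightarrow> 'a \<Rightarrow> (bool list \<Rightarrow> 'a) \<Rightarrow>\<^sub>0 bit" where
  "link u v = edge_chain u (middle u v) + edge_chain (middle u v) v"

lemma middle:
  assumes "linked u v"
  shows "(u, middle u v) \<in> adj G" "(middle u v, v) \<in> adj G"
  using someI_ex[OF assms[unfolded linked_def]] by (simp_all add: middle_def)

lemma link_mem: "linked u v \<Longrightarrow> link u v \<in> cube_chains 1 G"
  unfolding link_def using middle by (blast intro: additive_set_add[OF additive_cube_chains] edge_chain_mem)

lemma cube_boundary_link: "cube_boundary 1 (link u v) = vert_chain u + vert_chain v"
  unfolding link_def cube_boundary_add cube_boundary_edge_chain by (simp add: add_ac)

text \<open>The two paths from \<open>u\<close> to \<open>v\<close>, through
  \<open>middle u v\<close> and through \<open>m\<close>, make up a closed walk of length four. So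
  the choice of the middle vertex does not matter modulo boundaries.\<close>

lemma link_via:
  assumes "(u, m) \<in> adj G" "(m, v) \<in> adj G"
  shows "link u v + (edge_chain u m + edge_chain m v) \<in> boundaries1"
proof -
  have "linked u v"
    using assms by (auto simp: linked_def)
  from square_mem_boundaries1[of u "middle u v" m v] middle[OF this] assms show ?thesis
    by (simp add: link_def add_ac)
qed

text \<open>Reflexivity makes \<open>u\<close> itself a possible middle vertex.\<close>

lemma link_adj: "(u, v) \<in> adj G \<Longrightarrow> link u v + edge_chain u v \<in> boundaries1"
  using link_via[of u u v] adj_verts adj_refl by simp

lemma link_same: "u \<in> verts G \<Longrightarrow> link u u \<in> boundaries1"
  using link_adj[of u u] adj_refl by simp

text \<open>The square \<open>cube2 u v u u\<close> has two constant sides; the other two are the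
  edge in its two directions.\<close>

lemma edge_chain_sym:
  assumes "(u, v) \<in> adj G"
  shows "edge_chain u v + edge_chain v u \<in> boundaries1"
  using square_mem_boundaries1[of u v u u] assms adj_verts[OF assms] adj_refl adj_sym[OF assms] by simp

lemma link_sym:
  assumes "linked u v"
  shows "link u v + link v u \<in> boundaries1"
proof -
  let ?m = "middle u v"
  note m = middle[OF assms]
  have "link v u + (edge_chain v ?m + edge_chain ?m u) \<in> boundaries1"
    using m adj_sym by (intro link_via) auto
  moreover have "edge_chain u ?m + edge_chain ?m u \<in> boundaries1"
    using m edge_chain_sym by auto
  moreover have "edge_chain ?m v + edge_chain v ?m \<in> boundaries1"
    using m edge_chain_sym by auto
  ultimately have "link v u + (edge_chain v ?m + edge_chain ?m u)
      + ((edge_chain u ?m + edge_chain ?m u) + (edge_chain ?m v + edge_chain v ?m)) \<in> boundaries1"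
    by (meson boundaries1_add)
  then show ?thesis
    unfolding link_def[of u v] by (simp add: add_ac)
qed

text \<open>The vertex sets of the closed cells of the complex of the graph are clusters; on them \<open>link\<close>
  is a cocycle modulo boundaries.\<close>

definition cluster :: "'a set \<Rightarrow> bool" where
  "cluster S \<longleftrightarrow> S \<subseteq> verts G \<and> (\<forall>u\<in>S. \<forall>v\<in>S. linked u v) \<and>
     (\<forall>u\<in>S. \<forall>v\<in>S. \<forall>w\<in>S. distinct [u, v, w] \<longrightarrow>
        (u, v) \<in> adj G \<and> (u, w) \<in> adj G \<or> (v, u) \<in> adj G \<and> (v, w) \<in> adj G \<or>
        (w, u) \<in> adj G \<and> (w, v) \<in> adj G)"

text \<open>The link from \<open>u\<close> to \<open>w\<close> may be routed through
  \<open>v\<close>.\<close>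

lemma link_centre:
  assumes "(v, u) \<in> adj G" "(v, w) \<in> adj G"
  shows "link u v + link v w + link u w \<in> boundaries1"
proof -
  have "link u v + edge_chain u v \<in> boundaries1"
    using assms adj_sym by (blast intro: link_adj)
  moreover have "link v w + edge_chain v w \<in> boundaries1"
    using assms by (blast intro: link_adj)
  moreover have "link u w + (edge_chain u v + edge_chain v w) \<in> boundaries1"
    using assms adj_sym by (intro link_via) auto
  ultimately have "(link u v + edge_chain u v) + (link v w + edge_chain v w)
      + (link u w + (edge_chain u v + edge_chain v w)) \<in> boundaries1"
    by (meson boundaries1_add)
  then show ?thesis
    by (simp add: add_ac)
qed

lemma link_cocycle:
  assumes S: "cluster S" "u \<in> S" "v \<in> S" "w \<in> S"
  shows "link u v + link v w + link u w \<in> boundaries1"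
proof -
  have lk: "linked x y" if "x \<in> S" "y \<in> S" for x y
    using S that by (auto simp: cluster_def)
  have V: "x \<in> verts G" if "x \<in> S" for x
    using S that by (auto simp: cluster_def)
  \<comment> \<open>Among three distinct vertices of a cluster one is adjacent to the other two and
    plays the role of the centre; \<open>link_sym\<close> corrects the directions.\<close>
  consider "u = v" | "v = w" | "u = w" | "(v, u) \<in> adj G" "(v, w) \<in> adj G"
    | "(u, v) \<in> adj G" "(u, w) \<in> adj G" | "(w, u) \<in> adj G" "(w, v) \<in> adj G"
    using S unfolding cluster_def by (smt (verit) distinct_length_2_or_more distinct_singleton)
  then show ?thesis
  proof cases
    case 1
    then show ?thesis using link_same[OF V[OF \<open>v \<in> S\<close>]] by (simp add: add_ac)
  next
    case 2
    then show ?thesis using link_same[OF V[OF \<open>v \<in> S\<close>]] by (simp add: add_ac)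
  next
    case 3
    then show ?thesis
      using boundaries1_add[OF link_same[OF V[OF \<open>u \<in> S\<close>]] link_sym[OF lk[OF \<open>u \<in> S\<close> \<open>v \<in> S\<close>]]] by (simp add: add_ac)
  next
    case 4
    then show ?thesis by (rule link_centre)
  next
    case 5
    from boundaries1_add[OF link_centre[OF 5] link_sym[OF lk[OF \<open>u \<in> S\<close> \<open>v \<in> S\<close>]]] show ?thesis
      by (simp add: add_ac)
  next
    case 6
    from boundaries1_add[OF link_centre[OF 6(2,1)] boundaries1_add[OF link_sym[OF lk[OF \<open>u \<in> S\<close> \<open>w \<in> S\<close>]] link_sym[OF lk[OF \<open>u \<in> S\<close> \<open>v \<in> S\<close>]]]]
    show ?thesis
      by (simp add: add_ac)
  qed
qed

end

section \<open>Homotopies out of attaching spaces\<close>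

lemma topspace_attach_cells:
  assumes "\<And>i y. i \<in> I \<Longrightarrow> y \<in> S \<Longrightarrow> \<phi> i y \<in> topspace X"
  shows "topspace (attach_cells X D S I \<phi>) = Inl ` topspace X \<union> Inr ` (I \<times> (topspace D - S))"
    (is "_ = ?T")
proof -
  have "{x \<in> topspace X. Inl x \<in> ?T} = topspace X" by auto
  moreover have "{y \<in> topspace D. characteristic_map S \<phi> i y \<in> ?T} = topspace D" if "i \<in> I" for i
    using assms that by (auto simp: characteristic_map_def)
  ultimately have "openin (attach_cells X D S I \<phi>) ?T"
    unfolding openin_attach_cells by simp
  then show ?thesis
    unfolding topspace_def openin_attach_cells by blast
qed

lemma continuous_map_Inl_attach_cells:
  assumes "\<And>i y. i \<in> I \<Longrightarrow> y \<in> S \<Longrightarrow> \<phi> i y \<in> topspace X"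
  shows "continuous_map X (attach_cells X D S I \<phi>) Inl"
proof -
  have "topspace (attach_cells X D S I \<phi>) = Inl ` topspace X \<union> Inr ` (I \<times> (topspace D - S))"
    using assms by (rule topspace_attach_cells)
  then show ?thesis
    by (auto simp: continuous_map_def openin_attach_cells)
qed

lemma continuous_map_characteristic_map:
  assumes "\<And>i y. i \<in> I \<Longrightarrow> y \<in> S \<Longrightarrow> \<phi> i y \<in> topspace X" "i \<in> I"
  shows "continuous_map D (attach_cells X D S I \<phi>) (characteristic_map S \<phi> i)"
proof -
  have "topspace (attach_cells X D S I \<phi>) = Inl ` topspace X \<union> Inr ` (I \<times> (topspace D - S))"
    using assms(1) by (rule topspace_attach_cells)
  then show ?thesis
    using assms by (auto simp: continuous_map_def openin_attach_cells characteristic_map_def)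
qed

section \<open>The tube lemma and continuity on attaching spaces\<close>

lemma continuous_map_prod_subtopology:
  assumes "continuous_map (prod_topology X Y) Z f"
  shows "continuous_map (prod_topology X (subtopology Y S)) Z f"
  using continuous_map_from_subtopology[OF assms, of "UNIV \<times> S"]
  by (simp only: subtopology_Times subtopology_UNIV)

text \<open>The complement is the projection, along the compact factor \<open>T\<close>, of the
  closed set where \<open>k\<close> leaves \<open>V\<close>, and such projections are closed
  maps.\<close>

lemma tube_open:
  assumes k: "continuous_map (prod_topology (top_of_set {0..1::real}) P) Y k"
    and V: "openin Y V" and T: "compact T" "T \<subseteq> {0..1}"
  shows "openin P {x \<in> topspace P. \<forall>t\<in>T. k (t, x) \<in> V}"
proof -
  let ?Q = "prod_topology (top_of_set T) P"
  have "continuous_map (subtopology (prod_topology (top_of_set {0..1}) P) (T \<times> topspace P)) Y k"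
    using k by (rule continuous_map_from_subtopology)
  moreover have "subtopology (prod_topology (top_of_set {0..1}) P) (T \<times> topspace P) = ?Q"
    using T(2) by (simp add: subtopology_Times subtopology_subtopology Int_absorb1)
  ultimately have "continuous_map ?Q Y k"
    by simp
  then have "closedin ?Q {p \<in> topspace ?Q. k p \<in> topspace Y - V}"
    using V by (intro closedin_continuous_map_preimage) auto
  moreover have "closed_map ?Q P snd"
    using T(1) by (intro Abstract_Topological_Spaces.closed_map_snd) (simp add: compact_space_subtopology)
  ultimately have "closedin P (snd ` {p \<in> topspace ?Q. k p \<in> topspace Y - V})"
    by (simp add: closed_map_def)
  moreover have "k p \<in> topspace Y" if "p \<in> topspace ?Q" for p
    using \<open>continuous_map ?Q Y k\<close> that by (auto simp: continuous_map_def)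
  then have "{x \<in> topspace P. \<forall>t\<in>T. k (t, x) \<in> V}
      = topspace P - snd ` {p \<in> topspace ?Q. k p \<in> topspace Y - V}"
    by (force simp: image_iff)
  ultimately show ?thesis
    by auto
qed

lemma tube_open_subtopology:
  assumes k: "continuous_map (prod_topology (top_of_set {0..1::real}) (subtopology X U)) Y k"
    and V: "openin Y V" and T: "compact T" "T \<subseteq> {0..1}" and U: "openin X (topspace X \<inter> U)"
  shows "openin X {x \<in> topspace X. x \<in> U \<and> (\<forall>t\<in>T. k (t, x) \<in> V)}"
proof -
  have "openin (subtopology X (topspace X \<inter> U)) {x \<in> topspace (subtopology X U). \<forall>t\<in>T. k (t, x) \<in> V}"
    using tube_open[OF k V T] by (simp add: subtopology_restrict)
  then have "openin X {x \<in> topspace (subtopology X U). \<forall>t\<in>T. k (t, x) \<in> V}"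
    using U by (simp add: openin_open_subtopology)
  then show ?thesis
    by (rule back_subst[of "openin X"]) auto
qed

text \<open>The product of a quotient map with the unit interval has to be shown to be a quotient map; the
  tube lemma, applied on a compact neighbourhood of the given time, reduces this to openness in the
  attaching space itself.\<close>

lemma homotopy_on_attach_cells:
  fixes K :: "real \<times> ('p + 'i \<times> 'd) \<Rightarrow> 'y"
  assumes W: "openin (attach_cells X D S I \<phi>) W"
    and KX: "continuous_map (prod_topology (top_of_set {0..1}) (subtopology X {x. Inl x \<in> W})) Y
              (\<lambda>(t, x). K (t, Inl x))"
    and KD: "\<And>i. i \<in> I \<Longrightarrow> continuous_map
              (prod_topology (top_of_set {0..1}) (subtopology D {y. characteristic_map S \<phi> i y \<in> W})) Y
              (\<lambda>(t, y). K (t, characteristic_map S \<phi> i y))"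
    and SD: "S \<subseteq> topspace D"
  shows "continuous_map (prod_topology (top_of_set {0..1}) (subtopology (attach_cells X D S I \<phi>) W)) Y K"
proof -
  let ?A = "attach_cells X D S I \<phi>" and ?J = "top_of_set {0..1::real}"
  let ?c = "characteristic_map S \<phi>"
  have WA: "W \<subseteq> topspace ?A"
    using W by (rule openin_subset)
  have W': "W \<subseteq> Inl ` topspace X \<union> Inr ` (I \<times> (topspace D - S))"
    using W by (simp add: openin_attach_cells)
  have pt: "(\<exists>x. w = Inl x \<and> x \<in> topspace X) \<or> (\<exists>i\<in>I. \<exists>y. w = ?c i y \<and> y \<in> topspace D)" if "w \<in> W" for w
  proof -
    have "w \<in> Inl ` topspace X \<union> Inr ` (I \<times> (topspace D - S))"
      using that W' by blast
    then consider x where "w = Inl x" "x \<in> topspace X"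
      | i y where "w = Inr (i, y)" "i \<in> I" "y \<in> topspace D - S"
      by blast
    then show ?thesis
    proof cases
      case 2
      then have "w = ?c i y"
        by (simp add: characteristic_map_def)
      with 2 show ?thesis
        by blast
    qed blast
  qed
  have slice: "continuous_map ?J Y (\<lambda>t. K (t, w))" if "w \<in> W" for w
  proof -
    from pt[OF that] show ?thesis
    proof (elim disjE exE conjE bexE)
      fix x assume x: "w = Inl x" "x \<in> topspace X"
      have "continuous_map ?J (prod_topology ?J (subtopology X {x. Inl x \<in> W})) (\<lambda>t. (t, x))"
        using x that by (simp add: continuous_map_pairwise o_def)
      from continuous_map_compose[OF this KX] show ?thesis
        using x by (simp add: o_def)
    next
      fix i y assume y: "w = ?c i y" "y \<in> topspace D" "i \<in> I"
      have "continuous_map ?J (prod_topology ?J (subtopology D {y. ?c i y \<in> W})) (\<lambda>t. (t, y))"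
        using y that by (simp add: continuous_map_pairwise o_def)
      from continuous_map_compose[OF this KD[OF y(3)]] show ?thesis
        using y by (simp add: o_def)
    qed
  qed
  have KY: "K (t, w) \<in> topspace Y" if "t \<in> {0..1}" "w \<in> W" for t w
    using slice[OF that(2)] that(1) by (auto simp: continuous_map_def)
  \<comment> \<open>Openness in the attaching space is tested on \<open>X\<close> and on each copy
    of \<open>D\<close>, where the ordinary tube lemma applies.\<close>
  have tube: "openin ?A {w \<in> W. \<forall>t\<in>T. K (t, w) \<in> V}"
    if V: "openin Y V" and T: "compact T" "T \<subseteq> {0..1}" for V T
    unfolding openin_attach_cells
  proof (intro conjI ballI)
    show "{w \<in> W. \<forall>t\<in>T. K (t, w) \<in> V} \<subseteq> Inl ` topspace X \<union> Inr ` (I \<times> (topspace D - S))"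
      using W' by auto
    have "openin X (topspace X \<inter> {x. Inl x \<in> W})"
      using W by (simp add: openin_attach_cells Collect_conj_eq)
    from tube_open_subtopology[OF KX V T this]
    show "openin X {x \<in> topspace X. Inl x \<in> {w \<in> W. \<forall>t\<in>T. K (t, w) \<in> V}}"
      by simp
    fix i assume i: "i \<in> I"
    then have "openin D (topspace D \<inter> {y. ?c i y \<in> W})"
      using W by (simp add: openin_attach_cells Collect_conj_eq)
    from tube_open_subtopology[OF KD[OF i] V T this]
    show "openin D {y \<in> topspace D. ?c i y \<in> {w \<in> W. \<forall>t\<in>T. K (t, w) \<in> V}}"
      by simp
  qed
  show ?thesis
    unfolding continuous_map_def
  proof (intro conjI allI impI)
    show "K \<in> topspace (prod_topology ?J (subtopology ?A W)) \<rightarrow> topspace Y"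
      using KY by auto
    fix V assume V: "openin Y V"
    show "openin (prod_topology ?J (subtopology ?A W)) {p \<in> topspace (prod_topology ?J (subtopology ?A W)). K p \<in> V}"
    proof (subst openin_prod_topology_alt, intro allI impI)
      fix t w assume "(t, w) \<in> {p \<in> topspace (prod_topology ?J (subtopology ?A W)). K p \<in> V}"
      then have tw: "t \<in> {0..1}" "w \<in> W" "K (t, w) \<in> V"
        by auto
      have "openin ?J {s \<in> topspace ?J. K (s, w) \<in> V}"
        using slice[OF tw(2)] V by (simp add: continuous_map_def)
      then obtain e where e: "e > 0" "\<And>s. s \<in> {0..1} \<Longrightarrow> dist s t < e \<Longrightarrow> K (s, w) \<in> V"
        unfolding openin_euclidean_subtopology_iff using tw by auto
      \<comment> \<open>Half the radius keeps the closed ball where \<open>K (s, w)\<close> lies in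
        \<open>V\<close>, and the open ball inside it is still a neighbourhood of
        \<open>t\<close>.\<close>
      define T where "T = cball t (e/2) \<inter> {0..1}"
      have T: "compact T" "T \<subseteq> {0..1}"
        unfolding T_def by (auto intro: compact_Int)
      have "openin ?J (ball t (e/2) \<inter> {0..1})"
        by (auto simp: openin_open)
      moreover have "openin (subtopology ?A W) {w \<in> W. \<forall>t\<in>T. K (t, w) \<in> V}"
        using tube[OF V T] openin_open_subtopology[OF W] by auto
      moreover have "t \<in> ball t (e/2) \<inter> {0..1}"
        using tw e by simp
      moreover have "w \<in> {w \<in> W. \<forall>t\<in>T. K (t, w) \<in> V}"
        using tw e by (auto simp: T_def dist_commute)
      moreover have "(ball t (e/2) \<inter> {0..1}) \<times> {w \<in> W. \<forall>t\<in>T. K (t, w) \<in> V}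
          \<subseteq> {p \<in> topspace (prod_topology ?J (subtopology ?A W)). K p \<in> V}"
        using WA by (auto simp: T_def)
      ultimately show "\<exists>U V'. openin ?J U \<and> openin (subtopology ?A W) V' \<and> t \<in> U \<and> w \<in> V' \<and>
          U \<times> V' \<subseteq> {p \<in> topspace (prod_topology ?J (subtopology ?A W)). K p \<in> V}"
        by blast
    qed
  qed
qed

lemma null_homotopic_convex:
  fixes T :: "'v::real_normed_vector set"
  assumes "convex T" "a \<in> T" and k: "continuous_map (top_of_set T) X k"
  shows "homotopic_with (\<lambda>_. True) (top_of_set T) X k (\<lambda>_. k a)"
proof -
  let ?h = "\<lambda>p::real \<times> 'v. (1 - fst p) *\<^sub>R snd p + fst p *\<^sub>R a"
  have "?h p \<in> T" if "p \<in> {0..1} \<times> T" for p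
    using assms that by (auto intro!: convexD)
  then have "continuous_map (top_of_set ({0..1} \<times> T)) (top_of_set T) ?h"
    by (auto simp: continuous_map_in_subtopology intro!: continuous_intros)
  then have "continuous_map (prod_topology (top_of_set {0..1}) (top_of_set T)) (top_of_set T) ?h"
    by simp
  from continuous_map_compose[OF this k] show ?thesis
    unfolding homotopic_with_def by (intro exI[of _ "k \<circ> ?h"]) auto
qed

section \<open>Cells of the complex\<close>

definition rep :: "'a list set \<Rightarrow> 'a list" where
  "rep C = (SOME vs. vs \<in> C)"

lemma two_cell_attach_rep: "two_cell_attach C = cycle_loop (rep C)"
  by (simp add: two_cell_attach_def rep_def)

lemma cycle_class_alt:
  assumes "vs \<noteq> []"
  shows "cycle_class vs = (\<lambda>k. rotate k vs) ` {..<length vs} \<union> (\<lambda>k. rotate k (rev vs)) ` {..<length vs}"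
proof -
  have "{rotate k ws |k. True} = (\<lambda>k. rotate k ws) ` {..<length ws}" if "ws \<noteq> []" for ws :: "'a list"
  proof -
    have "rotate k ws \<in> (\<lambda>k. rotate k ws) ` {..<length ws}" for k
      using that by (intro image_eqI[of _ _ "k mod length ws"]) (simp_all add: rotate_conv_mod[symmetric])
    then show ?thesis
      by blast
  qed
  from this[OF assms] this[of "rev vs"] assms show ?thesis
    unfolding cycle_class_def by simp
qed

lemma cycle_class_3:
  "cycle_class [a, b, c] = {[a, b, c], [b, c, a], [c, a, b], [c, b, a], [b, a, c], [a, c, b]}"
proof -
  have *: "{..<length [a, b, c]} = {0, 1, 2}" by auto
  have "rotate 0 [x, y, z] = [x, y, z]" "rotate 1 [x, y, z] = [y, z, x]"
    "rotate 2 [x, y, z] = [z, x, y]" for x y z :: 'a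
    by (simp_all add: rotate_drop_take)
  moreover have "rev [a, b, c] = [c, b, a]"
    by simp
  ultimately show ?thesis
    unfolding cycle_class_alt[of "[a, b, c]", OF list.distinct(2)] * image_insert image_empty
    by (simp only: Un_insert_left Un_empty_left)
qed

lemma cycle_class_4:
  "cycle_class [a, b, c, d] =
     {[a, b, c, d], [b, c, d, a], [c, d, a, b], [d, a, b, c],
      [d, c, b, a], [c, b, a, d], [b, a, d, c], [a, d, c, b]}"
proof -
  have *: "{..<length [a, b, c, d]} = {0, 1, 2, 3}" by auto
  have "rotate 0 [w, x, y, z] = [w, x, y, z]" "rotate 1 [w, x, y, z] = [x, y, z, w]"
    "rotate 2 [w, x, y, z] = [y, z, w, x]" "rotate 3 [w, x, y, z] = [z, w, x, y]" for w x y z :: 'a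
    by (simp_all add: rotate_drop_take)
  moreover have "rev [a, b, c, d] = [d, c, b, a]"
    by simp
  ultimately show ?thesis
    unfolding cycle_class_alt[of "[a, b, c, d]", OF list.distinct(2)] * image_insert image_empty
    by (simp only: Un_insert_left Un_empty_left)
qed

lemma self_mem_cycle_class: "vs \<in> cycle_class vs"
  unfolding cycle_class_def by (auto intro: exI[of _ 0])

lemma graph_cycle_3:
  "graph_cycle G [a, b, c] \<longleftrightarrow> distinct [a, b, c] \<and> {a, b, c} \<subseteq> verts G \<and>
     (a, b) \<in> adj G \<and> (b, c) \<in> adj G \<and> (c, a) \<in> adj G"
  unfolding graph_cycle_def by (auto simp: less_Suc_eq nth_Cons split: nat.splits)

lemma graph_cycle_4:
  "graph_cycle G [a, b, c, d] \<longleftrightarrow> distinct [a, b, c, d] \<and> {a, b, c, d} \<subseteq> verts G \<and>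
     (a, b) \<in> adj G \<and> (b, c) \<in> adj G \<and> (c, d) \<in> adj G \<and> (d, a) \<in> adj G"
  unfolding graph_cycle_def by (auto simp: less_Suc_eq nth_Cons split: nat.splits)

lemma simple_cycle_3: "graph_cycle G [a, b, c] \<Longrightarrow> simple_cycle G [a, b, c]"
  unfolding simple_cycle_def strict_subseq_def
  using subseq_same_length list_emb_length by (metis le_antisym length_Cons list.size(3) numeral_3_eq_3)

text \<open>A proper subsequence of length at least three omits exactly one vertex, and as a cycle
  it would use one of the diagonals.\<close>

lemma simple_cycle_4:
  assumes "graph_cycle G [a, b, c, d]" "(a, c) \<notin> adj G" "(b, d) \<notin> adj G" "sym (adj G)"
  shows "simple_cycle G [a, b, c, d]"
  unfolding simple_cycle_def
proof (intro conjI allI impI)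
  fix ws assume ws: "strict_subseq ws [a, b, c, d] \<and> length ws \<ge> 3"
  then have "ws \<in> set (subseqs [a, b, c, d])" "ws \<noteq> [a, b, c, d]"
    by (auto simp: strict_subseq_def simp del: subseqs.simps)
  with ws have "ws \<in> {[a, b, c], [a, b, d], [a, c, d], [b, c, d]}"
    by (simp add: Let_def del: in_set_subseqs) (elim disjE; simp)
  moreover have "(c, a) \<notin> adj G" "(d, b) \<notin> adj G"
    using assms(2-4) by (auto dest: symD)
  ultimately show "\<not> graph_cycle G ws"
    using assms(2,3) by (auto simp: graph_cycle_3)
qed fact

context reflexive_graph
begin

text \<open>\<open>rep C\<close> need not be the cycle that produced \<open>C\<close>, but it is a
  rotation of it or of its reversal, so cyclic neighbours are still adjacent.\<close>

lemma two_cell_cases: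
  assumes "C \<in> two_cells G"
  obtains (triangle) a b c where "rep C = [a, b, c]" "distinct [a, b, c]"
      "(a, b) \<in> adj G" "(b, c) \<in> adj G" "(c, a) \<in> adj G"
    | (square) a b c d where "rep C = [a, b, c, d]" "distinct [a, b, c, d]"
      "(a, b) \<in> adj G" "(b, c) \<in> adj G" "(c, d) \<in> adj G" "(d, a) \<in> adj G"
proof -
  obtain us where us: "C = cycle_class us" "simple_cycle G us" "length us \<in> {3, 4}"
    using assms by (auto simp: two_cells_def)
  then have cyc: "graph_cycle G us"
    by (simp add: simple_cycle_def)
  have rep: "rep C \<in> cycle_class us"
    unfolding rep_def us(1) by (rule someI[of "\<lambda>vs. vs \<in> cycle_class us", OF self_mem_cycle_class])
  from us(3) consider a b c where "us = [a, b, c]" | a b c d where "us = [a, b, c, d]"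
    by (auto simp: eval_nat_numeral length_Suc_conv)
  then show thesis
  proof cases
    case (1 a b c)
    with cyc rep triangle show thesis
      unfolding cycle_class_3 graph_cycle_3 1 by (auto dest: adj_sym)
  next
    case (2 a b c d)
    then have *: "distinct [a, b, c, d]"
      "(a, b) \<in> adj G" "(b, c) \<in> adj G" "(c, d) \<in> adj G" "(d, a) \<in> adj G"
      using cyc by (simp_all add: graph_cycle_4)
    note ** = *(2-5)[THEN adj_sym]
    from rep have "rep C \<in> {[a, b, c, d], [b, c, d, a], [c, d, a, b], [d, a, b, c],
        [d, c, b, a], [c, b, a, d], [b, a, d, c], [a, d, c, b]}"
      unfolding cycle_class_4 2 .
    then show thesis
      using * ** square by (elim insertE emptyE) auto
  qed
qed

lemma rep_facts:
  assumes "C \<in> two_cells G"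
  shows "length (rep C) \<in> {3, 4}" "distinct (rep C)"
    "k < length (rep C) \<Longrightarrow> (rep C ! k, rep C ! (Suc k mod length (rep C))) \<in> adj G"
proof -
  from assms show "length (rep C) \<in> {3, 4}" "distinct (rep C)"
    by (cases rule: two_cell_cases; auto)+
  show "(rep C ! k, rep C ! (Suc k mod length (rep C))) \<in> adj G" if "k < length (rep C)"
    using assms that
    by (cases rule: two_cell_cases) (auto simp: less_Suc_eq nth_Cons split: nat.splits)
qed

lemma rep_next_neq:
  assumes "C \<in> two_cells G" "k < length (rep C)"
  shows "rep C ! k \<noteq> rep C ! (Suc k mod length (rep C))" "Suc k mod length (rep C) < length (rep C)"
proof -
  have n: "length (rep C) \<ge> 2"
    using rep_facts(1)[OF assms(1)] by auto
  then show "Suc k mod length (rep C) < length (rep C)"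
    by (intro mod_less_divisor) linarith
  moreover have "k \<noteq> Suc k mod length (rep C)"
    using n assms(2) by (auto simp: mod_Suc)
  ultimately show "rep C ! k \<noteq> rep C ! (Suc k mod length (rep C))"
    using rep_facts(2)[OF assms(1)] assms(2) nth_eq_iff_index_eq by blast
qed

lemma triangle_two_cell:
  assumes "distinct [a, b, c]" "(a, b) \<in> adj G" "(b, c) \<in> adj G" "(a, c) \<in> adj G"
  shows "cycle_class [a, b, c] \<in> two_cells G"
proof -
  have "simple_cycle G [a, b, c]"
    using assms adj_verts adj_sym by (intro simple_cycle_3) (auto simp: graph_cycle_3)
  then show ?thesis
    unfolding two_cells_def by (intro CollectI exI[of _ "[a, b, c]"]) simp
qed

lemma square_two_cell:
  assumes "distinct [a, b, c, d]" "(a, b) \<in> adj G" "(b, c) \<in> adj G" "(c, d) \<in> adj G" "(d, a) \<in> adj G"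
    "(a, c) \<notin> adj G" "(b, d) \<notin> adj G"
  shows "cycle_class [a, b, c, d] \<in> two_cells G"
proof -
  have "simple_cycle G [a, b, c, d]"
    using assms adj_verts graph by (intro simple_cycle_4) (auto simp: graph_cycle_4 graph_def)
  then show ?thesis
    unfolding two_cells_def by (intro CollectI exI[of _ "[a, b, c, d]"]) simp
qed

end

subsection \<open>Edge paths and boundary loops\<close>

lemma edge_ends_cases: "edge_ends {u, v} = (u, v) \<or> edge_ends {u, v} = (v, u)"
proof -
  have "case edge_ends {u, v} of (x, y) \<Rightarrow> {u, v} = {x, y}"
    unfolding edge_ends_def by (rule someI[of _ "(u, v)"]) simp
  then show ?thesis
    by (auto simp: doubleton_eq_iff split: prod.splits)
qed

lemma edge_path_0 [simp]: "u \<noteq> v \<Longrightarrow> edge_path u v 0 = Inl u"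
  using edge_ends_cases[of u v] by (auto simp: edge_path_def characteristic_map_def edge_attach_def)

lemma edge_path_1 [simp]: "u \<noteq> v \<Longrightarrow> edge_path u v 1 = Inl v"
  using edge_ends_cases[of u v] by (auto simp: edge_path_def characteristic_map_def edge_attach_def)

lemma edge_path_rev: "u \<noteq> v \<Longrightarrow> edge_path v u t = edge_path u v (1 - t)"
  using edge_ends_cases[of u v] by (auto simp: edge_path_def insert_commute[of v u])

lemma edge_path_inner:
  "0 < t \<Longrightarrow> t < 1 \<Longrightarrow> \<exists>s. 0 < s \<and> s < 1 \<and> edge_path u v t = Inr ({u, v}, s)"
  by (auto simp: edge_path_def characteristic_map_def)

lemma characteristic_map_edge:
  assumes "u \<noteq> v"
  shows "characteristic_map {0, 1} edge_attach {u, v} s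
           = edge_path u v (if edge_ends {u, v} = (u, v) then s else 1 - s)"
  by (simp add: edge_path_def)

lemma cycle_loop_cis:
  assumes "j < length vs" "0 \<le> s" "s < 1"
  shows "cycle_loop vs (cis (2 * pi * (real j + s) / real (length vs)))
           = edge_path (vs ! j) (vs ! (Suc j mod length vs)) s"
proof -
  let ?n = "real (length vs)" and ?a = "2 * pi * (real j + s) / real (length vs)"
  have n: "?n > 0" using assms by auto
  have "real j + s < ?n"
    using assms by linarith
  then have a: "0 \<le> ?a" "?a < 2 * pi"
    using assms n by (auto simp: divide_simps)
  then have "Arg2pi (cis ?a) = ?a"
    by (intro Arg2pi_unique[of 1]) (auto simp: cis_conv_exp)
  then have "?n * Arg2pi (cis ?a) / (2 * pi) = real j + s"
    using n by simp
  moreover have "\<lfloor>s\<rfloor> = 0"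
    using assms by (simp add: floor_eq_iff)
  then have "nat \<lfloor>real j + s\<rfloor> = j" "frac (real j + s) = s"
    by (simp_all add: frac_def)
  ultimately show ?thesis
    by (simp add: cycle_loop_def Let_def)
qed

lemma circle_param:
  assumes "z \<in> sphere 0 1" "n > 0"
  obtains j s where "j < n" "0 \<le> s" "s < 1" "z = cis (2 * pi * (real j + s) / real n)"
proof -
  define r where "r = real n * Arg2pi z / (2 * pi)"
  have "0 \<le> Arg2pi z" "Arg2pi z < 2 * pi" "z = cis (Arg2pi z)"
    using Arg2pi[of z] assms by (auto simp: cis_conv_exp is_Arg_def)
  then have r: "0 \<le> r" "r < real n" "z = cis (2 * pi * r / real n)"
    using assms by (auto simp: r_def divide_simps)
  have rj: "real (nat \<lfloor>r\<rfloor>) + frac r = r"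
    using r(1) by (simp add: frac_def)
  moreover have "nat \<lfloor>r\<rfloor> < n"
    using r rj frac_ge_0[of r] by linarith
  ultimately show thesis
    using r(3) frac_lt_1[of r] frac_ge_0[of r] by (intro that[of "nat \<lfloor>r\<rfloor>" "frac r"]) simp_all
qed

text \<open>The sector of the closed disc around the \<open>k\<close>-th corner of an \<open>n\<close>-gon, of half-angle
  \<open>2 * pi / n\<close> and without the centre.\<close>

definition sector_set :: "nat \<Rightarrow> nat \<Rightarrow> complex set" where
  "sector_set n k = {y. norm y * cos (2 * pi / n) < Re (y * cnj (cis (2 * pi * k / n)))}"

lemma open_sector_set: "open (sector_set n k)"
  unfolding sector_set_def by (intro open_Collect_less continuous_intros)

text \<open>Here \<open>x\<close> is a signed position on a circle of circumference
  \<open>n\<close>. Evenness and periodicity of the cosine fold it to its distance \<open>?y\<close>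
  from 0 along the circle, at most \<open>n / 2\<close>; on that range the cosine is strictly
  decreasing in \<open>?y\<close>.\<close>

lemma cos_sector_iff:
  assumes "n \<ge> 2" "\<bar>x\<bar> < real n"
  shows "cos (2 * pi / n) < cos (2 * pi * x / n) \<longleftrightarrow> \<bar>x\<bar> < 1 \<or> \<bar>x\<bar> > real n - 1"
proof -
  have n: "real n > 0" "real n \<ge> 2" using assms by auto
  let ?y = "if \<bar>x\<bar> \<le> real n / 2 then \<bar>x\<bar> else real n - \<bar>x\<bar>"
  have "cos (2 * pi * x / n) = cos (2 * pi * \<bar>x\<bar> / n)"
    using cos_minus[of "2 * pi * x / n"] by (cases "x \<ge> 0") simp_all
  also have "\<dots> = cos (2 * pi * ?y / n)"
  proof (cases "\<bar>x\<bar> \<le> real n / 2")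
    case False
    have "2 * pi * (real n - \<bar>x\<bar>) / n = 2 * pi - 2 * pi * \<bar>x\<bar> / n"
      using n by (simp add: field_simps)
    then show ?thesis
      using False by (simp add: cos_diff)
  qed simp
  finally have "cos (2 * pi / n) < cos (2 * pi * x / n) \<longleftrightarrow> cos (2 * pi * 1 / n) < cos (2 * pi * ?y / n)"
    by simp
  also have "\<dots> \<longleftrightarrow> 2 * pi * ?y / n < 2 * pi * 1 / n"
  proof (rule cos_mono_less_eq)
    show "0 \<le> 2 * pi * 1 / real n" "2 * pi * 1 / real n \<le> pi" "0 \<le> 2 * pi * ?y / real n" "2 * pi * ?y / real n \<le> pi"
      using n assms by (auto simp: divide_simps)
  qed
  also have "\<dots> \<longleftrightarrow> ?y < 1"
    using n by (simp add: divide_simps)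
  also have "\<dots> \<longleftrightarrow> \<bar>x\<bar> < 1 \<or> \<bar>x\<bar> > real n - 1"
    using n by auto
  finally show ?thesis .
qed

text \<open>The angular distance to corner \<open>k\<close> is below one side only on the two sides
  meeting there. This is what makes the sectors in the discs fit the open stars of the
  graph.\<close>

lemma cis_mem_sector_set:
  assumes "n \<ge> 2" "j < n" "k < n" "0 \<le> s" "s < 1"
  shows "cis (2 * pi * (real j + s) / n) \<in> sector_set n k \<longleftrightarrow> k = j \<or> k = Suc j mod n \<and> s > 0"
proof -
  have "2 * pi * (real j + s) / n - 2 * pi * k / n = 2 * pi * (real j + s - real k) / n"
    by (simp add: diff_divide_distrib right_diff_distrib)
  then have eq: "cis (2 * pi * (real j + s) / n) * cnj (cis (2 * pi * k / n)) = cis (2 * pi * (real j + s - real k) / n)"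
    by (simp add: cis_cnj cis_mult)
  have "cis (2 * pi * (real j + s) / n) \<in> sector_set n k
      \<longleftrightarrow> cos (2 * pi / n) < cos (2 * pi * (real j + s - real k) / n)"
    unfolding sector_set_def mem_Collect_eq eq by simp
  also have "\<dots> \<longleftrightarrow> \<bar>real j + s - real k\<bar> < 1 \<or> \<bar>real j + s - real k\<bar> > real n - 1"
    using assms by (intro cos_sector_iff) auto
  also have "\<dots> \<longleftrightarrow> k = j \<or> k = Suc j mod n \<and> s > 0"
  proof -
    \<comment> \<open>The third case is the wrap-around from the last corner to corner 0: there the
      difference of the positions exceeds \<open>n - 1\<close> once \<open>s > 0\<close>.\<close>
    consider "k = j" | "k = Suc j" | "k = 0" "Suc j = n" "j \<noteq> 0" | "Suc k \<le> j" "k \<noteq> 0 \<or> Suc j \<noteq> n"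
      | "Suc (Suc j) \<le> k"
      using assms by linarith
    then show ?thesis
    proof cases
      case 2
      then have "Suc j mod n = k" "real k = real j + 1"
        using assms by simp_all
      with 2 assms show ?thesis
        by (auto simp: abs_if)
    next
      case 3
      then have "Suc j mod n = k" "real n = real j + 1" "real j \<ge> 1"
        by simp_all
      with 3 assms show ?thesis
        by (auto simp: abs_if)
    next
      case 4
      then have "real k + 1 \<le> real j" "real j + 2 \<le> real n + real k"
        using assms by linarith+
      moreover have "Suc j mod n = (if Suc j = n then 0 else Suc j)"
        using assms by simp
      ultimately show ?thesis
        using 4 assms by (auto simp: abs_if)
    next
      case 5
      then have "real j + 2 \<le> real k" "real k + 1 \<le> real n"
        using assms by linarith+
      moreover have "Suc j mod n = Suc j"
        using 5 assms by simp
      ultimately show ?thesis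
        using 5 assms by (auto simp: abs_if)
    qed (use assms in auto)
  qed
  finally show ?thesis .
qed

subsection \<open>Points of the complex\<close>

context reflexive_graph
begin

abbreviation "edge_map \<equiv> characteristic_map {0, 1} edge_attach"

definition "cell_map = characteristic_map (sphere 0 1) two_cell_attach"

lemma edges_cases:
  assumes "e \<in> edges G"
  obtains u v where "e = {u, v}" "u \<noteq> v" "(u, v) \<in> adj G"
  using assms unfolding edges_def by blast

lemma edge_attach_verts: "e \<in> edges G \<Longrightarrow> edge_attach e t \<in> topspace (discrete_topology (verts G))"
proof (elim edges_cases)
  fix u v assume "e = {u, v}" "(u, v) \<in> adj G"
  then show ?thesis
    using edge_ends_cases[of u v] adj_verts[of u v] by (auto simp: edge_attach_def)
qed

lemma topspace_one_skeleton:
  "topspace (one_skeleton G) = Inl ` verts G \<union> Inr ` (edges G \<times> ({0..1} - {0, 1}))"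
  unfolding one_skeleton_def using edge_attach_verts by (subst topspace_attach_cells) auto

lemma continuous_edge_map:
  "e \<in> edges G \<Longrightarrow> continuous_map (top_of_set {0..1}) (one_skeleton G) (edge_map e)"
  unfolding one_skeleton_def using edge_attach_verts by (intro continuous_map_characteristic_map)

lemma edge_mem: "(u, v) \<in> adj G \<Longrightarrow> u \<noteq> v \<Longrightarrow> {u, v} \<in> edges G"
  unfolding edges_def by blast

lemma continuous_edge_path:
  assumes "(u, v) \<in> adj G" "u \<noteq> v"
  shows "continuous_map (top_of_set {0..1}) (one_skeleton G) (edge_path u v)"
proof -
  have "continuous_map (top_of_set {0..1}) (top_of_set {0..1::real})
      (\<lambda>t. if edge_ends {u, v} = (u, v) then t else 1 - t)"
    by (auto simp: continuous_map_in_subtopology intro!: continuous_intros)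
  from continuous_map_compose[OF this continuous_edge_map[OF edge_mem[OF assms]]] show ?thesis
    by (simp add: o_def edge_path_def[abs_def])
qed

lemma edge_path_mem:
  "(u, v) \<in> adj G \<Longrightarrow> u \<noteq> v \<Longrightarrow> t \<in> {0..1} \<Longrightarrow> edge_path u v t \<in> topspace (one_skeleton G)"
  using continuous_edge_path[of u v] by (auto simp: continuous_map_def)

lemma two_cell_attach_param:
  assumes C: "C \<in> two_cells G" and z: "z \<in> sphere 0 1"
  obtains j s where "j < length (rep C)" "0 \<le> s" "s < 1"
    "z = cis (2 * pi * (real j + s) / real (length (rep C)))"
    "two_cell_attach C z = edge_path (rep C ! j) (rep C ! (Suc j mod length (rep C))) s"
proof -
  have "length (rep C) > 0"
    using rep_facts(1)[OF C] by auto
  with circle_param[OF z] obtain j s where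
    js: "j < length (rep C)" "0 \<le> s" "s < 1" "z = cis (2 * pi * (real j + s) / real (length (rep C)))"
    by metis
  with cycle_loop_cis[OF js(1-3)] that show thesis
    by (simp add: two_cell_attach_rep)
qed

lemma two_cell_attach_mem:
  assumes "C \<in> two_cells G" "z \<in> sphere 0 1"
  shows "two_cell_attach C z \<in> topspace (one_skeleton G)"
  using assms
proof (rule two_cell_attach_param)
  fix j s
  assume "j < length (rep C)" "0 \<le> s" "s < 1"
    and eq: "two_cell_attach C z = edge_path (rep C ! j) (rep C ! (Suc j mod length (rep C))) s"
  then show ?thesis
    unfolding eq using assms(1) rep_facts(3) rep_next_neq(1) by (intro edge_path_mem) auto
qed

lemma topspace_X_complex:
  "topspace (X_complex G) = Inl ` topspace (one_skeleton G) \<union> Inr ` (two_cells G \<times> ball 0 1)"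
proof -
  have "cball 0 1 - sphere 0 1 = (ball 0 1 :: complex set)"
    by auto
  then show ?thesis
    unfolding X_complex_def using two_cell_attach_mem by (subst topspace_attach_cells) auto
qed

lemma continuous_Inl_X_complex: "continuous_map (one_skeleton G) (X_complex G) Inl"
  unfolding X_complex_def using two_cell_attach_mem by (intro continuous_map_Inl_attach_cells)

lemma continuous_cell_map:
  "C \<in> two_cells G \<Longrightarrow> continuous_map (top_of_set (cball 0 1)) (X_complex G) (cell_map C)"
  unfolding X_complex_def cell_map_def using two_cell_attach_mem by (intro continuous_map_characteristic_map)

lemma cell_map_ball: "y \<in> ball 0 1 \<Longrightarrow> cell_map C y = Inr (C, y)"
  by (auto simp: cell_map_def characteristic_map_def)

lemma cell_map_sphere: "y \<in> sphere 0 1 \<Longrightarrow> cell_map C y = Inl (two_cell_attach C y)"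
  by (auto simp: cell_map_def characteristic_map_def)

lemma X_complex_cases:
  assumes "x \<in> topspace (X_complex G)"
  obtains (vertex) v where "x = Inl (Inl v)" "v \<in> verts G"
    | (edge) u v s where "x = Inl (edge_path u v s)" "(u, v) \<in> adj G" "u \<noteq> v" "0 < s" "s < 1"
    | (cell) C y where "x = Inr (C, y)" "C \<in> two_cells G" "y \<in> ball 0 1"
proof -
  have "x \<in> Inl ` (Inl ` verts G \<union> Inr ` (edges G \<times> ({0..1} - {0, 1}))) \<union> Inr ` (two_cells G \<times> ball 0 1)"
    using assms unfolding topspace_X_complex topspace_one_skeleton .
  then consider v where "x = Inl (Inl v)" "v \<in> verts G"
    | e s where "x = Inl (Inr (e, s))" "e \<in> edges G" "s \<in> {0..1} - {0, 1}"
    | C y where "x = Inr (C, y)" "C \<in> two_cells G" "y \<in> ball 0 1"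
    by blast
  then show thesis
  proof cases
    case (2 e s)
    then obtain u v where uv: "e = {u, v}" "u \<noteq> v" "(u, v) \<in> adj G"
      by (elim edges_cases)
    let ?s = "if edge_ends {u, v} = (u, v) then s else 1 - s"
    have "x = Inl (edge_path u v ?s)"
      using 2 uv by (simp add: edge_path_def characteristic_map_def)
    then show thesis
      using 2 uv by (intro edge[of u v ?s]) auto
  qed (use vertex cell in blast)+
qed

subsection \<open>Vertices of the carrier cell\<close>

definition cell_verts :: "('a + 'a set \<times> real) + 'a list set \<times> complex \<Rightarrow> 'a set" where
  "cell_verts x = (case x of
      Inl (Inl v) \<Rightarrow> {v} | Inl (Inr (e, s)) \<Rightarrow> e | Inr (C, y) \<Rightarrow> set (rep C))"

lemma cell_verts_vertex [simp]: "cell_verts (Inl (Inl v)) = {v}"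
  by (simp add: cell_verts_def)

lemma cell_verts_cell [simp]: "cell_verts (Inr (C, y)) = set (rep C)"
  by (simp add: cell_verts_def)

lemma cell_verts_edge_path:
  assumes "u \<noteq> v" "0 \<le> s" "s \<le> 1"
  shows "cell_verts (Inl (edge_path u v s)) = (if s = 0 then {u} else if s = 1 then {v} else {u, v})"
  using assms edge_path_inner[of s u v] by (auto simp: cell_verts_def)

text \<open>Opposite corners of a square have a common neighbour, and of any three corners one is
  adjacent to the other two. Here it matters that the cells are triangles and squares: in a pentagon
  without chords the corners 0, 1, 3 contain no such centre.\<close>

lemma cluster_cell_verts:
  assumes "x \<in> topspace (X_complex G)"
  shows "cluster (cell_verts x)"
  using assms
proof (cases rule: X_complex_cases)
  case (vertex v)
  then show ?thesis
    using adj_refl[of v] by (auto simp: cluster_def linked_def)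
next
  case (edge u v s)
  note adj = edge(2) adj_sym[OF edge(2)] adj_refl adj_verts[OF edge(2)]
  have "linked u u" "linked v v" "linked u v" "linked v u"
    using adj unfolding linked_def by blast+
  with edge adj show ?thesis
    by (auto simp: cluster_def cell_verts_edge_path)
next
  case (cell C y)
  from cell(2) show ?thesis
  proof (cases rule: two_cell_cases)
    case (triangle a b c)
    note adj = triangle(3-5) triangle(3-5)[THEN adj_sym]
    have "{a, b, c} \<subseteq> verts G"
      using adj adj_verts by blast
    moreover have "linked u v" if "u \<in> {a, b, c}" "v \<in> {a, b, c}" for u v
      using that adj adj_refl calculation unfolding linked_def by blast
    ultimately show ?thesis
      using adj unfolding cell cell_verts_cell triangle(1) cluster_def by auto
  next
    case (square a b c d)
    note adj = square(3-6) square(3-6)[THEN adj_sym]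
    have "{a, b, c, d} \<subseteq> verts G"
      using adj adj_verts by blast
    moreover have "linked u v" if "u \<in> {a, b, c, d}" "v \<in> {a, b, c, d}" for u v
      using that adj adj_refl calculation unfolding linked_def by blast
    ultimately show ?thesis
      using adj unfolding cell cell_verts_cell square(1) cluster_def by auto
  qed
qed

lemma cell_verts_nonempty:
  assumes "x \<in> topspace (X_complex G)"
  shows "cell_verts x \<noteq> {}"
  using assms
proof (cases rule: X_complex_cases)
  case (edge u v s)
  then show ?thesis by (simp add: cell_verts_edge_path)
next
  case (cell C y)
  then show ?thesis using rep_facts(1)[OF cell(2)] by auto
qed auto

subsection \<open>A cover by sectors and open cells\<close>

definition sector :: "'a \<Rightarrow> (('a + 'a set \<times> real) + 'a list set \<times> complex) set" where
  "sector w = {x \<in> topspace (X_complex G). case x of Inl p \<Rightarrow> w \<in> cell_verts (Inl p)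
     | Inr (C, y) \<Rightarrow> \<exists>k<length (rep C). rep C ! k = w \<and> y \<in> sector_set (length (rep C)) k}"

definition open_cell :: "'a list set \<Rightarrow> (('a + 'a set \<times> real) + 'a list set \<times> complex) set" where
  "open_cell C = (\<lambda>y. Inr (C, y)) ` ball 0 1"

lemma Inl_mem_sector: "Inl p \<in> sector w \<longleftrightarrow> p \<in> topspace (one_skeleton G) \<and> w \<in> cell_verts (Inl p)"
  by (auto simp: sector_def topspace_X_complex)

lemma sector_subset: "x \<in> sector w \<Longrightarrow> x \<in> topspace (X_complex G) \<and> w \<in> cell_verts x"
  by (auto simp: sector_def split: sum.splits)

text \<open>In the open disc this is the definition of \<open>sector\<close>; on the circle, where
  the sector is defined through the graph, it is \<open>cis_mem_sector_set\<close>. The preimage of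
  a sector in a closed disc is therefore relatively open.\<close>

lemma cell_map_mem_sector:
  assumes C: "C \<in> two_cells G" and y: "y \<in> cball 0 1"
  shows "cell_map C y \<in> sector w
      \<longleftrightarrow> (\<exists>k<length (rep C). rep C ! k = w \<and> y \<in> sector_set (length (rep C)) k)"
proof (cases "y \<in> ball 0 1")
  case True
  then show ?thesis
    using C by (auto simp: cell_map_ball sector_def topspace_X_complex)
next
  case False
  let ?n = "length (rep C)"
  have n: "?n \<ge> 2"
    using rep_facts(1)[OF C] by auto
  have S: "y \<in> sphere 0 1"
    using y False by auto
  from C S obtain j s where js: "j < ?n" "0 \<le> s" "s < 1"
      "y = cis (2 * pi * (real j + s) / real ?n)"
      "two_cell_attach C y = edge_path (rep C ! j) (rep C ! (Suc j mod ?n)) s"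
    by (rule two_cell_attach_param)
  note nx = rep_next_neq[OF C js(1)]
  have "cell_map C y \<in> sector w \<longleftrightarrow> w \<in> cell_verts (Inl (edge_path (rep C ! j) (rep C ! (Suc j mod ?n)) s))"
    using two_cell_attach_mem[OF C S] by (simp add: cell_map_sphere[OF S] Inl_mem_sector js(5))
  also have "\<dots> \<longleftrightarrow> rep C ! j = w \<or> s > 0 \<and> rep C ! (Suc j mod ?n) = w"
    using js nx by (auto simp: cell_verts_edge_path)
  also have "\<dots> \<longleftrightarrow> (\<exists>k<?n. rep C ! k = w \<and> (k = j \<or> k = Suc j mod ?n \<and> s > 0))"
    using js nx by blast
  also have "\<dots> \<longleftrightarrow> (\<exists>k<?n. rep C ! k = w \<and> y \<in> sector_set ?n k)"
    unfolding js(4) using cis_mem_sector_set[OF n js(1) _ js(2,3)] by blast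
  finally show ?thesis .
qed

lemma openin_sector: "openin (X_complex G) (sector w)"
  unfolding X_complex_def openin_attach_cells
proof (intro conjI ballI)
  show "sector w \<subseteq> Inl ` topspace (one_skeleton G)
      \<union> Inr ` (two_cells G \<times> (topspace (top_of_set (cball 0 1)) - sphere 0 1))"
    by (auto simp: sector_def topspace_X_complex)
  have *: "{p \<in> topspace (one_skeleton G). Inl p \<in> sector w}
      = {p \<in> topspace (one_skeleton G). w \<in> cell_verts (Inl p)}"
    by (auto simp: Inl_mem_sector)
  have "openin (one_skeleton G) {p \<in> topspace (one_skeleton G). w \<in> cell_verts (Inl p)}"
    unfolding one_skeleton_def openin_attach_cells
    unfolding one_skeleton_def[symmetric]
  proof (intro conjI ballI)
    fix e assume e: "e \<in> edges G"
    then obtain u v where uv: "e = {u, v}" "u \<noteq> v" "(u, v) \<in> adj G"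
      by (elim edges_cases)
    \<comment> \<open>An edge at \<open>w\<close> meets the star of \<open>w\<close> in everything
      except its other end, whose parameter is 1 or 0 depending on the chosen orientation.\<close>
    have "{t \<in> {0..1}. edge_map e t \<in> {p \<in> topspace (one_skeleton G). w \<in> cell_verts (Inl p)}}
        = {0..1} \<inter> (if w \<notin> e then {} else if w = edge_attach e 0 then - {1} else - {0})"
      (is "?L = {0..1} \<inter> ?U")
    proof -
      have "edge_map e t \<in> topspace (one_skeleton G)" if "t \<in> {0..1}" for t
        using continuous_edge_map[OF e] that by (auto simp: continuous_map_def)
      moreover have "w \<in> cell_verts (Inl (edge_map e t)) \<longleftrightarrow> t \<in> ?U" if "t \<in> {0..1}" for t
        using that uv(2) edge_ends_cases[of u v] unfolding uv(1)
        by (auto simp: characteristic_map_def cell_verts_def edge_attach_def)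
      ultimately show ?thesis
        by auto
    qed
    moreover have "open ?U"
      by auto
    ultimately show "openin (top_of_set {0..1}) {t \<in> topspace (top_of_set {0..1}).
        edge_map e t \<in> {p \<in> topspace (one_skeleton G). w \<in> cell_verts (Inl p)}}"
      by (simp add: openin_open_Int)
  qed (auto simp: topspace_one_skeleton)
  then show "openin (one_skeleton G) {p \<in> topspace (one_skeleton G). Inl p \<in> sector w}"
    unfolding * .
  fix C assume C: "C \<in> two_cells G"
  let ?U = "\<Union>k\<in>{k. k < length (rep C) \<and> rep C ! k = w}. sector_set (length (rep C)) k"
  have "{y \<in> topspace (top_of_set (cball 0 1)). cell_map C y \<in> sector w} = cball 0 1 \<inter> ?U"
    using cell_map_mem_sector[OF C] by auto
  moreover have "open ?U"
    using open_sector_set by blast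
  ultimately show "openin (top_of_set (cball 0 1)) {y \<in> topspace (top_of_set (cball 0 1)).
      characteristic_map (sphere 0 1) two_cell_attach C y \<in> sector w}"
    by (simp add: openin_open_Int cell_map_def)
qed

lemma openin_open_cell:
  assumes "C \<in> two_cells G" "open U" "U \<subseteq> ball 0 1"
  shows "openin (X_complex G) ((\<lambda>y. Inr (C, y)) ` U)"
  unfolding X_complex_def openin_attach_cells
proof (intro conjI ballI)
  show "(\<lambda>y. Inr (C, y)) ` U \<subseteq> Inl ` topspace (one_skeleton G)
      \<union> Inr ` (two_cells G \<times> (topspace (top_of_set (cball 0 1)) - sphere 0 1))"
    using assms by auto
  have *: "{p \<in> topspace (one_skeleton G). Inl p \<in> (\<lambda>y. Inr (C, y)) ` U} = {}"
    by auto
  show "openin (one_skeleton G) {p \<in> topspace (one_skeleton G). Inl p \<in> (\<lambda>y. Inr (C, y)) ` U}"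
    unfolding * by simp
  fix D
  have "{y \<in> topspace (top_of_set (cball 0 1)). characteristic_map (sphere 0 1) two_cell_attach D y
        \<in> (\<lambda>y. Inr (C, y)) ` U} = cball 0 1 \<inter> (if D = C then U else {})"
    using assms(3) by (auto simp: characteristic_map_def)
  then show "openin (top_of_set (cball 0 1)) {y \<in> topspace (top_of_set (cball 0 1)).
      characteristic_map (sphere 0 1) two_cell_attach D y \<in> (\<lambda>y. Inr (C, y)) ` U}"
    using assms(2) by (simp add: openin_open_Int)
qed

definition cover :: "(('a + 'a set \<times> real) + 'a list set \<times> complex) set set" where
  "cover = range sector \<union> open_cell ` two_cells G"

lemma openin_cover: "U \<in> cover \<Longrightarrow> openin (X_complex G) U"
  unfolding cover_def open_cell_def using openin_sector openin_open_cell by auto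

lemma cover_covers: "topspace (X_complex G) \<subseteq> \<Union>cover"
proof
  fix x assume x: "x \<in> topspace (X_complex G)"
  then obtain w where w: "w \<in> cell_verts x"
    using cell_verts_nonempty by blast
  from x show "x \<in> \<Union>cover"
  proof (cases rule: X_complex_cases)
    case (cell C y)
    then have "x \<in> open_cell C"
      by (simp add: open_cell_def)
    with cell(2) show ?thesis
      unfolding cover_def by blast
  qed (use x w in \<open>auto simp: cover_def sector_def\<close>)
qed

subsection \<open>Rays towards a vertex\<close>

definition index :: "'a list set \<Rightarrow> 'a \<Rightarrow> nat" where
  "index C w = (SOME k. k < length (rep C) \<and> rep C ! k = w)"

definition corner :: "'a list set \<Rightarrow> nat \<Rightarrow> complex" where
  "corner C k = cis (2 * pi * k / length (rep C))"

lemma index_nth: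
  assumes "C \<in> two_cells G" "k < length (rep C)"
  shows "index C (rep C ! k) = k"
proof -
  have "index C (rep C ! k) < length (rep C) \<and> rep C ! index C (rep C ! k) = rep C ! k"
    unfolding index_def by (rule someI[of _ k]) (use assms in simp)
  then show ?thesis
    using rep_facts(2)[OF assms(1)] assms(2) nth_eq_iff_index_eq by blast
qed

text \<open>Intended for \<open>w\<close> in \<open>cell_verts x\<close>: a straight path from
  \<open>x\<close> to \<open>w\<close> in the coordinates of the cell. It exists from every point of
  a 2-cell, the centre included, but it cannot contract a whole sector, since segments leave the
  boundary circle.\<close>

definition ray :: "('a + 'a set \<times> real) + 'a list set \<times> complex \<Rightarrow> 'a \<Rightarrow> real \<Rightarrow> ('a + 'a set \<times> real) + 'a list set \<times> complex"
  where "ray x w t = (case x of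
      Inl (Inl v) \<Rightarrow> Inl (Inl v)
    | Inl (Inr (e, s)) \<Rightarrow> Inl (edge_map e ((1 - t) * s + t * (if w = edge_attach e 0 then 0 else 1)))
    | Inr (C, y) \<Rightarrow> cell_map C ((1 - t) *\<^sub>R y + t *\<^sub>R corner C (index C w)))"

lemma ray_vertex [simp]: "ray (Inl (Inl v)) w t = Inl (Inl v)"
  by (simp add: ray_def)

lemma ray_edge:
  assumes "w \<noteq> u" "0 < s" "s < 1"
  shows "ray (Inl (edge_path w u s)) w t = Inl (edge_path w u ((1 - t) * s))"
proof (cases "edge_ends {w, u} = (w, u)")
  case True
  then show ?thesis
    using assms by (simp add: edge_path_def characteristic_map_def ray_def edge_attach_def)
next
  case False
  then have *: "edge_ends {w, u} = (u, w)"
    using edge_ends_cases by metis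
  have "(1 - t) * (1 - s) + t = 1 - (1 - t) * s"
    by (simp add: algebra_simps)
  then have "ray (Inl (edge_path w u s)) w t = Inl (edge_map {w, u} (1 - (1 - t) * s))"
    using assms * by (simp add: edge_path_def characteristic_map_def[of _ _ _ "1 - s"] ray_def edge_attach_def)
  then show ?thesis
    using assms * by (simp add: edge_path_def)
qed

lemma ray_cell:
  "C \<in> two_cells G \<Longrightarrow> k < length (rep C) \<Longrightarrow>
     ray (Inr (C, y)) (rep C ! k) t = cell_map C ((1 - t) *\<^sub>R y + t *\<^sub>R corner C k)"
  by (simp add: ray_def index_nth)

lemma cell_verts_cases:
  assumes "x \<in> topspace (X_complex G)" "w \<in> cell_verts x"
  obtains (vertex) "x = Inl (Inl w)" "w \<in> verts G"
    | (edge) u s where "x = Inl (edge_path w u s)" "(w, u) \<in> adj G" "w \<noteq> u" "0 < s" "s < 1"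
    | (cell) C k y where "x = Inr (C, y)" "C \<in> two_cells G" "y \<in> ball 0 1" "k < length (rep C)" "rep C ! k = w"
  using assms(1)
proof (cases rule: X_complex_cases)
  case (edge u v s)
  then have "w = u \<or> w = v"
    using assms(2) by (auto simp: cell_verts_edge_path)
  then show thesis
  proof
    assume "w = u"
    with edge show thesis
      using that(2) by blast
  next
    assume "w = v"
    have "edge_path u v s = edge_path v u (1 - s)"
      using edge_path_rev[of v u s] edge(3) by simp
    with edge \<open>w = v\<close> show thesis
      using that(2)[of u "1 - s"] adj_sym by auto
  qed
next
  case (cell C y)
  then obtain k where "k < length (rep C)" "rep C ! k = w"
    using assms(2) by (auto simp: in_set_conv_nth)
  with cell show thesis
    using that(3) by blast
qed (use assms that in auto)

lemma corner_mem: "corner C k \<in> cball 0 1" "norm (corner C k) = 1"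
  by (simp_all add: corner_def)

lemma segment_mem: "y \<in> cball 0 1 \<Longrightarrow> 0 \<le> t \<Longrightarrow> t \<le> 1 \<Longrightarrow> (1 - t) *\<^sub>R y + t *\<^sub>R corner C k \<in> cball 0 1"
  using corner_mem by (intro convexD[OF convex_cball]) auto

lemma corner_Suc:
  assumes "j < length (rep C)"
  shows "corner C (Suc j mod length (rep C)) = cis (2 * pi * (real j + 1) / length (rep C))"
proof (cases "Suc j = length (rep C)")
  case True
  then have "real j + 1 = real (length (rep C))" "real (length (rep C)) \<noteq> 0" "Suc j mod length (rep C) = 0"
    using assms by auto
  then show ?thesis
    unfolding corner_def by simp
next
  case False
  with assms show ?thesis
    by (simp add: corner_def add.commute)
qed

text \<open>At \<open>s = 1\<close> the loop has already switched to the next side, at its parameter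
  0; both descriptions give the common vertex.\<close>

lemma cell_map_arc:
  assumes C: "C \<in> two_cells G" and j: "j < length (rep C)" and s: "0 \<le> s" "s \<le> 1"
  shows "cell_map C (cis (2 * pi * (real j + s) / length (rep C)))
           = Inl (edge_path (rep C ! j) (rep C ! (Suc j mod length (rep C))) s)"
proof (cases "s < 1")
  case True
  with j s show ?thesis
    by (simp add: cell_map_sphere two_cell_attach_rep cycle_loop_cis)
next
  case False
  let ?n = "length (rep C)"
  note nx = rep_next_neq[OF C j]
  have s1: "s = 1" using s False by simp
  have "cell_map C (corner C (Suc j mod ?n))
      = Inl (edge_path (rep C ! (Suc j mod ?n)) (rep C ! (Suc (Suc j mod ?n) mod ?n)) 0)"
    using cycle_loop_cis[OF nx(2), of 0] by (simp add: cell_map_sphere two_cell_attach_rep corner_def)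
  also have "\<dots> = Inl (Inl (rep C ! (Suc j mod ?n)))"
    using rep_next_neq(1)[OF C nx(2)] by simp
  finally show ?thesis
    using nx unfolding corner_Suc[OF j] s1 by simp
qed

lemma cell_map_corner:
  assumes "C \<in> two_cells G" "k < length (rep C)"
  shows "cell_map C (corner C k) = Inl (Inl (rep C ! k))"
  using cell_map_arc[OF assms, of 0] rep_next_neq(1)[OF assms] by (simp add: corner_def)

lemma continuous_ray:
  assumes "x \<in> topspace (X_complex G)" "w \<in> cell_verts x"
  shows "continuous_map (top_of_set {0..1}) (X_complex G) (ray x w)"
  using assms
proof (cases rule: cell_verts_cases)
  case vertex
  then show ?thesis
    using assms(1) by (simp add: ray_def[abs_def])
next
  case (edge u s)
  have "(1 - t) * s \<le> 1" if "0 \<le> t" "t \<le> 1" for t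
    using that edge by (intro mult_le_one) auto
  then have "continuous_map (top_of_set {0..1}) (top_of_set {0..1}) (\<lambda>t. (1 - t) * s)"
    using edge by (auto simp: continuous_map_in_subtopology intro!: continuous_intros)
  from continuous_map_compose[OF continuous_map_compose[OF this continuous_edge_path[OF edge(2,3)]] continuous_Inl_X_complex]
  show ?thesis
    unfolding edge(1) ray_edge[OF edge(3-5), abs_def] by (simp add: o_def)
next
  case (cell C k y)
  have "continuous_map (top_of_set {0..1}) (top_of_set (cball 0 1)) (\<lambda>t. (1 - t) *\<^sub>R y + t *\<^sub>R corner C k)"
    using cell(3) segment_mem[of y] by (auto simp: continuous_map_in_subtopology intro!: continuous_intros)
  from continuous_map_compose[OF this continuous_cell_map[OF cell(2)]] show ?thesis
    unfolding cell(1) cell(5)[symmetric] ray_cell[OF cell(2,4), THEN ext] by (simp add: o_def)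
qed

lemma ray_ends:
  assumes "x \<in> topspace (X_complex G)" "w \<in> cell_verts x"
  shows "ray x w 0 = x" "ray x w 1 = Inl (Inl w)"
proof -
  have "ray x w 0 = x \<and> ray x w 1 = Inl (Inl w)"
    using assms
  proof (cases rule: cell_verts_cases)
    case (edge u s)
    then show ?thesis
      by (simp add: ray_edge)
  next
    case (cell C k y)
    with ray_cell[OF cell(2,4)] show ?thesis
      by (simp add: cell_map_ball cell_map_corner[OF cell(2,4)])
  qed simp
  then show "ray x w 0 = x" "ray x w 1 = Inl (Inl w)"
    by auto
qed

text \<open>The angle is \<open>2 * pi / 3\<close> or \<open>pi / 2\<close>. The sign of the cosine
  turns lower bounds for norms into upper bounds, and the strict bound keeps sectors away from the
  ray opposite to the corner.\<close>

lemma cos_cell_angle: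
  assumes "C \<in> two_cells G"
  shows "cos (2 * pi / length (rep C)) \<le> 0" "- 1 < cos (2 * pi / length (rep C))"
proof -
  have n: "length (rep C) = 3 \<or> length (rep C) = 4"
    using rep_facts(1)[OF assms] by auto
  then have "pi / 2 \<le> 2 * pi / length (rep C)" "2 * pi / length (rep C) < pi"
    by auto
  moreover have "0 \<le> pi / 2"
    by simp
  ultimately have "cos (2 * pi / length (rep C)) \<le> cos (pi / 2)" "cos pi < cos (2 * pi / length (rep C))"
    by (intro cos_monotone_0_pi_le cos_monotone_0_pi; linarith)+
  then show "cos (2 * pi / length (rep C)) \<le> 0" "- 1 < cos (2 * pi / length (rep C))"
    by simp_all
qed

text \<open>For triangles the sector spans more than a half-plane and is not convex, but it is
  star-shaped about its corner.\<close>

lemma segment_sector_set: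
  assumes C: "C \<in> two_cells G" and y: "y \<in> sector_set (length (rep C)) k" and t: "0 \<le> t" "t \<le> 1"
  shows "(1 - t) *\<^sub>R y + t *\<^sub>R corner C k \<in> sector_set (length (rep C)) k"
proof -
  let ?z = "corner C k" and ?c = "cos (2 * pi / length (rep C))"
  have zz: "?z * cnj ?z = 1"
    by (simp add: corner_def complex_norm_square[symmetric])
  have y': "norm y * ?c < Re (y * cnj ?z)"
    using y by (simp add: sector_set_def corner_def)
  have "((1 - t) *\<^sub>R y + t *\<^sub>R ?z) * cnj ?z = (1 - t) *\<^sub>R (y * cnj ?z) + t *\<^sub>R 1"
    using zz by (simp add: distrib_right)
  then have Re: "Re (((1 - t) *\<^sub>R y + t *\<^sub>R ?z) * cnj ?z) = (1 - t) * Re (y * cnj ?z) + t"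
    by simp
  \<comment> \<open>The reverse triangle inequality is the useful one, because multiplication by
    \<open>?c\<close>, which is not positive, reverses it.\<close>
  have "norm ((1 - t) *\<^sub>R y) - norm (t *\<^sub>R ?z) \<le> norm ((1 - t) *\<^sub>R y + t *\<^sub>R ?z)"
    by (rule norm_diff_ineq)
  then have "(1 - t) * norm y - t \<le> norm ((1 - t) *\<^sub>R y + t *\<^sub>R ?z)"
    using t corner_mem by simp
  then have "norm ((1 - t) *\<^sub>R y + t *\<^sub>R ?z) * ?c \<le> ((1 - t) * norm y - t) * ?c"
    using cos_cell_angle(1)[OF C] by (rule mult_right_mono_neg)
  also have "\<dots> = (1 - t) * (norm y * ?c) - t * ?c"
    by (simp add: algebra_simps)
  also have "\<dots> < (1 - t) * Re (y * cnj ?z) + t"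
  proof (cases "t = 0")
    case True
    then show ?thesis using y' by simp
  next
    case False
    have "(1 - t) * (norm y * ?c) \<le> (1 - t) * Re (y * cnj ?z)"
      using t y' by (intro mult_left_mono) auto
    moreover have "t * - 1 < t * ?c"
      using cos_cell_angle(2)[OF C] False t by (intro mult_strict_left_mono) auto
    ultimately show ?thesis
      by linarith
  qed
  finally show ?thesis
    unfolding sector_set_def corner_def[symmetric] mem_Collect_eq Re .
qed

text \<open>Needed so that a simplex in the sector, together with the rays from its ends, forms a
  loop inside the contractible set.\<close>

lemma ray_mem_sector:
  assumes x: "x \<in> sector w" and t: "0 \<le> t" "t \<le> 1"
  shows "ray x w t \<in> sector w"
proof -
  have x': "x \<in> topspace (X_complex G)" "w \<in> cell_verts x"
    using sector_subset[OF x] by auto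
  then show ?thesis
  proof (cases rule: cell_verts_cases)
    case vertex
    with x show ?thesis by simp
  next
    case (edge u s)
    have "(1 - t) * s \<le> s"
      using t edge by (intro mult_left_le_one_le) auto
    then have "(1 - t) * s < 1"
      using edge(5) by linarith
    moreover have "0 \<le> (1 - t) * s"
      using t edge by simp
    ultimately have *: "0 \<le> (1 - t) * s" "(1 - t) * s < 1"
      by auto
    then have "edge_path w u ((1 - t) * s) \<in> topspace (one_skeleton G)"
      by (intro edge_path_mem[OF edge(2,3)]) auto
    moreover have "w \<in> cell_verts (Inl (edge_path w u ((1 - t) * s)))"
      using * by (simp add: cell_verts_edge_path[OF edge(3)])
    ultimately show ?thesis
      unfolding edge(1) ray_edge[OF edge(3-5)] Inl_mem_sector by blast
  next
    case (cell C k y)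
    have "y \<in> sector_set (length (rep C)) k"
      using x cell rep_facts(2)[OF cell(2)] by (auto simp: sector_def nth_eq_iff_index_eq)
    from segment_sector_set[OF cell(2) this t] show ?thesis
      unfolding cell(1) cell(5)[symmetric] ray_cell[OF cell(2,4)]
      using cell segment_mem[of y t] t by (subst cell_map_mem_sector) auto
  qed
qed

subsection \<open>Sectors contract to their vertex\<close>

text \<open>The straight-line contraction in the coordinate \<open>Ln (y / z)\<close>; it preserves the unit circle,
  moving its points at constant speed towards \<open>z\<close>, so that it agrees with the contraction of the
  edges.\<close>

definition flow :: "complex \<Rightarrow> real \<Rightarrow> complex \<Rightarrow> complex" where
  "flow z t y = z * exp ((1 - t) *\<^sub>R Ln (y / z))"

definition contract where
  "contract w t x = (case x of Inl p \<Rightarrow> ray (Inl p) w t | Inr (C, y) \<Rightarrow> cell_map C (flow (corner C (index C w)) t y))"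

lemma flow_cis:
  assumes "\<bar>a\<bar> < pi"
  shows "flow (cis b) t (cis (b + a)) = cis (b + (1 - t) * a)"
proof -
  have "cis (b + a) / cis b = exp (\<i> * of_real a)"
    unfolding cis_divide cis_conv_exp[symmetric] by simp
  moreover have "Ln (exp (\<i> * of_real a)) = \<i> * of_real a"
    using assms by (intro Ln_exp) auto
  ultimately have "flow (cis b) t (cis (b + a)) = cis b * exp ((1 - t) *\<^sub>R (\<i> * of_real a))"
    by (simp add: flow_def)
  also have "(1 - t) *\<^sub>R (\<i> * of_real a) = \<i> * of_real ((1 - t) * a)"
    by (simp add: scaleR_conv_of_real)
  finally show ?thesis
    unfolding cis_conv_exp[symmetric] cis_mult .
qed

text \<open>The norm of the moved point is \<open>norm y\<close> to the power
  \<open>1 - t\<close>.\<close>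

lemma flow_mem_cball:
  assumes "y \<noteq> 0" "norm y \<le> 1" "norm z = 1" "0 \<le> t" "t \<le> 1"
  shows "flow z t y \<in> cball 0 1"
proof -
  have "y / z \<noteq> 0" "norm (y / z) \<le> 1"
    using assms by (auto simp: norm_divide)
  then have "(1 - t) * ln (norm (y / z)) \<le> 0"
    using assms by (intro mult_nonneg_nonpos) auto
  with \<open>y / z \<noteq> 0\<close> assms show ?thesis
    by (simp add: flow_def norm_mult norm_exp_eq_Re del: norm_divide)
qed

text \<open>On the ray opposite to the corner the real part is minus the norm, which the bound on
  the cosine excludes. So the sector avoids the branch cut of \<open>Ln\<close>, and
  \<open>flow\<close> is continuous there.\<close>

lemma sector_set_slit:
  assumes C: "C \<in> two_cells G" and y: "y \<in> sector_set (length (rep C)) k"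
  shows "y / corner C k \<notin> \<real>\<^sub>\<le>\<^sub>0" "y \<noteq> 0"
proof -
  let ?c = "cos (2 * pi / length (rep C))"
  have "y / corner C k = y * cnj (corner C k)"
    by (simp add: corner_def cis_cnj divide_inverse)
  then have *: "norm (y / corner C k) * ?c < Re (y / corner C k)"
    using y by (simp add: sector_set_def corner_def norm_mult)
  show "y \<noteq> 0"
    using * by auto
  show "y / corner C k \<notin> \<real>\<^sub>\<le>\<^sub>0"
  proof
    assume "y / corner C k \<in> \<real>\<^sub>\<le>\<^sub>0"
    then obtain r where r: "y / corner C k = of_real r" "r \<le> 0"
      by (auto elim: nonpos_Reals_cases)
    then have "- r * ?c < r"
      using * by simp
    moreover have "- r * -1 \<le> - r * ?c"
      using r(2) cos_cell_angle(2)[OF C] by (intro mult_left_mono) auto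
    ultimately show False
      by simp
  qed
qed

lemma contract_edge:
  assumes "(w, u) \<in> adj G" "w \<noteq> u" "0 \<le> s" "s < 1"
  shows "contract w t (Inl (edge_path w u s)) = Inl (edge_path w u ((1 - t) * s))"
  using assms ray_edge[of w u s t] by (cases "s = 0") (auto simp: contract_def)

lemma contract_cell:
  assumes C: "C \<in> two_cells G" and k: "k < length (rep C)"
    and y: "y \<in> cball 0 1" "y \<in> sector_set (length (rep C)) k" and t: "0 \<le> t" "t \<le> 1"
  shows "contract (rep C ! k) t (cell_map C y) = cell_map C (flow (corner C k) t y)"
proof (cases "y \<in> ball 0 1")
  case True
  then show ?thesis
    using C k by (simp add: cell_map_ball contract_def index_nth)
next
  case False
  let ?n = "length (rep C)"
  have n: "?n \<ge> 2" "real ?n > 2"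
    using rep_facts(1)[OF C] by auto
  have "?n > 0" "y \<in> sphere 0 1"
    using k y False by auto
  then obtain j s where js: "j < ?n" "0 \<le> s" "s < 1" and yjs: "y = cis (2 * pi * (real j + s) / real ?n)"
    using circle_param by metis
  have alt: "k = j \<or> k = Suc j mod ?n \<and> s > 0"
    using y(2) cis_mem_sector_set[OF n(1) js(1) k js(2,3)] unfolding yjs by blast
  have Y: "cell_map C y = Inl (edge_path (rep C ! j) (rep C ! (Suc j mod ?n)) s)"
    unfolding yjs using js by (intro cell_map_arc[OF C]) auto
  note nx = rep_next_neq[OF C js(1)]
  have adj: "(rep C ! j, rep C ! (Suc j mod ?n)) \<in> adj G"
    using rep_facts(3)[OF C js(1)] .
  \<comment> \<open>A side spans an angle below \<open>pi\<close>, as there are at least three of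
    them, so \<open>flow_cis\<close> applies.\<close>
  have small: "\<bar>2 * pi * r / ?n\<bar> < pi" if "0 \<le> r" "r \<le> 1" for r
  proof -
    have "2 * r < real ?n"
      using that n by linarith
    then show ?thesis
      using that n by (simp add: divide_simps)
  qed
  show ?thesis
  proof (cases "k = j")
    case True
    have "y = cis (2 * pi * j / ?n + 2 * pi * s / ?n)"
      unfolding yjs by (simp add: add_divide_distrib ring_distribs)
    then have "flow (corner C k) t y = cis (2 * pi * j / ?n + (1 - t) * (2 * pi * s / ?n))"
      unfolding corner_def True using flow_cis[OF small] js by simp
    also have "\<dots> = cis (2 * pi * (real j + (1 - t) * s) / ?n)"
      by (simp add: add_divide_distrib ring_distribs mult_ac)
    finally have F: "flow (corner C k) t y = cis (2 * pi * (real j + (1 - t) * s) / ?n)" .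
    have "0 \<le> (1 - t) * s" "(1 - t) * s \<le> 1"
      using js t by (auto intro: mult_le_one)
    then have "cell_map C (flow (corner C k) t y) = Inl (edge_path (rep C ! j) (rep C ! (Suc j mod ?n)) ((1 - t) * s))"
      unfolding F by (intro cell_map_arc[OF C js(1)])
    then show ?thesis
      unfolding Y unfolding True using contract_edge[OF adj nx(1) js(2,3)] by simp
  next
    case False
    then have k': "k = Suc j mod ?n" "s > 0"
      using alt by auto
    \<comment> \<open>Measured from corner \<open>k\<close> the point has edge parameter
      \<open>1 - s\<close>, which the flow scales by \<open>1 - t\<close>; \<open>?s\<close> is the
      outcome measured from corner \<open>j\<close>.\<close>
    let ?s = "1 - (1 - t) * (1 - s)"
    have "y = cis (2 * pi * (real j + 1) / ?n + - (2 * pi * (1 - s) / ?n))"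
      unfolding yjs by (simp add: add_divide_distrib diff_divide_distrib ring_distribs)
    then have "flow (corner C k) t y = cis (2 * pi * (real j + 1) / ?n + (1 - t) * - (2 * pi * (1 - s) / ?n))"
      unfolding k'(1) corner_Suc[OF js(1)] using flow_cis[of "- (2 * pi * (1 - s) / ?n)"] small[of "1 - s"] js by simp
    also have "2 * pi * (real j + 1) / ?n + (1 - t) * - (2 * pi * (1 - s) / ?n) = 2 * pi * (real j + ?s) / ?n"
      by (simp add: add_divide_distrib diff_divide_distrib ring_distribs mult_ac)
    finally have F: "flow (corner C k) t y = cis (2 * pi * (real j + ?s) / ?n)" .
    have "0 \<le> (1 - t) * (1 - s)" "(1 - t) * (1 - s) \<le> 1"
      using js t by (auto intro: mult_le_one)
    then have "cell_map C (flow (corner C k) t y) = Inl (edge_path (rep C ! j) (rep C ! k) ?s)"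
      unfolding F unfolding k'(1) by (intro cell_map_arc[OF C js(1)]) auto
    also have "\<dots> = Inl (edge_path (rep C ! k) (rep C ! j) ((1 - t) * (1 - s)))"
      using edge_path_rev[of "rep C ! j" "rep C ! k" "(1 - t) * (1 - s)"] nx(1) k'(1) by simp
    also have "\<dots> = contract (rep C ! k) t (Inl (edge_path (rep C ! k) (rep C ! j) (1 - s)))"
      using contract_edge[of "rep C ! k" "rep C ! j" "1 - s" t] adj_sym[OF adj] nx(1) k' js by simp
    also have "edge_path (rep C ! k) (rep C ! j) (1 - s) = edge_path (rep C ! j) (rep C ! k) s"
      using edge_path_rev[of "rep C ! j" "rep C ! k" "1 - s"] nx(1) k'(1) by simp
    finally show ?thesis
      unfolding Y k'(1) by simp
  qed
qed

lemma continuous_flow: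
  assumes C: "C \<in> two_cells G"
  shows "continuous_on ({0..1} \<times> sector_set (length (rep C)) k) (\<lambda>(t, y). flow (corner C k) t y)"
proof -
  have "corner C k \<noteq> 0"
    by (simp add: corner_def)
  then show ?thesis
    unfolding flow_def split_beta using sector_set_slit(1)[OF C]
    by (intro continuous_intros) auto
qed

text \<open>The complex is built in two stages, so \<open>homotopy_on_attach_cells\<close> is
  applied twice: to the discs over the skeleton and to the edges over the discrete set of vertices.
  The two formulas match on the circles by \<open>contract_cell\<close>.\<close>

lemma continuous_contract:
  "continuous_map (prod_topology (top_of_set {0..1}) (subtopology (X_complex G) (sector w)))
     (X_complex G) (\<lambda>(t, x). contract w t x)"
  unfolding X_complex_def
proof (rule homotopy_on_attach_cells, unfold X_complex_def[symmetric])
  show "openin (X_complex G) (sector w)"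
    by (rule openin_sector)
  let ?J = "top_of_set {0..1::real}"
  have E: "continuous_map (prod_topology ?J (subtopology (one_skeleton G) {p. Inl p \<in> sector w})) (X_complex G)
      (\<lambda>(t, p). contract w t (Inl p))"
  proof -
    let ?W = "{p \<in> topspace (one_skeleton G). Inl p \<in> sector w}"
    have W: "openin (one_skeleton G) ?W"
      using openin_sector[of w] by (simp add: X_complex_def openin_attach_cells)
    have "continuous_map (prod_topology ?J (subtopology (one_skeleton G) ?W)) (X_complex G)
      (\<lambda>(t, p). contract w t (Inl p))"
      unfolding one_skeleton_def
    proof (rule homotopy_on_attach_cells, unfold one_skeleton_def[symmetric])
      show "openin (one_skeleton G) ?W"
        by (rule W)
      have "continuous_map (discrete_topology (verts G)) (one_skeleton G) Inl"
        unfolding one_skeleton_def using edge_attach_verts by (intro continuous_map_Inl_attach_cells)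
      from continuous_map_compose[OF this continuous_Inl_X_complex]
      have "continuous_map (subtopology (discrete_topology (verts G)) {v. Inl v \<in> ?W}) (X_complex G) (Inl \<circ> Inl)"
        by (rule continuous_map_from_subtopology)
      from continuous_map_compose[OF continuous_map_snd this, of ?J]
      show "continuous_map (prod_topology ?J (subtopology (discrete_topology (verts G)) {v. Inl v \<in> ?W}))
          (X_complex G) (\<lambda>(t, v). case (t, Inl v) of (t, p) \<Rightarrow> contract w t (Inl p))"
        by (simp add: contract_def o_def case_prod_unfold)
      fix e assume e: "e \<in> edges G"
      let ?P = "subtopology (top_of_set {0..1}) {s. edge_map e s \<in> ?W}"
      show "continuous_map (prod_topology ?J ?P) (X_complex G)
          (\<lambda>(t, s). case (t, edge_map e s) of (t, p) \<Rightarrow> contract w t (Inl p))"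
      proof (cases "w \<in> e")
        \<comment> \<open>An edge not at \<open>w\<close> has no point in the sector, so the domain
          is empty.\<close>
        case False
        obtain u v where uv: "e = {u, v}" "u \<noteq> v" "(u, v) \<in> adj G"
          using e by (elim edges_cases)
        have "w \<notin> cell_verts (Inl (edge_map e s))" for s
          using False edge_ends_cases[of u v] unfolding uv(1)
          by (auto simp: cell_verts_def characteristic_map_def edge_attach_def)
        then have "{s. edge_map e s \<in> ?W} = {}"
          by (auto simp: Inl_mem_sector)
        then have top: "topspace (prod_topology ?J ?P) = {}"
          by auto
        show ?thesis
          unfolding continuous_map_def top by simp
      next
        case True
        with e obtain u where u: "e = {w, u}" "w \<noteq> u" "(w, u) \<in> adj G"
          using adj_sym by (elim edges_cases) (auto simp: insert_commute)
        \<comment> \<open>The edge coordinate measured from \<open>w\<close>. It stays below 1 on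
          the sector, as the far end of the edge does not belong to it.\<close>
        define r where "r s = (if edge_ends {w, u} = (w, u) then s else 1 - s)" for s :: real
        have emap: "edge_map e s = edge_path w u (r s)" for s
          unfolding u(1) r_def by (rule characteristic_map_edge[OF u(2)])
        have r01: "r s \<in> {0..1}" if "s \<in> {0..1}" for s
          using that by (auto simp: r_def)
        have rlt: "r s < 1" if "s \<in> {0..1}" "edge_map e s \<in> ?W" for s
        proof (rule ccontr)
          assume "\<not> r s < 1"
          then have "r s = 1"
            using r01[OF that(1)] by auto
          then show False
            using that(2) u(2) by (simp add: emap Inl_mem_sector)
        qed
        have "continuous_map (prod_topology ?J (top_of_set {0..1})) (top_of_set {0..1}) (\<lambda>(t, s). (1 - t) * r s)"
        proof -
          have "continuous_on UNIV r"
            unfolding r_def by (cases "edge_ends {w, u} = (w, u)") (auto intro!: continuous_intros)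
          then have "continuous_on ({0..1} \<times> {0..1}) (\<lambda>p. (1 - fst p) * r (snd p))"
            by (intro continuous_intros continuous_on_compose2[of UNIV r _ snd]) auto
          moreover have "(1 - t) * r s \<in> {0..1}" if "t \<in> {0..1}" "s \<in> {0..1}" for t s
            using that r01[OF that(2)] by (auto intro: mult_le_one)
          ultimately show ?thesis
            by (auto simp: continuous_map_in_subtopology case_prod_unfold)
        qed
        from continuous_map_compose[OF continuous_map_compose[OF this continuous_edge_path[OF u(3,2)]] continuous_Inl_X_complex]
        have "continuous_map (prod_topology ?J ?P) (X_complex G) (\<lambda>(t, s). Inl (edge_path w u ((1 - t) * r s)))"
          unfolding o_def case_prod_unfold by (rule continuous_map_prod_subtopology)
        then show ?thesis
        proof (rule continuous_map_eq)
          fix p assume "p \<in> topspace (prod_topology ?J ?P)"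
          then obtain t s where p: "p = (t, s)" "s \<in> {0..1}" "edge_map e s \<in> ?W"
            by auto
          then show "(\<lambda>(t, s). Inl (edge_path w u ((1 - t) * r s))) p
              = (\<lambda>(t, s). case (t, edge_map e s) of (t, p) \<Rightarrow> contract w t (Inl p)) p"
            using contract_edge[OF u(3,2), of "r s" t] r01[OF p(2)] rlt[OF p(2,3)] by (simp add: emap)
        qed
      qed
    qed auto
    moreover have "subtopology (one_skeleton G) ?W = subtopology (one_skeleton G) {p. Inl p \<in> sector w}"
    proof -
      have "?W = topspace (one_skeleton G) \<inter> {p. Inl p \<in> sector w}"
        by blast
      then show ?thesis
        by (simp only: subtopology_restrict)
    qed
    ultimately show ?thesis
      by simp
  qed
  then show "continuous_map (prod_topology ?J (subtopology (one_skeleton G) {p. Inl p \<in> sector w})) (X_complex G)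
      (\<lambda>(t, p). case (t, Inl p) of (t, x) \<Rightarrow> contract w t x)"
    by simp
  fix C assume C: "C \<in> two_cells G"
  let ?S = "{y. cell_map C y \<in> sector w}"
  have "continuous_map (prod_topology ?J (subtopology (top_of_set (cball 0 1)) ?S)) (X_complex G)
      (\<lambda>(t, y). contract w t (cell_map C y))"
  proof (cases "w \<in> set (rep C)")
    case False
    then have top: "topspace (prod_topology ?J (subtopology (top_of_set (cball 0 1)) ?S)) = {}"
      using cell_map_mem_sector[OF C] by force
    show ?thesis
      unfolding continuous_map_def top by simp
  next
    case True
    then obtain k where k: "k < length (rep C)" "rep C ! k = w"
      by (auto simp: in_set_conv_nth)
    let ?T = "cball 0 1 \<inter> sector_set (length (rep C)) k"
    have S: "y \<in> ?S \<longleftrightarrow> y \<in> sector_set (length (rep C)) k" if "y \<in> cball 0 1" for y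
      unfolding mem_Collect_eq cell_map_mem_sector[OF C that]
      using k rep_facts(2)[OF C] nth_eq_iff_index_eq by blast
    then have "cball 0 1 \<inter> ?S = ?T"
      by blast
    then have "subtopology (top_of_set (cball 0 1)) ?S = top_of_set ?T"
      by (simp only: subtopology_subtopology)
    then have top: "prod_topology ?J (subtopology (top_of_set (cball 0 1)) ?S) = top_of_set ({0..1::real} \<times> ?T)"
      by simp
    have "continuous_on ({0..1} \<times> ?T) (\<lambda>(t, y). flow (corner C k) t y)"
      using continuous_flow[OF C, of k] by (rule continuous_on_subset) auto
    moreover have "flow (corner C k) t y \<in> cball 0 1" if "t \<in> {0..1}" "y \<in> ?T" for t y
      using that sector_set_slit(2)[OF C] corner_mem by (intro flow_mem_cball) auto
    ultimately have "continuous_map (top_of_set ({0..1::real} \<times> ?T)) (top_of_set (cball 0 1)) (\<lambda>(t, y). flow (corner C k) t y)"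
      by (auto simp: continuous_map_in_subtopology)
    from continuous_map_compose[OF this continuous_cell_map[OF C]]
    have "continuous_map (top_of_set ({0..1::real} \<times> ?T)) (X_complex G) (\<lambda>(t, y). cell_map C (flow (corner C k) t y))"
      by (simp add: o_def case_prod_unfold)
    then show ?thesis
      unfolding top
    proof (rule continuous_map_eq)
      fix p assume "p \<in> topspace (top_of_set ({0..1::real} \<times> ?T))"
      then obtain t y where p: "p = (t, y)" "0 \<le> t" "t \<le> 1" "y \<in> cball 0 1" "y \<in> sector_set (length (rep C)) k"
        by auto
      then show "(\<lambda>(t, y). cell_map C (flow (corner C k) t y)) p = (\<lambda>(t, y). contract w t (cell_map C y)) p"
        using contract_cell[OF C k(1) p(4,5,2,3)] k(2) by simp
    qed
  qed
  then show "continuous_map (prod_topology ?J (subtopology (top_of_set (cball 0 1))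
        {y. characteristic_map (sphere 0 1) two_cell_attach C y \<in> sector w})) (X_complex G)
      (\<lambda>(t, y). case (t, characteristic_map (sphere 0 1) two_cell_attach C y) of (t, x) \<Rightarrow> contract w t x)"
    by (simp add: cell_map_def)
qed auto

lemma sector_null_homotopic:
  "homotopic_with (\<lambda>_. True) (subtopology (X_complex G) (sector w)) (X_complex G) id (\<lambda>_. Inl (Inl w))"
proof -
  have ends: "contract w 0 x = x \<and> contract w 1 x = Inl (Inl w)" if x: "x \<in> sector w" for x
    using conjunct1[OF sector_subset[OF x]] conjunct2[OF sector_subset[OF x]]
  proof (cases rule: cell_verts_cases)
    case vertex
    then show ?thesis
      by (simp add: contract_def)
  next
    case (edge u s)
    then show ?thesis
      by (simp add: contract_edge)
  next
    case (cell C k y)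
    have "y \<in> sector_set (length (rep C)) k"
      using x cell rep_facts(2)[OF cell(2)] by (auto simp: sector_def nth_eq_iff_index_eq)
    then have "y \<noteq> 0"
      by (rule sector_set_slit(2)[OF cell(2)])
    moreover have "corner C k \<noteq> 0"
      by (simp add: corner_def)
    ultimately have "flow (corner C k) 0 y = y" "flow (corner C k) 1 y = corner C k"
      by (simp_all add: flow_def)
    then show ?thesis
      using cell index_nth[OF cell(2,4)] cell_map_corner[OF cell(2,4)]
      by (simp add: contract_def cell_map_ball)
  qed
  show ?thesis
    by (rule homotopic_with[THEN iffD2], simp, intro exI[of _ "\<lambda>(t, x). contract w t x"] conjI continuous_contract)
       (use ends in auto)
qed

section \<open>Edge paths as singular chains\<close>

abbreviation "bounds \<equiv> singular_boundaries2 1 (X_complex G)"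

lemmas bounds_add = additive_set_add[OF additive_singular_boundaries2]
lemmas bounds_0 = additive_set_0[OF additive_singular_boundaries2]

text \<open>A whole edge lies in no member of the cover, since a sector contains at most one vertex
  of the graph and an open 2-cell none. A half lies in the sector of its end, so \<open>Phi\<close>
  has small values without subdivision.\<close>

definition half_edge :: "'a \<Rightarrow> 'a \<Rightarrow> (nat \<Rightarrow> real) \<Rightarrow> ('a + 'a set \<times> real) + 'a list set \<times> complex" where
  "half_edge u v = path_simplex (\<lambda>s. Inl (edge_path u v (s / 2)))"

definition edge_simplices where
  "edge_simplices u v = gen (half_edge u v) + gen (half_edge v u)"

definition ray_simplex where
  "ray_simplex x w = gen (path_simplex (ray x w))"

definition Phi where
  "Phi = linear_extension (\<lambda>A. edge_simplices (A [False]) (A [True]))"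

lemma edge_simplices_same [simp]: "edge_simplices u u = 0"
  by (simp add: edge_simplices_def)

lemma edge_simplices_commute: "edge_simplices u v = edge_simplices v u"
  by (simp add: edge_simplices_def add.commute)

lemma Phi_add [simp]: "Phi (c + d) = Phi c + Phi d"
  by (simp add: Phi_def)

lemma Phi_0 [simp]: "Phi 0 = 0"
  by (simp add: Phi_def)

lemma Phi_edge_chain [simp]: "Phi (edge_chain u v) = edge_simplices u v"
  by (simp add: Phi_def edge_chain_alt)

lemma half_edge:
  assumes "(u, v) \<in> adj G" "u \<noteq> v"
  shows "singular_simplex 1 (X_complex G) (half_edge u v)" "half_edge u v \<in> standard_simplex 1 \<rightarrow> sector u"
    "half_edge u v (basis 0) = Inl (Inl u)" "half_edge u v (basis 1) = half_edge v u (basis 1)"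
    "cell_verts (half_edge u v (basis 1)) = {u, v}"
proof -
  have "continuous_map (top_of_set {0..1}) (top_of_set {0..1}) (\<lambda>s::real. s / 2)"
    by (auto simp: continuous_map_in_subtopology intro!: continuous_intros)
  from continuous_map_compose[OF continuous_map_compose[OF this continuous_edge_path[OF assms]] continuous_Inl_X_complex]
  show "singular_simplex 1 (X_complex G) (half_edge u v)"
    unfolding half_edge_def by (intro singular_simplex_path_simplex) (simp add: o_def)
  show "half_edge u v \<in> standard_simplex 1 \<rightarrow> sector u"
    unfolding half_edge_def
  proof (rule path_simplex_mem)
    fix t :: real assume "0 \<le> t" "t \<le> 1"
    then show "Inl (edge_path u v (t / 2)) \<in> sector u"
      unfolding Inl_mem_sector
      by (intro conjI edge_path_mem assms) (simp_all add: cell_verts_edge_path[OF assms(2)])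
  qed
  show "half_edge u v (basis 0) = Inl (Inl u)" "half_edge u v (basis 1) = half_edge v u (basis 1)"
    "cell_verts (half_edge u v (basis 1)) = {u, v}"
    using assms edge_path_rev[of u v "1 / 2"] by (simp_all add: half_edge_def cell_verts_edge_path)
qed

text \<open>The two rays and the side between their ends lift to a loop in the closed disc, which is
  convex, so the characteristic map makes the loop bound.\<close>

lemma ray_simplex_cell:
  assumes C: "C \<in> two_cells G" and k: "k < length (rep C)" and y: "y \<in> ball 0 1"
  defines "u \<equiv> rep C ! k" and "v \<equiv> rep C ! (Suc k mod length (rep C))"
  shows "ray_simplex (Inr (C, y)) u + ray_simplex (Inr (C, y)) v + edge_simplices u v \<in> bounds"
proof -
  let ?n = "length (rep C)" and ?k' = "Suc k mod length (rep C)"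
  \<comment> \<open>The lifts: \<open>?f\<close> and \<open>?k\<close> are the segments to the two
    corners, \<open>?g\<close> and \<open>?h\<close> run along the arc from its two ends to its
    midpoint.\<close>
  let ?f = "\<lambda>t. (1 - t) *\<^sub>R y + t *\<^sub>R corner C k"
    and ?k = "\<lambda>t. (1 - t) *\<^sub>R y + t *\<^sub>R corner C ?k'"
    and ?g = "\<lambda>s. cis (2 * pi * (real k + s / 2) / ?n)"
    and ?h = "\<lambda>s. cis (2 * pi * (real k + (1 - s / 2)) / ?n)"
  note nx = rep_next_neq[OF C k]
  have "homotopic_with (\<lambda>_. True) (top_of_set (cball 0 1)) (X_complex G) (cell_map C) (\<lambda>_. cell_map C 0)"
    by (rule null_homotopic_convex) (auto intro: continuous_cell_map[OF C])
  then have "gen (simplex_map 1 (cell_map C) (path_simplex ?f)) + gen (simplex_map 1 (cell_map C) (path_simplex ?g))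
      + (gen (simplex_map 1 (cell_map C) (path_simplex ?h)) + gen (simplex_map 1 (cell_map C) (path_simplex ?k))) \<in> bounds"
  proof (rule null_homotopic_quadrangle)
    have "rep C \<noteq> []"
      using k by auto
    then show "singular_simplex 1 (top_of_set (cball 0 1)) (path_simplex ?f)"
      "singular_simplex 1 (top_of_set (cball 0 1)) (path_simplex ?g)"
      "singular_simplex 1 (top_of_set (cball 0 1)) (path_simplex ?h)"
      "singular_simplex 1 (top_of_set (cball 0 1)) (path_simplex ?k)"
      using y segment_mem[of y]
      by (intro singular_simplex_path_in continuous_intros; simp)+
    show "path_simplex ?g (basis 1) = path_simplex ?h (basis 1)"
      by (simp add: algebra_simps)
    show "path_simplex ?h (basis 0) = path_simplex ?k (basis 1)"
      using corner_Suc[OF k] by simp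
  qed (simp_all add: corner_def)
  moreover have "simplex_map 1 (cell_map C) (path_simplex ?f) = path_simplex (ray (Inr (C, y)) u)"
    "simplex_map 1 (cell_map C) (path_simplex ?k) = path_simplex (ray (Inr (C, y)) v)"
    unfolding simplex_map_path_simplex u_def v_def
    by (rule path_simplex_cong, simp add: ray_cell[OF C k] ray_cell[OF C nx(2)])+
  moreover have "simplex_map 1 (cell_map C) (path_simplex ?g) = half_edge u v"
    unfolding simplex_map_path_simplex u_def v_def half_edge_def
    by (rule path_simplex_cong) (simp add: cell_map_arc[OF C k])
  moreover have "simplex_map 1 (cell_map C) (path_simplex ?h) = half_edge v u"
    unfolding simplex_map_path_simplex u_def v_def half_edge_def
    by (rule path_simplex_cong) (simp add: cell_map_arc[OF C k] edge_path_rev[OF nx(1)])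
  ultimately show ?thesis
    by (simp add: ray_simplex_def edge_simplices_def add_ac)
qed

text \<open>The argument for 2-cells, with the unit interval and \<open>edge_path w u\<close> in
  place of the disc and its characteristic map.\<close>

lemma ray_simplex_edge:
  assumes adj: "(w, u) \<in> adj G" "w \<noteq> u" and s: "0 < s" "s < 1"
  shows "ray_simplex (Inl (edge_path w u s)) w + ray_simplex (Inl (edge_path w u s)) u
           + edge_simplices w u \<in> bounds"
proof -
  let ?q = "Inl \<circ> edge_path w u :: real \<Rightarrow> ('a + 'a set \<times> real) + 'a list set \<times> complex"
  let ?f = "\<lambda>t. (1 - t) * s" and ?k = "\<lambda>t. (1 - t) * s + t" and ?g = "\<lambda>s::real. s / 2" and ?h = "\<lambda>s::real. 1 - s / 2"
  have q: "continuous_map (top_of_set {0..1}) (X_complex G) ?q"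
    by (rule continuous_map_compose[OF continuous_edge_path[OF adj] continuous_Inl_X_complex])
  have "homotopic_with (\<lambda>_. True) (top_of_set {0..1::real}) (X_complex G) ?q (\<lambda>_. ?q 0)"
    by (rule null_homotopic_convex) (auto intro: q simp del: o_apply)
  then have "gen (simplex_map 1 ?q (path_simplex ?f)) + gen (simplex_map 1 ?q (path_simplex ?g))
      + (gen (simplex_map 1 ?q (path_simplex ?h)) + gen (simplex_map 1 ?q (path_simplex ?k))) \<in> bounds"
  proof (rule null_homotopic_quadrangle)
    have "(1 - t) * s \<le> 1" "(1 - t) * s + t \<le> 1" if "0 \<le> t" "t \<le> 1" for t
    proof -
      have "(1 - t) * s \<le> (1 - t) * 1"
        using that s by (intro mult_left_mono) auto
      then show "(1 - t) * s \<le> 1" "(1 - t) * s + t \<le> 1"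
        using that by auto
    qed
    then show "singular_simplex 1 (top_of_set {0..1}) (path_simplex ?f)"
      "singular_simplex 1 (top_of_set {0..1}) (path_simplex ?g)"
      "singular_simplex 1 (top_of_set {0..1}) (path_simplex ?h)"
      "singular_simplex 1 (top_of_set {0..1}) (path_simplex ?k)"
      using s by (intro singular_simplex_path_in continuous_intros; simp)+
  qed simp_all
  moreover have "simplex_map 1 ?q (path_simplex ?f) = path_simplex (ray (Inl (edge_path w u s)) w)"
    unfolding simplex_map_path_simplex by (rule path_simplex_cong) (simp add: ray_edge[OF adj(2) s])
  moreover have "simplex_map 1 ?q (path_simplex ?k) = path_simplex (ray (Inl (edge_path w u s)) u)"
    unfolding simplex_map_path_simplex
  proof (rule path_simplex_cong)
    fix t :: real
    have "edge_path w u s = edge_path u w (1 - s)"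
      using edge_path_rev[of w u "1 - s"] adj by simp
    then have "ray (Inl (edge_path w u s)) u t = Inl (edge_path u w ((1 - t) * (1 - s)))"
      using ray_edge[of u w "1 - s" t] adj s by simp
    also have "\<dots> = Inl (edge_path w u (1 - (1 - t) * (1 - s)))"
      using edge_path_rev[OF adj(2)] by simp
    also have "1 - (1 - t) * (1 - s) = (1 - t) * s + t"
      by (simp add: algebra_simps)
    finally show "(?q \<circ> ?k) t = ray (Inl (edge_path w u s)) u t"
      by simp
  qed
  moreover have "simplex_map 1 ?q (path_simplex ?g) = half_edge w u"
    unfolding simplex_map_path_simplex half_edge_def by (rule path_simplex_cong) simp
  moreover have "simplex_map 1 ?q (path_simplex ?h) = half_edge u w"
    unfolding simplex_map_path_simplex half_edge_def
    by (rule path_simplex_cong) (simp add: edge_path_rev[OF adj(2)])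
  ultimately show ?thesis
    by (simp add: ray_simplex_def edge_simplices_def add_ac)
qed

text \<open>In the sum of the relations \<open>ray_simplex_cell\<close> over the three sides, taken
  at the centre of the 2-cell, every ray occurs twice. If vertices coincide, the edges cancel by
  themselves.\<close>

lemma triangle_bounds:
  assumes adj: "(a, b) \<in> adj G" "(b, c) \<in> adj G" "(a, c) \<in> adj G"
  shows "edge_simplices a b + edge_simplices b c + edge_simplices a c \<in> bounds"
proof (cases "distinct [a, b, c]")
  case False
  then show ?thesis
    using bounds_0 edge_simplices_commute[of b a] by auto
next
  case True
  define C where "C = cycle_class [a, b, c]"
  have C: "C \<in> two_cells G"
    unfolding C_def using True adj by (rule triangle_two_cell)
  have "rep C \<in> C"
    unfolding rep_def by (rule someI[of "\<lambda>vs. vs \<in> C" "[a, b, c]"]) (simp add: C_def self_mem_cycle_class)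
  \<comment> \<open>The representative may be any rotation or reflection of the triangle; the sum
    over the unoriented sides is the same for all of them.\<close>
  then have R: "rep C \<in> {[a, b, c], [b, c, a], [c, a, b], [c, b, a], [b, a, c], [a, c, b]}"
    unfolding C_def cycle_class_3 .
  then obtain x y z where xyz: "rep C = [x, y, z]"
    by auto
  have "ray_simplex (Inr (C, 0)) x + ray_simplex (Inr (C, 0)) y + edge_simplices x y \<in> bounds"
    "ray_simplex (Inr (C, 0)) y + ray_simplex (Inr (C, 0)) z + edge_simplices y z \<in> bounds"
    "ray_simplex (Inr (C, 0)) z + ray_simplex (Inr (C, 0)) x + edge_simplices z x \<in> bounds"
    using ray_simplex_cell[OF C, of 0 0] ray_simplex_cell[OF C, of "Suc 0" 0]
      ray_simplex_cell[OF C, of "Suc (Suc 0)" 0]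
    by (simp_all add: xyz)
  from bounds_add[OF this(1) bounds_add[OF this(2,3)]]
  have "edge_simplices x y + edge_simplices y z + edge_simplices z x \<in> bounds"
    by (simp add: add_ac)
  moreover have "edge_simplices x y + edge_simplices y z + edge_simplices z x
      = edge_simplices a b + edge_simplices b c + edge_simplices a c"
    using R unfolding xyz
    by (elim insertE emptyE; simp add: edge_simplices_commute[of b a] edge_simplices_commute[of c a]
        edge_simplices_commute[of c b] add_ac)
  ultimately show ?thesis
    by simp
qed

text \<open>The diagonals are \<open>a d\<close> and \<open>b c\<close>. If one of them is an edge,
  or a repeated vertex, the sum splits into two triangles; otherwise there is a 2-cell and its rays
  cancel as for triangles.\<close>

lemma square_bounds:
  assumes adj: "(a, b) \<in> adj G" "(b, d) \<in> adj G" "(d, c) \<in> adj G" "(c, a) \<in> adj G"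
  shows "edge_simplices a b + edge_simplices b d + (edge_simplices d c + edge_simplices c a) \<in> bounds"
proof -
  note comm = edge_simplices_commute
  consider "(a, d) \<in> adj G" | "(b, c) \<in> adj G" | "(a, d) \<notin> adj G" "(b, c) \<notin> adj G"
    by blast
  then show ?thesis
  proof cases
    case 1
    from bounds_add[OF triangle_bounds[OF adj(1,2) 1] triangle_bounds[OF 1 adj(3) adj_sym[OF adj(4)]]]
    show ?thesis
      by (simp add: add_ac comm[of c a])
  next
    case 2
    from bounds_add[OF triangle_bounds[OF 2 adj(4) adj_sym[OF adj(1)]] triangle_bounds[OF adj(2,3) 2]]
    show ?thesis
      by (simp add: add_ac comm[of b a])
  next
    case 3
    \<comment> \<open>A coincidence between any two corners would make one of the diagonals
      adjacent.\<close>
    have dist: "distinct [a, b, d, c]"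
      using 3 adj adj_sym adj_refl adj_verts by (auto; blast)
    define C where "C = cycle_class [a, b, d, c]"
    have C: "C \<in> two_cells G"
      unfolding C_def using dist adj 3 by (rule square_two_cell)
    have "rep C \<in> C"
      unfolding rep_def by (rule someI[of "\<lambda>vs. vs \<in> C" "[a, b, d, c]"]) (simp add: C_def self_mem_cycle_class)
    then have R: "rep C \<in> {[a, b, d, c], [b, d, c, a], [d, c, a, b], [c, a, b, d],
      [c, d, b, a], [d, b, a, c], [b, a, c, d], [a, c, d, b]}"
      unfolding C_def cycle_class_4 .
    then obtain w x y z where wxyz: "rep C = [w, x, y, z]"
      by auto
    let ?r = "ray_simplex (Inr (C, 0))"
    have "?r w + ?r x + edge_simplices w x \<in> bounds" "?r x + ?r y + edge_simplices x y \<in> bounds"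
      "?r y + ?r z + edge_simplices y z \<in> bounds" "?r z + ?r w + edge_simplices z w \<in> bounds"
      using ray_simplex_cell[OF C, of 0 0] ray_simplex_cell[OF C, of "Suc 0" 0]
        ray_simplex_cell[OF C, of "Suc (Suc 0)" 0] ray_simplex_cell[OF C, of "Suc (Suc (Suc 0))" 0]
      by (simp_all add: wxyz)
    from bounds_add[OF bounds_add[OF this(1,2)] bounds_add[OF this(3,4)]]
    have "edge_simplices w x + edge_simplices x y + (edge_simplices y z + edge_simplices z w) \<in> bounds"
      by (simp add: add_ac)
    moreover have "edge_simplices w x + edge_simplices x y + (edge_simplices y z + edge_simplices z w)
        = edge_simplices a b + edge_simplices b d + (edge_simplices d c + edge_simplices c a)"
      using R unfolding wxyz
      by (elim insertE emptyE; simp add: comm[of b a] comm[of d b] comm[of d c] comm[of c a] add_ac)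
    ultimately show ?thesis
      by simp
  qed
qed

lemma Phi_boundaries1:
  assumes "b \<in> boundaries1"
  shows "Phi b \<in> bounds"
  using assms
proof (induction b rule: boundaries1_induct)
  case (square a b c d)
  from square_bounds[OF square(1,4) adj_sym[OF square(2)] adj_sym[OF square(3)]] show ?case
    by (simp add: add_ac edge_simplices_commute[of c a] edge_simplices_commute[of d c])
qed (use bounds_0 bounds_add in auto)

text \<open>For vertices joined by a side of the cell this comes from the ray relations. Opposite
  corners of a square are reached through a corner \<open>m\<close> between them, and
  \<open>link_via\<close> trades the two steps for the link.\<close>

lemma ray_simplex_link:
  assumes x: "x \<in> topspace (X_complex G)" and uv: "u \<in> cell_verts x" "v \<in> cell_verts x"
  shows "ray_simplex x u + ray_simplex x v + Phi (link u v) \<in> bounds"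
proof -
  let ?P = "\<lambda>u v. (u, v) \<in> adj G \<and> ray_simplex x u + ray_simplex x v + edge_simplices u v \<in> bounds"
  have sym: "?P v u" if "?P u v" for u v
    using that adj_sym by (auto simp: edge_simplices_commute[of v u] add_ac)
  have one: ?thesis if "?P u v"
    using bounds_add[OF conjunct2[OF that] Phi_boundaries1[OF link_adj[OF conjunct1[OF that]]]]
    by (simp add: add_ac)
  have two: ?thesis if "?P u m" "?P m v" for m
    using bounds_add[OF bounds_add[OF conjunct2[OF that(1)] conjunct2[OF that(2)]]
        Phi_boundaries1[OF link_via[OF conjunct1[OF that(1)] conjunct1[OF that(2)]]]]
    by (simp add: add_ac)
  have same: ?thesis if "u = v"
  proof -
    have "u \<in> verts G"
      using cluster_cell_verts[OF x] uv by (auto simp: cluster_def)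
    from Phi_boundaries1[OF link_same[OF this]] show ?thesis
      using that by simp
  qed
  from x show ?thesis
  proof (cases rule: X_complex_cases)
    case vertex
    then show ?thesis
      using uv same by auto
  next
    case (edge a b s)
    then have "?P a b"
      using ray_simplex_edge by simp
    moreover have "u \<in> {a, b}" "v \<in> {a, b}"
      using uv edge by (auto simp: cell_verts_edge_path)
    ultimately consider "u = v" | "?P u v" | "?P v u"
      by blast
    then show ?thesis
      using same one sym by cases blast+
  next
    case (cell C y)
    have P: "?P (rep C ! k) (rep C ! (Suc k mod length (rep C)))" if "k < length (rep C)" for k
      using ray_simplex_cell[OF cell(2) that cell(3)] rep_facts(3)[OF cell(2) that] cell(1) by simp
    from cell(2) show ?thesis
    proof (cases rule: two_cell_cases)
      case (triangle a b c)
      have "?P a b" "?P b c" "?P c a"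
        using P[of 0] P[of "Suc 0"] P[of "Suc (Suc 0)"] by (simp_all add: triangle(1))
      note Ps = this this[THEN sym]
      have "u \<in> {a, b, c}" "v \<in> {a, b, c}"
        using uv cell triangle(1) by auto
      then show ?thesis
        using same one Ps by (elim insertE emptyE) blast+
    next
      case (square a b c d)
      have "?P a b" "?P b c" "?P c d" "?P d a"
        using P[of 0] P[of "Suc 0"] P[of "Suc (Suc 0)"] P[of "Suc (Suc (Suc 0))"]
        by (simp_all add: square(1))
      note Ps = this this[THEN sym]
      have "u \<in> {a, b, c, d}" "v \<in> {a, b, c, d}"
        using uv cell square(1) by auto
      then show ?thesis
        using same one two Ps by (elim insertE emptyE) blast+
    qed
  qed
qed

text \<open>The simplex and the rays from its ends to \<open>w\<close> form a loop. In a sector the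
  loop stays inside and is contracted with it. In an open 2-cell the rays end outside, on the
  boundary, so the loop is lifted to the closed disc instead.\<close>

lemma cell_verts_cover:
  assumes U: "U \<in> cover"
  obtains w where "\<And>x. x \<in> U \<Longrightarrow> w \<in> cell_verts x"
    "\<And>f. singular_simplex 1 (X_complex G) f \<Longrightarrow> f \<in> standard_simplex 1 \<rightarrow> U \<Longrightarrow>
      gen f + ray_simplex (f (basis 0)) w + ray_simplex (f (basis 1)) w \<in> bounds"
proof -
  from U consider w where "U = sector w" | C where "C \<in> two_cells G" "U = open_cell C"
    by (auto simp: cover_def)
  then show thesis
  proof cases
    case (1 w)
    show thesis
    proof (rule that[of w])
      show "w \<in> cell_verts x" if "x \<in> U" for x
        using that 1 sector_subset by blast
      fix f assume f: "singular_simplex 1 (X_complex G) f" "f \<in> standard_simplex 1 \<rightarrow> U"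
      let ?S = "subtopology (X_complex G) (sector w)"
      have fS: "singular_simplex 1 ?S f"
        using f 1 by (simp add: singular_simplex_subtopology image_subset_iff_funcset)
      have ends: "f (basis 0) \<in> sector w" "f (basis 1) \<in> sector w"
        using f(2) 1 by auto
      have ray: "singular_simplex 1 ?S (path_simplex (ray x w))" if x: "x \<in> sector w" for x
      proof -
        have "continuous_map (top_of_set {0..1}) ?S (ray x w)"
          using continuous_ray sector_subset[OF x] ray_mem_sector[OF x]
          by (auto simp: continuous_map_in_subtopology)
        then show ?thesis
          by (rule singular_simplex_path_simplex)
      qed
      have "gen (simplex_map 1 id f) + gen (simplex_map 1 id (path_simplex (ray (f (basis 1)) w)))
          + gen (simplex_map 1 id (path_simplex (ray (f (basis 0)) w))) \<in> bounds"
        using sector_null_homotopic[of w] fS ray[OF ends(2)] ray[OF ends(1)]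
      proof (rule null_homotopic_triangle)
        show "f (basis 0) = path_simplex (ray (f (basis 0)) w) (basis 0)"
          "f (basis 1) = path_simplex (ray (f (basis 1)) w) (basis 0)"
          "path_simplex (ray (f (basis 1)) w) (basis 1) = path_simplex (ray (f (basis 0)) w) (basis 1)"
          using ends sector_subset ray_ends by simp_all
      qed
      then show "gen f + ray_simplex (f (basis 0)) w + ray_simplex (f (basis 1)) w \<in> bounds"
        unfolding simplex_map_id_simplex[OF fS] simplex_map_id_simplex[OF ray[OF ends(1)]]
          simplex_map_id_simplex[OF ray[OF ends(2)]]
        by (simp add: ray_simplex_def add_ac)
    qed
  next
    case (2 C)
    define w where "w = rep C ! 0"
    have k: "0 < length (rep C)"
      using rep_facts(1)[OF 2(1)] by auto
    show thesis
    proof (rule that[of w])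
      show "w \<in> cell_verts x" if "x \<in> U" for x
        using that 2 k by (auto simp: open_cell_def w_def)
      fix f assume f: "singular_simplex 1 (X_complex G) f" "f \<in> standard_simplex 1 \<rightarrow> U"
      \<comment> \<open>On the open cell this inverts the characteristic map; the value 0 on the
        skeleton is arbitrary.\<close>
      define q where "q x = (case x of Inl p \<Rightarrow> 0 | Inr (D, y) \<Rightarrow> y)"
        for x :: "('a + 'a set \<times> real) + 'a list set \<times> complex"
      have q: "q x \<in> ball 0 1 \<and> x = Inr (C, q x)" if "x \<in> U" for x
        using that 2 by (auto simp: open_cell_def q_def)
      have contq: "continuous_map (subtopology (X_complex G) U) (top_of_set (cball 0 1)) q"
        unfolding continuous_map_def
      proof (intro conjI allI impI)
        show "q \<in> topspace (subtopology (X_complex G) U) \<rightarrow> topspace (top_of_set (cball 0 1))"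
          using q by fastforce
        fix V assume "openin (top_of_set (cball (0::complex) 1)) V"
        then obtain T where T: "open T" "V = cball 0 1 \<inter> T"
          by (auto simp: openin_open)
        have "{x \<in> topspace (subtopology (X_complex G) U). q x \<in> V} = (\<lambda>y. Inr (C, y)) ` (ball 0 1 \<inter> T)"
          using 2 T by (auto simp: open_cell_def q_def topspace_X_complex)
        moreover have "openin (X_complex G) ((\<lambda>y. Inr (C, y)) ` (ball 0 1 \<inter> T))"
          using T by (intro openin_open_cell 2) auto
        moreover have "openin (X_complex G) U"
          using openin_cover[OF U] .
        ultimately show "openin (subtopology (X_complex G) U) {x \<in> topspace (subtopology (X_complex G) U). q x \<in> V}"
          using 2 by (auto simp: openin_open_subtopology open_cell_def)
      qed
      let ?D = "top_of_set (cball (0::complex) 1)"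
      have fU: "singular_simplex 1 (subtopology (X_complex G) U) f"
        using f by (simp add: singular_simplex_subtopology image_subset_iff_funcset)
      have lift: "singular_simplex 1 ?D (simplex_map 1 q f)"
        by (rule singular_simplex_simplex_map[OF fU contq])
      have lift_f: "simplex_map 1 (cell_map C) (simplex_map 1 q f) = f"
      proof (rule extensionalityI[of _ "standard_simplex 1"])
        fix s :: "nat \<Rightarrow> real" assume s: "s \<in> standard_simplex 1"
        then have "f s \<in> U"
          using f(2) by blast
        then show "simplex_map 1 (cell_map C) (simplex_map 1 q f) s = f s"
          using s q[of "f s"] cell_map_ball[of "q (f s)" C] by (simp add: simplex_map_def)
      qed (use f(1) in \<open>auto simp: simplex_map_def singular_simplex_def\<close>)
      let ?r = "\<lambda>x t. (1 - t) *\<^sub>R q x + t *\<^sub>R corner C 0"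
      have r: "singular_simplex 1 ?D (path_simplex (?r x))"
        and lift_r: "simplex_map 1 (cell_map C) (path_simplex (?r x)) = path_simplex (ray x w)" if "x \<in> U" for x
      proof -
        have "q x \<in> cball 0 1" "x = Inr (C, q x)"
          using q[OF that] by auto
        then show "singular_simplex 1 ?D (path_simplex (?r x))"
          using segment_mem[of "q x"] by (intro singular_simplex_path_in continuous_intros) simp_all
        have "ray x w t = cell_map C (?r x t)" for t
          using \<open>x = Inr (C, q x)\<close> ray_cell[OF 2(1) k] unfolding w_def by metis
        then show "simplex_map 1 (cell_map C) (path_simplex (?r x)) = path_simplex (ray x w)"
          unfolding simplex_map_path_simplex by (intro path_simplex_cong) simp
      qed
      have ends: "f (basis 0) \<in> U" "f (basis 1) \<in> U"
        using f(2) by auto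
      have "homotopic_with (\<lambda>_. True) ?D (X_complex G) (cell_map C) (\<lambda>_. cell_map C 0)"
        by (rule null_homotopic_convex) (auto intro: continuous_cell_map[OF 2(1)])
      from null_homotopic_triangle[OF this lift r[OF ends(2)] r[OF ends(1)]]
      have "gen f + gen (path_simplex (ray (f (basis 1)) w)) + gen (path_simplex (ray (f (basis 0)) w)) \<in> bounds"
        unfolding lift_f lift_r[OF ends(1)] lift_r[OF ends(2)] by (simp add: simplex_map_def)
      then show "gen f + ray_simplex (f (basis 0)) w + ray_simplex (f (basis 1)) w \<in> bounds"
        by (simp add: ray_simplex_def add_ac)
    qed
  qed
qed

section \<open>From small singular chains to discrete chains\<close>

definition vertex_of where
  "vertex_of x = (SOME w. w \<in> cell_verts x)"

definition star_vertex where
  "star_vertex f = (SOME w. \<forall>s\<in>standard_simplex 1. w \<in> cell_verts (f s))"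

text \<open>The outer vertices depend only on the end points of \<open>f\<close>, so simplices with
  a common end point receive paths with a common end vertex, and boundaries are respected. Only the
  inner vertex depends on the whole simplex.\<close>

definition link_of where
  "link_of f = link (vertex_of (f (basis 0))) (star_vertex f) + link (star_vertex f) (vertex_of (f (basis 1)))"

abbreviation "Psi \<equiv> linear_extension link_of"

lemma vertex_of_mem: "x \<in> topspace (X_complex G) \<Longrightarrow> vertex_of x \<in> cell_verts x"
  unfolding vertex_of_def using cell_verts_nonempty by (simp add: some_in_eq)

lemma star_vertex_mem:
  assumes "\<And>s. s \<in> standard_simplex 1 \<Longrightarrow> w \<in> cell_verts (f s)" "s \<in> standard_simplex 1"
  shows "star_vertex f \<in> cell_verts (f s)"
proof -
  have "\<forall>s\<in>standard_simplex 1. star_vertex f \<in> cell_verts (f s)"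
    unfolding star_vertex_def by (rule someI[of _ w]) (use assms in blast)
  then show ?thesis
    using assms(2) by blast
qed

lemma cell_verts_linked:
  "x \<in> topspace (X_complex G) \<Longrightarrow> u \<in> cell_verts x \<Longrightarrow> v \<in> cell_verts x \<Longrightarrow> linked u v"
  using cluster_cell_verts by (auto simp: cluster_def)

text \<open>\<open>link_cocycle\<close>, applied in the carrier cells of both ends, exchanges
  \<open>star_vertex f\<close> for any other common vertex. So the faces of a 2-simplex can all be
  routed through the same \<open>w\<close>.\<close>

lemma link_of_via:
  assumes f: "singular_simplex 1 (X_complex G) f"
    and w: "\<And>s. s \<in> standard_simplex 1 \<Longrightarrow> w \<in> cell_verts (f s)"
  shows "link_of f + (link (vertex_of (f (basis 0))) w + link w (vertex_of (f (basis 1)))) \<in> boundaries1"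
proof -
  let ?x = "f (basis 0)" and ?y = "f (basis 1)" and ?m = "star_vertex f"
  have top: "?x \<in> topspace (X_complex G)" "?y \<in> topspace (X_complex G)"
    using f by (auto intro: singular_simplex_mem)
  have mem: "?m \<in> cell_verts ?x" "?m \<in> cell_verts ?y" "w \<in> cell_verts ?x" "w \<in> cell_verts ?y"
    using w by (auto intro!: star_vertex_mem[of w])
  have "link (vertex_of ?x) ?m + link ?m w + link (vertex_of ?x) w \<in> boundaries1"
    by (rule link_cocycle[OF cluster_cell_verts[OF top(1)] vertex_of_mem[OF top(1)] mem(1,3)])
  moreover have "link w ?m + link ?m (vertex_of ?y) + link w (vertex_of ?y) \<in> boundaries1"
    by (rule link_cocycle[OF cluster_cell_verts[OF top(2)] mem(4,2) vertex_of_mem[OF top(2)]])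
  moreover have "link w ?m + link ?m w \<in> boundaries1"
    by (rule link_sym[OF cell_verts_linked[OF top(1) mem(3,1)]])
  ultimately have "link (vertex_of ?x) ?m + link ?m w + link (vertex_of ?x) w
      + (link w ?m + link ?m (vertex_of ?y) + link w (vertex_of ?y) + (link w ?m + link ?m w)) \<in> boundaries1"
    by (meson boundaries1_add)
  then show ?thesis
    by (simp add: link_of_def add_ac)
qed

lemma link_of_mem:
  assumes f: "singular_simplex 1 (X_complex G) f"
    and w: "\<And>s. s \<in> standard_simplex 1 \<Longrightarrow> w \<in> cell_verts (f s)"
  shows "link_of f \<in> cube_chains 1 G"
    "cube_boundary 1 (link_of f) = vert_chain (vertex_of (f (basis 0))) + vert_chain (vertex_of (f (basis 1)))"
proof -
  have top: "f (basis 0) \<in> topspace (X_complex G)" "f (basis 1) \<in> topspace (X_complex G)"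
    using f by (auto intro: singular_simplex_mem)
  have mem: "star_vertex f \<in> cell_verts (f (basis 0))" "star_vertex f \<in> cell_verts (f (basis 1))"
    using w by (auto intro!: star_vertex_mem[of w])
  show "link_of f \<in> cube_chains 1 G"
    unfolding link_of_def
    using cell_verts_linked[OF top(1) vertex_of_mem[OF top(1)] mem(1)]
      cell_verts_linked[OF top(2) mem(2) vertex_of_mem[OF top(2)]]
    by (intro additive_set_add[OF additive_cube_chains] link_mem)
  show "cube_boundary 1 (link_of f) = vert_chain (vertex_of (f (basis 0))) + vert_chain (vertex_of (f (basis 1)))"
    unfolding link_of_def cube_boundary_add cube_boundary_link by (simp add: add_ac)
qed

lemma Psi_small_boundary:
  assumes "b \<in> small_chains2 cover (Suc 1) (X_complex G)"
  shows "Psi (singular_boundary2 (Suc 1) b) \<in> boundaries1"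
proof -
  have "Poly_Mapping.keys b
      \<subseteq> {f. singular_simplex (Suc 1) (X_complex G) f \<and> (\<exists>V\<in>cover. f \<in> standard_simplex (Suc 1) \<rightarrow> V)}"
    using assms by (simp add: small_chains2_def)
  then show ?thesis
  proof (induction b rule: bit_chain_induct)
    case (single f)
    then obtain V where f: "singular_simplex 2 (X_complex G) f" and V: "V \<in> cover" "f \<in> standard_simplex 2 \<rightarrow> V"
      by (auto simp: numeral_2_eq_2)
    from V(1) obtain w where w: "\<And>x. x \<in> V \<Longrightarrow> w \<in> cell_verts x"
      by (rule cell_verts_cover) blast
    let ?v = "\<lambda>i. vertex_of (f (basis i))"
    have face: "link_of (singular_face 2 k f)
        + (link (?v (if 0 < k then 0 else 1)) w + link w (?v (if 1 < k then 1 else 2))) \<in> boundaries1"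
      if "k \<le> 2" for k
    proof -
      have "singular_simplex (2 - Suc 0) (X_complex G) (singular_face 2 k f)"
        by (rule singular_simplex_singular_face[OF f]) (use that in auto)
      moreover have "w \<in> cell_verts (singular_face 2 k f s)" if s: "s \<in> standard_simplex 1" for s
      proof -
        have "simplical_face k s \<in> standard_simplex 2"
          using s \<open>k \<le> 2\<close> by (intro simplical_face_in_standard_simplex) auto
        then show ?thesis
          using s w V(2) by (auto simp: singular_face_def)
      qed
      ultimately have "link_of (singular_face 2 k f) + (link (vertex_of (singular_face 2 k f (basis 0))) w
          + link w (vertex_of (singular_face 2 k f (basis 1)))) \<in> boundaries1"
        by (intro link_of_via) simp_all
      moreover have "singular_face 2 k f (basis 0) = f (basis (if 0 < k then 0 else 1))"
        "singular_face 2 k f (basis 1) = f (basis (if 1 < k then 1 else 2))"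
        using singular_face_basis[of 0 2 k f] singular_face_basis[of 1 2 k f]
        by (auto simp: numeral_2_eq_2)
      ultimately show ?thesis
        by simp
    qed
    have "f (basis 1) \<in> topspace (X_complex G)" "w \<in> cell_verts (f (basis 1))"
      using singular_simplex_mem[OF f] w[OF funcset_mem[OF V(2)]] by auto
    \<comment> \<open>With one \<open>w\<close> for all faces, the links at corners 0 and 2 occur
      twice in the same direction and cancel; corner 1 is both an end of face 2 and a start of face
      0, so its links occur in both directions.\<close>
    then have sym: "link (?v 1) w + link w (?v 1) \<in> boundaries1"
      using vertex_of_mem cell_verts_linked by (intro link_sym) blast
    have "link_of (singular_face 2 0 f) + (link (?v 1) w + link w (?v 2)) \<in> boundaries1"
      "link_of (singular_face 2 1 f) + (link (?v 0) w + link w (?v 2)) \<in> boundaries1"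
      "link_of (singular_face 2 2 f) + (link (?v 0) w + link w (?v 1)) \<in> boundaries1"
      using face[of 0] face[of 1] face[of 2] by simp_all
    from boundaries1_add[OF boundaries1_add[OF this(1,2)] boundaries1_add[OF this(3) sym]]
    have "link_of (singular_face 2 0 f) + link_of (singular_face 2 1 f) + link_of (singular_face 2 2 f) \<in> boundaries1"
      by (simp add: add_ac)
    then show ?case
      unfolding singular_boundary2_2 by simp
  next
    case zero
    then show ?case
      using additive_set_0[OF additive_boundaries1] by simp
  next
    case (add a b)
    from boundaries1_add[OF add] show ?case
      by simp
  qed
qed

section \<open>The maps between discrete and small singular chains as inverses modulo
  boundaries\<close>

lemma Phi_small:
  assumes "c \<in> cube_chains 1 G"
  shows "Phi c \<in> small_chains2 cover 1 (X_complex G)"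
  using assms
proof (induction c rule: cube_chain_induct)
  case (edge u v)
  have "gen (half_edge x y) \<in> small_chains2 cover 1 (X_complex G)" if "(x, y) \<in> adj G" "x \<noteq> y" for x y
    using half_edge(1,2)[OF that] by (auto simp: small_chains2_def cover_def)
  with edge adj_sym have "gen (half_edge u v) \<in> small_chains2 cover 1 (X_complex G)"
    "gen (half_edge v u) \<in> small_chains2 cover 1 (X_complex G)"
    by auto
  then show ?case
    unfolding Phi_edge_chain edge_simplices_def by (rule additive_set_add[OF additive_small_chains2])
qed (simp_all add: additive_set_0 additive_set_add additive_small_chains2)

text \<open>The common midpoint of the two halves cancels. The right-hand side depends linearly on
  the discrete boundary, so cycles go to cycles.\<close>

lemma Phi_boundary:
  assumes "c \<in> cube_chains 1 G"
  shows "singular_boundary2 1 (Phi c)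
    = linear_extension (\<lambda>A. gen (point_simplex (Inl (Inl (A []))))) (cube_boundary 1 c)"
  using assms
proof (induction c rule: cube_chain_induct)
  case (edge u v)
  note e = half_edge[OF edge] half_edge[OF adj_sym[OF edge(1)] edge(2)[symmetric]]
  have "singular_boundary2 1 (edge_simplices u v)
      = gen (point_simplex (Inl (Inl u))) + gen (point_simplex (Inl (Inl v)))"
    unfolding edge_simplices_def singular_boundary2_add singular_boundary2_1 e(3,4,8)
    by (simp add: add_ac)
  then show ?case
    unfolding Phi_edge_chain cube_boundary_edge_chain by (simp add: vert_chain_def cube0_def)
qed simp_all

text \<open>The half at \<open>u\<close> may be routed through \<open>u\<close>, since it lies in
  that sector, and likewise at \<open>v\<close>. What remains is a path from \<open>u\<close> to
  \<open>v\<close> through the vertex \<open>q\<close> chosen for the midpoint, and \<open>q\<close>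
  is \<open>u\<close> or \<open>v\<close>.\<close>

lemma Psi_Phi:
  assumes "c \<in> cube_chains 1 G"
  shows "Psi (Phi c) + c \<in> boundaries1"
  using assms
proof (induction c rule: cube_chain_induct)
  case (edge u v)
  define q where "q = vertex_of (half_edge u v (basis 1))"
  have half: "link_of (half_edge x y) + link x (vertex_of (half_edge x y (basis 1))) \<in> boundaries1"
    if xy: "(x, y) \<in> adj G" "x \<noteq> y" for x y
  proof -
    note h = half_edge[OF xy]
    have "vertex_of (Inl (Inl x)) = x"
      by (simp add: vertex_of_def)
    moreover have "link_of (half_edge x y) + (link (vertex_of (half_edge x y (basis 0))) x
        + link x (vertex_of (half_edge x y (basis 1)))) \<in> boundaries1"
      by (rule link_of_via[OF h(1)]) (use h(2) sector_subset in blast)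
    ultimately have "link_of (half_edge x y) + (link x x + link x (vertex_of (half_edge x y (basis 1)))) \<in> boundaries1"
      using h(3) by simp
    from boundaries1_add[OF this link_same[OF conjunct1[OF adj_verts[OF xy(1)]]]] show ?thesis
      by (simp add: add_ac)
  qed
  note e = half_edge[OF edge]
  have top: "half_edge u v (basis 1) \<in> topspace (X_complex G)"
    using e(1) by (rule singular_simplex_mem) simp
  have q: "q \<in> {u, v}"
    using vertex_of_mem[OF top] e(5) by (simp add: q_def)
  have "cluster {u, v}"
    using cluster_cell_verts[OF top] e(5) by simp
  then have "link u q + link q v + link u v \<in> boundaries1"
    using q by (intro link_cocycle) auto
  moreover have "link v q + link q v \<in> boundaries1"
    using cell_verts_linked[OF top] q e(5) by (intro link_sym) auto
  moreover have "link_of (half_edge u v) + link u q \<in> boundaries1"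
    using half[OF edge] by (simp add: q_def)
  moreover have "link_of (half_edge v u) + link v q \<in> boundaries1"
    using half[OF adj_sym[OF edge(1)] edge(2)[symmetric]] e(4) by (simp add: q_def)
  moreover have "link u v + edge_chain u v \<in> boundaries1"
    using edge(1) by (rule link_adj)
  ultimately have "link u q + link q v + link u v + (link v q + link q v + (link_of (half_edge u v) + link u q
      + (link_of (half_edge v u) + link v q + (link u v + edge_chain u v)))) \<in> boundaries1"
    by (meson boundaries1_add)
  then show ?case
    unfolding Phi_edge_chain edge_simplices_def by (simp add: add_ac)
next
  case zero
  then show ?case
    using additive_set_0[OF additive_boundaries1] by simp
next
  case (add a b)
  from boundaries1_add[OF add] show ?case
    by (simp add: add_ac)
qed

text \<open>The image of a simplex starts and ends at chosen vertices rather than at its own end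
  points; the rays joining these give the correction term. It is linear in the boundary of
  \<open>c\<close>, hence zero on cycles.\<close>

lemma Phi_Psi:
  assumes "c \<in> small_chains2 cover 1 (X_complex G)"
  shows "Psi c \<in> cube_chains 1 G \<and>
    cube_boundary 1 (Psi c) = linear_extension (\<lambda>f. vert_chain (vertex_of (f (basis 0)))) (singular_boundary2 1 c) \<and>
    c + Phi (Psi c) + linear_extension (\<lambda>f. ray_simplex (f (basis 0)) (vertex_of (f (basis 0)))) (singular_boundary2 1 c)
      \<in> bounds"
    (is "?P c")
proof -
  have "Poly_Mapping.keys c
      \<subseteq> {f. singular_simplex 1 (X_complex G) f \<and> (\<exists>V\<in>cover. f \<in> standard_simplex 1 \<rightarrow> V)}"
    using assms by (simp add: small_chains2_def)
  then show ?thesis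
  proof (induction c rule: bit_chain_induct)
    case zero
    then show ?case
      using bounds_0 additive_set_0[OF additive_cube_chains] by simp
  next
    case (add a b)
    let ?R = "linear_extension (\<lambda>f. ray_simplex (f (basis 0)) (vertex_of (f (basis 0))))"
    have "(a + Phi (Psi a) + ?R (singular_boundary2 1 a)) + (b + Phi (Psi b) + ?R (singular_boundary2 1 b)) \<in> bounds"
      using add by (blast intro: bounds_add)
    moreover have "Psi a + Psi b \<in> cube_chains 1 G"
      using add by (blast intro: additive_set_add[OF additive_cube_chains])
    ultimately show ?case
      using add unfolding linear_extension_add singular_boundary2_add cube_boundary_add Phi_add
      by (simp add: add_ac)
  next
    case (single f)
    then obtain V where f: "singular_simplex 1 (X_complex G) f" and V: "V \<in> cover" "f \<in> standard_simplex 1 \<rightarrow> V"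
      by blast
    from V(1) obtain w where w: "\<And>x. x \<in> V \<Longrightarrow> w \<in> cell_verts x"
      and bound: "gen f + ray_simplex (f (basis 0)) w + ray_simplex (f (basis 1)) w \<in> bounds"
      by (rule cell_verts_cover) (use f V(2) in blast)
    have wf: "w \<in> cell_verts (f s)" if "s \<in> standard_simplex 1" for s
      using that w V(2) by blast
    let ?x = "f (basis 0)" and ?y = "f (basis 1)"
    have top: "?x \<in> topspace (X_complex G)" "?y \<in> topspace (X_complex G)"
      using f by (auto intro: singular_simplex_mem)
    have wxy: "w \<in> cell_verts ?x" "w \<in> cell_verts ?y"
      using wf by simp_all
    have "ray_simplex ?x (vertex_of ?x) + ray_simplex ?x w + Phi (link (vertex_of ?x) w) \<in> bounds"
      by (rule ray_simplex_link[OF top(1) vertex_of_mem[OF top(1)] wxy(1)])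
    moreover have "ray_simplex ?y w + ray_simplex ?y (vertex_of ?y) + Phi (link w (vertex_of ?y)) \<in> bounds"
      by (rule ray_simplex_link[OF top(2) wxy(2) vertex_of_mem[OF top(2)]])
    moreover have "Phi (link_of f + (link (vertex_of ?x) w + link w (vertex_of ?y))) \<in> bounds"
      by (rule Phi_boundaries1[OF link_of_via[OF f wf]])
    \<comment> \<open>Rays to \<open>w\<close> and links at \<open>w\<close> occur twice each, so
      \<open>w\<close> drops out of the sum.\<close>
    ultimately have "(gen f + ray_simplex ?x w + ray_simplex ?y w)
        + (ray_simplex ?x (vertex_of ?x) + ray_simplex ?x w + Phi (link (vertex_of ?x) w)
        + (ray_simplex ?y w + ray_simplex ?y (vertex_of ?y) + Phi (link w (vertex_of ?y))
        + Phi (link_of f + (link (vertex_of ?x) w + link w (vertex_of ?y))))) \<in> bounds"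
      using bound by (meson bounds_add)
    then have "gen f + Phi (link_of f) + (ray_simplex ?x (vertex_of ?x) + ray_simplex ?y (vertex_of ?y)) \<in> bounds"
      by (simp add: add_ac)
    then show ?case
      using link_of_mem[OF f wf] unfolding singular_boundary2_1 by (simp add: point_simplex_def)
  qed
qed

lemma discrete_homology_iso:
  "\<exists>h. h \<in> linear_isos (discrete_homology 1 G) (singular_homology2 1 (X_complex G))"
proof -
  let ?Z = "{c \<in> singular_chains2 1 (X_complex G). singular_boundary2 1 c = 0}"
  have hom: "singular_homology2 1 (X_complex G) = quotient_space ?Z bounds"
    by (simp add: singular_homology2_def singular_boundaries2_def)
  have "\<exists>h. h \<in> linear_isos (quotient_space cycles1 boundaries1) (quotient_space ?Z bounds)"
  proof (rule quotient_space_iso)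
    show "additive_set ?Z"
      by (intro additive_set_kernel additive_singular_chains2) simp
    show "Phi (x + y) = Phi x + Phi y" for x y
      by simp
    fix z assume z: "z \<in> cycles1"
    then have zc: "z \<in> cube_chains 1 G"
      by simp
    note small = Phi_small[OF zc]
    show "Phi z \<in> ?Z"
      using small small_chains2_subset z Phi_boundary[OF zc] by auto
    show "Phi z \<in> bounds \<longleftrightarrow> z \<in> boundaries1"
    proof
      assume "Phi z \<in> bounds"
      \<comment> \<open>A small filling is needed because \<open>Psi\<close> is controlled only on
        small chains: it makes \<open>Psi (Phi z)\<close> a boundary, and \<open>z\<close> differs
        from that by a boundary.\<close>
      then obtain b where b: "b \<in> small_chains2 cover (Suc 1) (X_complex G)" "singular_boundary2 (Suc 1) b = Phi z"
        using small_boundary[OF openin_cover cover_covers small] by metis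
      from boundaries1_add[OF Psi_small_boundary[OF b(1)] Psi_Phi[OF zc]] show "z \<in> boundaries1"
        unfolding b(2) by simp
    qed (rule Phi_boundaries1)
  next
    fix c assume "c \<in> ?Z"
    then obtain c' where c': "c' \<in> small_chains2 cover 1 (X_complex G)" "singular_boundary2 1 c' = 0" "c + c' \<in> bounds"
      using homologous_small_cycle[OF openin_cover cover_covers] by blast
    note P = Phi_Psi[OF c'(1), unfolded c'(2) linear_extension_0]
    have "(c + c') + (c' + Phi (Psi c') + 0) \<in> bounds"
      using P c'(3) by (blast intro: bounds_add)
    then have "c + Phi (Psi c') \<in> bounds"
      by (simp add: add_ac)
    then show "\<exists>z\<in>cycles1. c + Phi z \<in> bounds"
      using P by (intro bexI[of _ "Psi c'"]) auto
  qed (rule additive_cycles1 additive_boundaries1 additive_singular_boundaries2)+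
  then show ?thesis
    unfolding discrete_homology_1 hom .
qed

end

theorem theorem3p4:
  fixes G :: "'a rgraph"
  assumes "graph G" and "connected_graph G"
  shows "\<exists>h. h \<in> linear_isos (discrete_homology 1 G) (singular_homology2 1 (X_complex G))"
proof -
  interpret reflexive_graph G
    by unfold_locales fact
  show ?thesis
    by (rule discrete_homology_iso)
qed

end
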